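(* Let $A=[a_{ij}]_{i,j\in I}$ be a symmetrizable generalized Cartan matrix symmetrized by $\{d_i\}_{i\in I}$, with a root datum $(Y,X,\langle\,,\rangle,\{\alpha_i^\vee\},\{\alpha_i\})$ of type $A$, and let integers $\epsilon_{ij}$ ($i,j\in I$) satisfy: $\epsilon_{ij}=\pm1$ and $\epsilon_{ji}=-\epsilon_{ij}$ if $i\ne j$ and $a_{ij}\ne0$, and $\epsilon_{ij}=0$ otherwise. Let $f_{i1},f_{i2}$, $g_i=f_{i1}^{-1}f_{i2}$, $\mathcal A_q\subset Q(\widetilde{\mathcal A}_q)$ be as defined in the context. For $i,j\in I$ set $$\phi_{ij}(x)=\begin{cases}\displaystyle g_j\left(\prod_{\nu=0}^{-a_{ij}-1}\frac{1+q_i^{2\nu}g_i}{1+q_i^{2\nu}x^{-2}g_i}\right)&\text{if }\epsilon_{ij}=+1,\\[3mm]\displaystyle x^{2(-a_{ij})}\left(\prod_{\nu=0}^{-a_{ij}-1}\frac{1+q_i^{2\nu}x^{-2}g_i}{1+q_i^{2\nu}g_i}\right)g_j&\text{if }\epsilon_{ij}=-1,\\[3mm]x^{-2}g_i&\text{if }i=j,\\ g_j&\text{if }a_{ij}=0.\end{cases}$$ Then $(f_{i1}+f_{i2})^ng_j(f_{i1}+f_{i2})^{-n}=\phi_{ij}(q_i^n)$ in $Q(\widetilde{\mathcal A}_q)$ for all $n\in\mathbb Z$ and $i,j\in I$. Moreover, for every $i\in I$ and $\lambda\in Y$ there is a well-defined (unique) algebra automorphism $\gamma((f_{i1}+f_{i2})^\lambda)$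 of $Q(\mathcal A_q)$ such that $\gamma((f_{i1}+f_{i2})^\lambda)(g_j)=\phi_{ij}(q_i^\lambda)$ for $j\in I$ and $\gamma((f_{i1}+f_{i2})^\lambda)(q^\mu)=q^\mu$ for $\mu\in d^{-1}Y$.
   Context: Generalized Cartan matrix: a matrix $A=[a_{ij}]_{i,j\in I}$ ($I$ finite) of integers with $a_{ii}=2$, $a_{ij}\le 0$ for $i\ne j$, and $a_{ij}=0\iff a_{ji}=0$. It is symmetrized by positive rationals $\{d_i\}$ if $d_ia_{ij}=d_ja_{ji}$ for all $i,j$. A root datum of type $A$: finitely generated free $\mathbb Z$-modules $X,Y$, a perfect bilinear pairing $\langle\,,\rangle:Y\times X\to\mathbb Z$, and families $\alpha_i^\vee\in Y$, $\alpha_i\in X$ with $\langle\alpha_i^\vee,\alpha_j\rangle=a_{ij}$. Let $d$ be the least common denominator of the $d_i$, $\mathbb F=\mathbb Q(q^{1/d})$ ($q^{1/d}$ an indeterminate), $q_i=q^{d_i}$; extend the pairing to $d^{-1}Y\times X\to d^{-1}\mathbb Z$. $U_q^0=\bigoplus_{\lambda\in d^{-1}Y}\mathbb Fq^\lambda$ is the group algebra of $d^{-1}Y$; for $\lambda\in Y$, $q_i^\lambda=q^{d_i\lambda}\in U_q^0$. $\mathcal B_q$ is the $\mathbb F$-algebra generated by $f_i$ ($i\in I$) and $q^\lambda$ ($\lambda\in d^{-1}Y$) with relations: $q^0=1$, $q^\lambda q^\mu=q^{\lambda+\mu}$, $q^\lambda f_iq^{-\lambda}=q^{-\langle\lambda,\alpha_i\rangle}f_i$,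 $f_if_j=q_i^{-\epsilon_{ij}a_{ij}}f_jf_i$. Put $k_i=q^{d_i\alpha_i^\vee}\in\mathcal B_q$ and, in $\mathcal B_q\otimes\mathcal B_q$, $f_{i1}=f_i\otimes1$, $f_{i2}=k_i^{-1}\otimes f_i$. Let $\widetilde{\mathcal A}_{q,0}$ be the subalgebra of $\mathcal B_q\otimes\mathcal B_q$ generated by all $f_{i1},f_{i2}$, and $\widetilde{\mathcal A}_q=\widetilde{\mathcal A}_{q,0}\otimes U_q^0$ (so the $q^\lambda\in U_q^0$ commute with the $f_{i1},f_{i2}$). $\widetilde{\mathcal A}_q$ is an Ore domain with skew field of fractions $Q(\widetilde{\mathcal A}_q)$. $\mathcal A_q$ is the subalgebra of $Q(\widetilde{\mathcal A}_q)$ generated by the $g_i=f_{i1}^{-1}f_{i2}$ ($i\in I$) and $q^\lambda$ ($\lambda\in d^{-1}Y$); it is an Ore domain with skew field of fractions $Q(\mathcal A_q)\subset Q(\widetilde{\mathcal A}_q)$. All factors in each product defining $\phi_{ij}$ commute, so the fractions are unambiguous ($x$ is a central variable, later specialized to $q_i^n$ or $q_i^\lambda$). *)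

theory Defs
  imports
    "HOL-Algebra.Algebraic_Closure_Type"
    "HOL-Algebra.QuotRing"
    "HOL-Algebra.Generated_Rings"
    "HOL-Algebra.Module"
    "HOL-Computational_Algebra.Fraction_Field"
    "HOL-Computational_Algebra.Polynomial"
    "HOL-Library.FuncSet"
begin

section \<open>Finitely generated free abelian groups and root data\<close>

definition additive_group :: "'a::ab_group_add monoid" where
  "additive_group = \<lparr>carrier = UNIV, monoid.mult = (+), one = 0\<rparr>"

definition zmul :: "int \<Rightarrow> 'a::ab_group_add \<Rightarrow> 'a" where
  "zmul n y = y [^]\<^bsub>additive_group\<^esub> n"

lemma comm_group_additive_group: "comm_group additive_group"
  by (rule comm_groupI) (auto simp: additive_group_def add_ac intro: exI[of _ "- x" for x])

lemma module_zmul: "Modules.module zmul"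
proof -
  interpret comm_group "additive_group :: 'a monoid" by (rule comm_group_additive_group)
  have c: "x \<in> carrier additive_group" for x :: 'a by (simp add: additive_group_def)
  have m: "x \<otimes>\<^bsub>additive_group\<^esub> y = x + y" for x y :: 'a by (simp add: additive_group_def)
  show "Modules.module (zmul :: int \<Rightarrow> 'a \<Rightarrow> 'a)"
  proof (unfold_locales, unfold zmul_def)
    fix a b :: int and x y :: 'a
    show "(x + y) [^]\<^bsub>additive_group\<^esub> a = x [^]\<^bsub>additive_group\<^esub> a + y [^]\<^bsub>additive_group\<^esub> a"
      using int_pow_distrib[OF c c, of x y a] by (simp add: m)
    show "x [^]\<^bsub>additive_group\<^esub> (a + b) = x [^]\<^bsub>additive_group\<^esub> a + x [^]\<^bsub>additive_group\<^esub> b"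
      using int_pow_mult[OF c, of x a b] by (simp add: m)
    show "(x [^]\<^bsub>additive_group\<^esub> b) [^]\<^bsub>additive_group\<^esub> a = x [^]\<^bsub>additive_group\<^esub> (a * b)"
      using int_pow_pow[OF c, of x b a] by (simp add: mult.commute)
    show "x [^]\<^bsub>additive_group\<^esub> (1::int) = x"
      using int_pow_1[OF c] by simp
  qed
qed

definition fg_free :: "'a::ab_group_add itself \<Rightarrow> bool" where
  "fg_free _ \<longleftrightarrow> (\<exists>B :: 'a set. finite B \<and> \<not> Modules.module.dependent zmul B
                      \<and> Modules.module.span zmul B = UNIV)"

record ('i, 'x, 'y) quantum_datum =
  cartan :: "'i \<Rightarrow> 'i \<Rightarrow> int"
  symm :: "'i \<Rightarrow> rat"
  pairing :: "'y \<Rightarrow> 'x \<Rightarrow> int"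
  coroot :: "'i \<Rightarrow> 'y"
  sroot :: "'i \<Rightarrow> 'x"
  orient :: "'i \<Rightarrow> 'i \<Rightarrow> int"

definition generalized_cartan_matrix :: "('i \<Rightarrow> 'i \<Rightarrow> int) \<Rightarrow> bool" where
  "generalized_cartan_matrix a \<longleftrightarrow>
     (\<forall>i. a i i = 2) \<and> (\<forall>i j. i \<noteq> j \<longrightarrow> a i j \<le> 0) \<and> (\<forall>i j. a i j = 0 \<longleftrightarrow> a j i = 0)"

definition symmetrized_by :: "('i \<Rightarrow> 'i \<Rightarrow> int) \<Rightarrow> ('i \<Rightarrow> rat) \<Rightarrow> bool" where
  "symmetrized_by a d \<longleftrightarrow>
     (\<forall>i. d i > 0) \<and> (\<forall>i j. d i * of_int (a i j) = d j * of_int (a j i))"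

definition perfect_pairing :: "('y::ab_group_add \<Rightarrow> 'x::ab_group_add \<Rightarrow> int) \<Rightarrow> bool" where
  "perfect_pairing p \<longleftrightarrow>
     (\<forall>y. Modules.additive (\<lambda>x. p y x)) \<and> (\<forall>x. Modules.additive (\<lambda>y. p y x)) \<and>
     (\<forall>u. Modules.additive u \<longrightarrow> (\<exists>!y. \<forall>x. u x = p y x)) \<and>
     (\<forall>u. Modules.additive u \<longrightarrow> (\<exists>!x. \<forall>y. u y = p y x))"

definition root_datum :: "('i, 'x::ab_group_add, 'y::ab_group_add) quantum_datum \<Rightarrow> bool" where
  "root_datum D \<longleftrightarrow> fg_free TYPE('x) \<and> fg_free TYPE('y) \<and> perfect_pairing (pairing D) \<and>
     (\<forall>i j. pairing D (coroot D i) (sroot D j) = cartan D i j)"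

definition orientation :: "('i \<Rightarrow> 'i \<Rightarrow> int) \<Rightarrow> ('i \<Rightarrow> 'i \<Rightarrow> int) \<Rightarrow> bool" where
  "orientation a \<epsilon> \<longleftrightarrow>
     (\<forall>i j. if i \<noteq> j \<and> a i j \<noteq> 0 then (\<epsilon> i j = 1 \<or> \<epsilon> i j = -1) \<and> \<epsilon> j i = - \<epsilon> i j
            else \<epsilon> i j = 0)"

definition quantum_datum :: "('i::finite, 'x::ab_group_add, 'y::ab_group_add) quantum_datum \<Rightarrow> bool" where
  "quantum_datum D \<longleftrightarrow> generalized_cartan_matrix (cartan D) \<and>
     symmetrized_by (cartan D) (symm D) \<and> root_datum D \<and> orientation (cartan D) (orient D)"

section \<open>The base field\<close>

text \<open>The field \<open>\<rat>(q^(1/d))\<close>; the indeterminate of the polynomial ring is \<open>q^(1/d)\<close>.\<close>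

type_synonym qfield = "rat poly fract"

definition qroot :: qfield where
  "qroot = Fract [:0, 1:] 1"

definition lcd :: "('i::finite, 'x, 'y) quantum_datum \<Rightarrow> int" where
  "lcd D = Lcm (range (\<lambda>i. snd (quotient_of (symm D i))))"

text \<open>The integer \<open>d d\<^sub>i\<close>, so that \<open>q\<^sub>i = q^(d\<^sub>i) = (q^(1/d))^(d d\<^sub>i)\<close>.\<close>

definition wt :: "('i::finite, 'x, 'y) quantum_datum \<Rightarrow> 'i \<Rightarrow> int" where
  "wt D i = \<lfloor>of_int (lcd D) * symm D i\<rfloor>"

definition qi :: "('i::finite, 'x, 'y) quantum_datum \<Rightarrow> 'i \<Rightarrow> qfield" where
  "qi D i = qroot powi wt D i"

section \<open>Associative unital algebras over a field\<close>

text \<open>An algebra over a field given as a type is a ring record together with the scalar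
  multiplication \<^const>\<open>module.smult\<close>.\<close>

definition monoid_algebra :: "('m, 'z) monoid_scheme \<Rightarrow> ('f::field, 'm \<Rightarrow> 'f) module" where
  "monoid_algebra M =
     \<lparr>carrier = {u. finite {m. u m \<noteq> 0} \<and> {m. u m \<noteq> 0} \<subseteq> carrier M},
      monoid.mult = (\<lambda>u w m. \<Sum>(a, b)\<in>{(a, b). u a \<noteq> 0 \<and> w b \<noteq> 0 \<and> a \<otimes>\<^bsub>M\<^esub> b = m}. u a * w b),
      one = (\<lambda>m. if m = \<one>\<^bsub>M\<^esub> then 1 else 0),
      zero = (\<lambda>m. 0),
      add = (\<lambda>u w m. u m + w m),
      module.smult = (\<lambda>c u m. c * u m)\<rparr>"

definition mbasis :: "'m \<Rightarrow> 'm \<Rightarrow> 'f::field" where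
  "mbasis m = (\<lambda>m'. if m' = m then 1 else 0)"

definition quot_algebra :: "('f, 'a) module \<Rightarrow> 'a set \<Rightarrow> ('f, 'a set) module" where
  "quot_algebra R I =
     ring.extend (R Quot I) (module.fields (\<lambda>c C. \<Union>x\<in>C. I +>\<^bsub>R\<^esub> (c \<odot>\<^bsub>R\<^esub> x)))"

definition subalgebra_gen :: "('f, 'a) module \<Rightarrow> 'a set \<Rightarrow> 'a set" where
  "subalgebra_gen R S = generate_ring R (range (\<lambda>c. c \<odot>\<^bsub>R\<^esub> \<one>\<^bsub>R\<^esub>) \<union> S)"

text \<open>Tensor product of algebras over the field: the vector space with basis the pairs
  \<open>(a, b)\<close>, multiplied componentwise, modulo the bilinearity relations.  The span of
  these relations is already stable under left and right multiplication by pairs, so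
  generating an ideal adds nothing to it.\<close>

definition tensor_rels :: "('f::field, 'a) module \<Rightarrow> ('f, 'b) module \<Rightarrow> ('a \<times> 'b \<Rightarrow> 'f) set" where
  "tensor_rels R S =
    (let T = monoid_algebra (R \<times>\<times> S) in
      {mbasis (a \<oplus>\<^bsub>R\<^esub> a', b) \<ominus>\<^bsub>T\<^esub> (mbasis (a, b) \<oplus>\<^bsub>T\<^esub> mbasis (a', b)) | a a' b.
          a \<in> carrier R \<and> a' \<in> carrier R \<and> b \<in> carrier S} \<union>
      {mbasis (a, b \<oplus>\<^bsub>S\<^esub> b') \<ominus>\<^bsub>T\<^esub> (mbasis (a, b) \<oplus>\<^bsub>T\<^esub> mbasis (a, b')) | a b b'.
          a \<in> carrier R \<and> b \<in> carrier S \<and> b' \<in> carrier S} \<union>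
      {mbasis (c \<odot>\<^bsub>R\<^esub> a, b) \<ominus>\<^bsub>T\<^esub> (c \<odot>\<^bsub>T\<^esub> mbasis (a, b)) | c a b.
          a \<in> carrier R \<and> b \<in> carrier S} \<union>
      {mbasis (a, c \<odot>\<^bsub>S\<^esub> b) \<ominus>\<^bsub>T\<^esub> (c \<odot>\<^bsub>T\<^esub> mbasis (a, b)) | c a b.
          a \<in> carrier R \<and> b \<in> carrier S})"

definition tensor_ideal :: "('f::field, 'a) module \<Rightarrow> ('f, 'b) module \<Rightarrow> ('a \<times> 'b \<Rightarrow> 'f) set" where
  "tensor_ideal R S = Idl\<^bsub>monoid_algebra (R \<times>\<times> S)\<^esub> (tensor_rels R S)"

definition tensor_algebra ::
  "('f::field, 'a) module \<Rightarrow> ('f, 'b) module \<Rightarrow> ('f, ('a \<times> 'b \<Rightarrow> 'f) set) module" where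
  "tensor_algebra R S = quot_algebra (monoid_algebra (R \<times>\<times> S)) (tensor_ideal R S)"

definition tensor ::
  "('f::field, 'a) module \<Rightarrow> ('f, 'b) module \<Rightarrow> 'a \<Rightarrow> 'b \<Rightarrow> ('a \<times> 'b \<Rightarrow> 'f) set" where
  "tensor R S a b = tensor_ideal R S +>\<^bsub>monoid_algebra (R \<times>\<times> S)\<^esub> mbasis (a, b)"

section \<open>The algebras \<open>U\<^sub>q\<^sup>0\<close>, \<open>\<B>\<^sub>q\<close> and \<open>\<A>~\<^sub>q\<close>\<close>

text \<open>The lattice \<open>d\<^sup>-\<^sup>1Y\<close> is represented by \<open>Y\<close> itself through multiplication by \<open>d\<close>: the
  element \<open>y :: 'y\<close> stands for \<open>d\<^sup>-\<^sup>1y\<close>.  Hence \<open>\<lambda> \<in> Y\<close>, seen in \<open>d\<^sup>-\<^sup>1Y\<close>, is \<open>zmul (lcd D) \<lambda>\<close>,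
  the element \<open>d\<^sub>i\<lambda>\<close> is \<open>zmul (wt D i) \<lambda>\<close>, and for \<open>\<mu> \<in> d\<^sup>-\<^sup>1Y\<close> represented by \<open>y\<close> one has
  \<open>q^\<langle>\<mu>,x\<rangle> = (q^(1/d))^\<langle>y,x\<rangle>\<close>.\<close>

definition Uq0 :: "(qfield, 'y::ab_group_add \<Rightarrow> qfield) module" where
  "Uq0 = monoid_algebra additive_group"

datatype ('i, 'y) bq_gen = FGen 'i | QGen 'y

definition word_monoid :: "'g list monoid" where
  "word_monoid = \<lparr>carrier = UNIV, monoid.mult = (@), one = []\<rparr>"

abbreviation free_algebra :: "(qfield, 'g list \<Rightarrow> qfield) module" where
  "free_algebra \<equiv> monoid_algebra word_monoid"

type_synonym ('i, 'y) bq_elem = "(('i, 'y) bq_gen list \<Rightarrow> qfield) set"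
type_synonym ('i, 'y) bqbq_elem = "(('i, 'y) bq_elem \<times> ('i, 'y) bq_elem \<Rightarrow> qfield) set"
type_synonym ('i, 'y) aqt_elem = "(('i, 'y) bqbq_elem \<times> ('y \<Rightarrow> qfield) \<Rightarrow> qfield) set"

definition Bq_rels ::
  "('i::finite, 'x::ab_group_add, 'y::ab_group_add) quantum_datum \<Rightarrow>
     (('i, 'y) bq_gen list \<Rightarrow> qfield) set" where
  "Bq_rels D =
     {mbasis [QGen 0] \<ominus>\<^bsub>free_algebra\<^esub> \<one>\<^bsub>free_algebra\<^esub>} \<union>
     {mbasis [QGen y, QGen z] \<ominus>\<^bsub>free_algebra\<^esub> mbasis [QGen (y + z)] | y z. True} \<union>
     {mbasis [QGen y, FGen i, QGen (- y)] \<ominus>\<^bsub>free_algebra\<^esub>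
        (qroot powi (- pairing D y (sroot D i))) \<odot>\<^bsub>free_algebra\<^esub> mbasis [FGen i] | y i. True} \<union>
     {mbasis [FGen i, FGen j] \<ominus>\<^bsub>free_algebra\<^esub>
        (qi D i powi (- orient D i j * cartan D i j)) \<odot>\<^bsub>free_algebra\<^esub> mbasis [FGen j, FGen i]
        | i j. True}"

definition Bq_ideal ::
  "('i::finite, 'x::ab_group_add, 'y::ab_group_add) quantum_datum \<Rightarrow>
     (('i, 'y) bq_gen list \<Rightarrow> qfield) set" where
  "Bq_ideal D = Idl\<^bsub>free_algebra\<^esub> (Bq_rels D)"

definition Bq ::
  "('i::finite, 'x::ab_group_add, 'y::ab_group_add) quantum_datum \<Rightarrow>
     (qfield, ('i, 'y) bq_elem) module" where
  "Bq D = quot_algebra free_algebra (Bq_ideal D)"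

definition Bq_f ::
  "('i::finite, 'x::ab_group_add, 'y::ab_group_add) quantum_datum \<Rightarrow> 'i \<Rightarrow> ('i, 'y) bq_elem" where
  "Bq_f D i = Bq_ideal D +>\<^bsub>free_algebra\<^esub> mbasis [FGen i]"

definition Bq_q ::
  "('i::finite, 'x::ab_group_add, 'y::ab_group_add) quantum_datum \<Rightarrow> 'y \<Rightarrow> ('i, 'y) bq_elem" where
  "Bq_q D y = Bq_ideal D +>\<^bsub>free_algebra\<^esub> mbasis [QGen y]"

definition Bq_k ::
  "('i::finite, 'x::ab_group_add, 'y::ab_group_add) quantum_datum \<Rightarrow> 'i \<Rightarrow> ('i, 'y) bq_elem" where
  "Bq_k D i = Bq_q D (zmul (wt D i) (coroot D i))"

definition BqBq ::
  "('i::finite, 'x::ab_group_add, 'y::ab_group_add) quantum_datum \<Rightarrow> (qfield, ('i, 'y) bqbq_elem) module" where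
  "BqBq D = tensor_algebra (Bq D) (Bq D)"

definition Aqt0_f1 ::
  "('i::finite, 'x::ab_group_add, 'y::ab_group_add) quantum_datum \<Rightarrow> 'i \<Rightarrow> ('i, 'y) bqbq_elem" where
  "Aqt0_f1 D i = tensor (Bq D) (Bq D) (Bq_f D i) \<one>\<^bsub>Bq D\<^esub>"

definition Aqt0_f2 ::
  "('i::finite, 'x::ab_group_add, 'y::ab_group_add) quantum_datum \<Rightarrow> 'i \<Rightarrow> ('i, 'y) bqbq_elem" where
  "Aqt0_f2 D i = tensor (Bq D) (Bq D) (inv\<^bsub>Bq D\<^esub> Bq_k D i) (Bq_f D i)"

definition Aqt0 ::
  "('i::finite, 'x::ab_group_add, 'y::ab_group_add) quantum_datum \<Rightarrow> (qfield, ('i, 'y) bqbq_elem) module" where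
  "Aqt0 D = (BqBq D)\<lparr>carrier := subalgebra_gen (BqBq D) (range (Aqt0_f1 D) \<union> range (Aqt0_f2 D))\<rparr>"

definition Aqt ::
  "('i::finite, 'x::ab_group_add, 'y::ab_group_add) quantum_datum \<Rightarrow> (qfield, ('i, 'y) aqt_elem) module" where
  "Aqt D = tensor_algebra (Aqt0 D) Uq0"

definition Aqt_f1 ::
  "('i::finite, 'x::ab_group_add, 'y::ab_group_add) quantum_datum \<Rightarrow> 'i \<Rightarrow> ('i, 'y) aqt_elem" where
  "Aqt_f1 D i = tensor (Aqt0 D) Uq0 (Aqt0_f1 D i) \<one>\<^bsub>Uq0\<^esub>"

definition Aqt_f2 ::
  "('i::finite, 'x::ab_group_add, 'y::ab_group_add) quantum_datum \<Rightarrow> 'i \<Rightarrow> ('i, 'y) aqt_elem" where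
  "Aqt_f2 D i = tensor (Aqt0 D) Uq0 (Aqt0_f2 D i) \<one>\<^bsub>Uq0\<^esub>"

definition Aqt_q ::
  "('i::finite, 'x::ab_group_add, 'y::ab_group_add) quantum_datum \<Rightarrow> 'y \<Rightarrow> ('i, 'y) aqt_elem" where
  "Aqt_q D y = tensor (Aqt0 D) Uq0 \<one>\<^bsub>Aqt0 D\<^esub> (mbasis y)"

section \<open>Skew fields of fractions\<close>

text \<open>The type \<open>'k\<close>, with the embedding \<open>\<iota>\<close>, is a skew field of (right) fractions of \<open>R\<close>.  For an
  Ore domain such a pair exists and is unique up to unique isomorphism.\<close>

definition skew_field_of_fractions ::
  "('a, 'z) ring_scheme \<Rightarrow> ('a \<Rightarrow> 'k::division_ring) \<Rightarrow> bool" where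
  "skew_field_of_fractions R \<iota> \<longleftrightarrow>
     \<iota> \<in> ring_hom R ring_of_type_algebra \<and> inj_on \<iota> (carrier R) \<and>
     (\<forall>k. \<exists>a\<in>carrier R. \<exists>s\<in>carrier R - {\<zero>\<^bsub>R\<^esub>}. k = \<iota> a * inverse (\<iota> s))"

text \<open>From here on \<open>\<iota>\<close> is the embedding of \<^term>\<open>Aqt D\<close> into its skew field of fractions.\<close>

definition scal ::
  "('i::finite, 'x::ab_group_add, 'y::ab_group_add) quantum_datum \<Rightarrow> (('i, 'y) aqt_elem \<Rightarrow> 'k::division_ring) \<Rightarrow> qfield \<Rightarrow> 'k" where
  "scal D \<iota> c = \<iota> (c \<odot>\<^bsub>Aqt D\<^esub> \<one>\<^bsub>Aqt D\<^esub>)"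

definition f1 ::
  "('i::finite, 'x::ab_group_add, 'y::ab_group_add) quantum_datum \<Rightarrow> (('i, 'y) aqt_elem \<Rightarrow> 'k::division_ring) \<Rightarrow> 'i \<Rightarrow> 'k" where
  "f1 D \<iota> i = \<iota> (Aqt_f1 D i)"

definition f2 ::
  "('i::finite, 'x::ab_group_add, 'y::ab_group_add) quantum_datum \<Rightarrow> (('i, 'y) aqt_elem \<Rightarrow> 'k::division_ring) \<Rightarrow> 'i \<Rightarrow> 'k" where
  "f2 D \<iota> i = \<iota> (Aqt_f2 D i)"

definition qpow ::
  "('i::finite, 'x::ab_group_add, 'y::ab_group_add) quantum_datum \<Rightarrow> (('i, 'y) aqt_elem \<Rightarrow> 'k::division_ring) \<Rightarrow> 'y \<Rightarrow> 'k" where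
  "qpow D \<iota> y = \<iota> (Aqt_q D y)"

definition g ::
  "('i::finite, 'x::ab_group_add, 'y::ab_group_add) quantum_datum \<Rightarrow> (('i, 'y) aqt_elem \<Rightarrow> 'k::division_ring) \<Rightarrow> 'i \<Rightarrow> 'k" where
  "g D \<iota> i = inverse (f1 D \<iota> i) * f2 D \<iota> i"

definition Aq ::
  "('i::finite, 'x::ab_group_add, 'y::ab_group_add) quantum_datum \<Rightarrow> (('i, 'y) aqt_elem \<Rightarrow> 'k::division_ring) \<Rightarrow> 'k set" where
  "Aq D \<iota> = generate_ring ring_of_type_algebra
     (range (scal D \<iota>) \<union> range (g D \<iota>) \<union> range (qpow D \<iota>))"

definition QAq ::
  "('i::finite, 'x::ab_group_add, 'y::ab_group_add) quantum_datum \<Rightarrow> (('i, 'y) aqt_elem \<Rightarrow> 'k::division_ring) \<Rightarrow> 'k set" where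
  "QAq D \<iota> = {a * inverse s | a s. a \<in> Aq D \<iota> \<and> s \<in> Aq D \<iota> \<and> s \<noteq> 0}"

text \<open>Algebra automorphisms of a subring \<open>S\<close> that contains the scalars \<open>sc c\<close>;
  extensionality off \<open>S\<close> makes uniqueness meaningful.\<close>

definition algebra_auts :: "('f \<Rightarrow> 'k::division_ring) \<Rightarrow> 'k set \<Rightarrow> ('k \<Rightarrow> 'k) set" where
  "algebra_auts sc S =
     {\<sigma> \<in> ring_iso (ring_of_type_algebra\<lparr>carrier := S\<rparr>) (ring_of_type_algebra\<lparr>carrier := S\<rparr>).
        \<sigma> \<in> extensional S \<and> (\<forall>c. \<forall>x\<in>S. \<sigma> (sc c * x) = sc c * \<sigma> x)}"

text \<open>The factors of each product commute, so the order in \<^const>\<open>prod_list\<close> is immaterial.\<close>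

definition phi ::
  "('i::finite, 'x::ab_group_add, 'y::ab_group_add) quantum_datum \<Rightarrow>
     (('i, 'y) aqt_elem \<Rightarrow> 'k::division_ring) \<Rightarrow> 'i \<Rightarrow> 'i \<Rightarrow> 'k \<Rightarrow> 'k" where
  "phi D \<iota> i j x =
    (let m = - cartan D i j;
         qg = (\<lambda>\<nu>::nat. scal D \<iota> (qi D i ^ (2 * \<nu>)));
         num = (\<lambda>\<nu>. 1 + qg \<nu> * g D \<iota> i);
         den = (\<lambda>\<nu>. 1 + qg \<nu> * x powi (-2) * g D \<iota> i)
     in if orient D i j = 1 then
          g D \<iota> j * prod_list (map (\<lambda>\<nu>. num \<nu> * inverse (den \<nu>)) [0..<nat m])
        else if orient D i j = -1 then
          x powi (2 * m) * prod_list (map (\<lambda>\<nu>. den \<nu> * inverse (num \<nu>)) [0..<nat m]) * g D \<iota> j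
        else if i = j then x powi (-2) * g D \<iota> i
        else g D \<iota> j)"

end

(*
  Conjugation by F = f_i1 + f_i2 = f_i1 (1 + g_i) is computed from the q-commutation relations, and
  the products telescope: F phi_ij(x) F^-1 = phi_ij(q_i x) for every central x, which gives the
  formula for F^n.

  Now let P be a polynomial expression in the phi_ij(x), the q^mu and the scalars.  If P vanishes at
  one central x_0, then conjugation makes it vanish at all q_i^n x_0.  Up to a denominator
  without zeros P is a Laurent polynomial in x over the skew field, so it vanishes
  at every central x.  Comparing x = 1 with x = q_i^lambda, the substitution
  g_j |-> phi_ij(q_i^lambda) is a well-defined injective homomorphism on A_q; no presentation of
  A_q is needed.  A_q satisfies the Ore condition because it has polynomial growth, so the
  homomorphism extends to Q(A_q), and it is onto because phi_ij(q_i^-lambda) is sent to g_j.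

  That no f_ik vanishes, and hence that no denominator does, is seen from linear functionals built
  from two-dimensional representations of B_q.
*)
theory Submission
  imports Defs
begin

section \<open>Monoid algebras\<close>

text \<open>The variable x is never adjoined: it runs through the nonzero central elements of
  Q(A~_q) itself. Scalars are central there, and so are all q^\<mu>, since U_q^0 enters as a tensor
  factor. Hence q_i^n and q_i^\<lambda> are points of one set, and conjugation by F moves a point
  x_0 along the orbit q_i^n x_0, which is infinite because q_i is not a root of unity.

  The obstacle is the denominators. In sums and products of phi_ij(x) for several j, factors (1 + c
  g_i)^-1 are scattered between elements g_j that need not commute with them. All these factors lie
  in the double centralizer of g_i, which is commutative, closed under inverses, and stable under
  conjugation by nonzero elements that commute with g_i up to a scalar, in particular by every g_j.
  So denominators can be collected on the right and multiplied together.

  The values phi_ij(q_i^\<lambda>) carry denominators. Therefore the homomorphism is built from A_q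
  to the big skew field, and only afterwards is it shown to map Q(A_q) to itself.\<close>

definition lin :: "('m \<Rightarrow> 'f::field) \<Rightarrow> ('m \<Rightarrow> 'f) \<Rightarrow> 'f" where
  "lin \<theta> u = (\<Sum>m | u m \<noteq> 0. u m * \<theta> m)"

lemma lin_superset:
  assumes "finite S" "{m. u m \<noteq> 0} \<subseteq> S"
  shows "lin \<theta> u = (\<Sum>m\<in>S. u m * \<theta> m)"
  unfolding lin_def using assms by (intro sum.mono_neutral_left) auto

lemma lin_add:
  assumes "finite {m. u m \<noteq> 0}" "finite {m. w m \<noteq> 0}"
  shows "lin \<theta> (\<lambda>m. u m + w m) = lin \<theta> u + lin \<theta> w"
proof -
  let ?S = "{m. u m \<noteq> 0} \<union> {m. w m \<noteq> 0}"
  have "lin \<theta> (\<lambda>m. u m + w m) = (\<Sum>m\<in>?S. (u m + w m) * \<theta> m)"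
    using assms by (intro lin_superset) auto
  moreover have "lin \<theta> u = (\<Sum>m\<in>?S. u m * \<theta> m)" "lin \<theta> w = (\<Sum>m\<in>?S. w m * \<theta> m)"
    using assms by (intro lin_superset; auto)+
  ultimately show ?thesis by (simp add: distrib_right sum.distrib)
qed

lemma lin_smult: "lin \<theta> (\<lambda>m. c * u m) = c * lin \<theta> u"
  unfolding lin_def by (cases "c = 0") (auto simp: sum_distrib_left mult.assoc)

lemma lin_zero [simp]: "lin \<theta> (\<lambda>m. 0) = 0"
  by (simp add: lin_def)

lemma mbasis_nonzero [simp]: "mbasis m m' \<noteq> (0::'f::field) \<longleftrightarrow> m' = m"
  by (simp add: mbasis_def)

lemma lin_mbasis [simp]: "lin \<theta> (mbasis m) = \<theta> m"
  by (simp add: lin_def) (simp add: mbasis_def)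

lemma lin_cong: "(\<And>m. u m \<noteq> 0 \<Longrightarrow> \<theta> m = \<theta>' m) \<Longrightarrow> lin \<theta> u = lin \<theta>' u"
  unfolding lin_def by (intro sum.cong) auto

lemma monoid_algebra_simps:
  "\<one>\<^bsub>monoid_algebra M\<^esub> = (mbasis \<one>\<^bsub>M\<^esub> :: 'm \<Rightarrow> 'f::field)"
  "\<zero>\<^bsub>monoid_algebra M\<^esub> = (\<lambda>m. 0 :: 'f)"
  "u \<oplus>\<^bsub>monoid_algebra M\<^esub> w = (\<lambda>m. u m + w m :: 'f)"
  "c \<odot>\<^bsub>monoid_algebra M\<^esub> w = (\<lambda>m. c * w m :: 'f)"
  by (auto simp: monoid_algebra_def mbasis_def)

lemma monoid_algebra_carrier:
  "u \<in> carrier (monoid_algebra M) \<longleftrightarrow>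
     finite {m. u m \<noteq> (0::'f::field)} \<and> {m. u m \<noteq> 0} \<subseteq> carrier M"
  by (simp add: monoid_algebra_def)

lemma mbasis_carrier [simp]:
  "mbasis m \<in> carrier (monoid_algebra M :: ('f::field, 'm \<Rightarrow> 'f) module) \<longleftrightarrow> m \<in> carrier M"
  by (auto simp: monoid_algebra_carrier)

lemma monoid_algebra_mult:
  assumes "finite {m. u m \<noteq> 0}" "finite {m. w m \<noteq> (0::'f::field)}"
  shows "(u \<otimes>\<^bsub>monoid_algebra M\<^esub> w) p =
    (\<Sum>a | u a \<noteq> 0. \<Sum>b | w b \<noteq> 0. if a \<otimes>\<^bsub>M\<^esub> b = p then u a * w b else 0)"
proof -
  let ?A = "{m. u m \<noteq> 0}" and ?B = "{m. w m \<noteq> 0}"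
  have "(u \<otimes>\<^bsub>monoid_algebra M\<^esub> w) p =
      (\<Sum>(a, b)\<in>{x \<in> ?A \<times> ?B. fst x \<otimes>\<^bsub>M\<^esub> snd x = p}. u a * w b)"
    unfolding monoid_algebra_def by (simp, intro sum.cong) auto
  also have "\<dots> = (\<Sum>x\<in>?A \<times> ?B. if fst x \<otimes>\<^bsub>M\<^esub> snd x = p then (case x of (a, b) \<Rightarrow> u a * w b) else 0)"
    using assms by (intro sum.inter_filter) auto
  also have "\<dots> = (\<Sum>a\<in>?A. \<Sum>b\<in>?B. if a \<otimes>\<^bsub>M\<^esub> b = p then u a * w b else 0)"
    by (subst sum.cartesian_product) (auto intro!: sum.cong)
  finally show ?thesis .
qed

lemma monoid_algebra_mult_supp:
  assumes "finite {m. u m \<noteq> 0}" "finite {m. w m \<noteq> (0::'f::field)}"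
  shows "{p. (u \<otimes>\<^bsub>monoid_algebra M\<^esub> w) p \<noteq> 0} \<subseteq>
    (\<lambda>(a, b). a \<otimes>\<^bsub>M\<^esub> b) ` ({m. u m \<noteq> 0} \<times> {m. w m \<noteq> 0})"
proof
  fix p assume "p \<in> {p. (u \<otimes>\<^bsub>monoid_algebra M\<^esub> w) p \<noteq> 0}"
  then have "(\<Sum>a | u a \<noteq> 0. \<Sum>b | w b \<noteq> 0. if a \<otimes>\<^bsub>M\<^esub> b = p then u a * w b else 0) \<noteq> 0"
    by (simp add: monoid_algebra_mult[OF assms])
  then obtain a where "a \<in> {m. u m \<noteq> 0}" "(\<Sum>b | w b \<noteq> 0. if a \<otimes>\<^bsub>M\<^esub> b = p then u a * w b else 0) \<noteq> 0"
    by (rule sum.not_neutral_contains_not_neutral)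
  moreover from this(2) obtain b where "b \<in> {m. w m \<noteq> 0}" "(if a \<otimes>\<^bsub>M\<^esub> b = p then u a * w b else 0) \<noteq> 0"
    by (rule sum.not_neutral_contains_not_neutral)
  ultimately show "p \<in> (\<lambda>(a, b). a \<otimes>\<^bsub>M\<^esub> b) ` ({m. u m \<noteq> 0} \<times> {m. w m \<noteq> 0})"
    by (force split: if_splits)
qed

lemma lin_mult:
  assumes "finite {m. u m \<noteq> 0}" "finite {m. w m \<noteq> (0::'f::field)}"
  shows "lin \<theta> (u \<otimes>\<^bsub>monoid_algebra M\<^esub> w) =
    (\<Sum>a | u a \<noteq> 0. \<Sum>b | w b \<noteq> 0. u a * w b * \<theta> (a \<otimes>\<^bsub>M\<^esub> b))"
proof -
  let ?A = "{m. u m \<noteq> 0}" and ?B = "{m. w m \<noteq> 0}"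
  let ?S = "(\<lambda>(a, b). a \<otimes>\<^bsub>M\<^esub> b) ` (?A \<times> ?B)"
  have fin: "finite ?S" using assms by simp
  have "lin \<theta> (u \<otimes>\<^bsub>monoid_algebra M\<^esub> w) = (\<Sum>p\<in>?S. (u \<otimes>\<^bsub>monoid_algebra M\<^esub> w) p * \<theta> p)"
    by (rule lin_superset[OF fin monoid_algebra_mult_supp[OF assms]])
  also have "\<dots> = (\<Sum>p\<in>?S. \<Sum>a\<in>?A. \<Sum>b\<in>?B. if a \<otimes>\<^bsub>M\<^esub> b = p then u a * w b * \<theta> p else 0)"
    by (simp add: monoid_algebra_mult[OF assms] sum_distrib_right if_distrib cong: if_cong)
       (auto intro!: sum.cong)
  also have "\<dots> = (\<Sum>a\<in>?A. \<Sum>p\<in>?S. \<Sum>b\<in>?B. if a \<otimes>\<^bsub>M\<^esub> b = p then u a * w b * \<theta> p else 0)"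
    by (rule sum.swap)
  also have "\<dots> = (\<Sum>a\<in>?A. \<Sum>b\<in>?B. \<Sum>p\<in>?S. if a \<otimes>\<^bsub>M\<^esub> b = p then u a * w b * \<theta> p else 0)"
    by (rule sum.cong[OF refl], rule sum.swap)
  also have "\<dots> = (\<Sum>a\<in>?A. \<Sum>b\<in>?B. u a * w b * \<theta> (a \<otimes>\<^bsub>M\<^esub> b))"
  proof (intro sum.cong refl)
    fix a b assume "a \<in> ?A" "b \<in> ?B"
    then have "a \<otimes>\<^bsub>M\<^esub> b \<in> ?S" by force
    with fin show "(\<Sum>p\<in>?S. if a \<otimes>\<^bsub>M\<^esub> b = p then u a * w b * \<theta> p else 0) = u a * w b * \<theta> (a \<otimes>\<^bsub>M\<^esub> b)"
      by (simp only: sum.delta') simp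
  qed
  finally show ?thesis .
qed

lemma monoid_algebra_mult_carrier:
  assumes "monoid M" "u \<in> carrier (monoid_algebra M)" "w \<in> carrier (monoid_algebra M)"
  shows "u \<otimes>\<^bsub>monoid_algebra M\<^esub> w \<in> carrier (monoid_algebra M :: ('f::field, 'm \<Rightarrow> 'f) module)"
proof -
  interpret M: monoid M by fact
  from assms have f: "finite {m. u m \<noteq> 0}" "finite {m. w m \<noteq> 0}"
    and s: "{m. u m \<noteq> 0} \<subseteq> carrier M" "{m. w m \<noteq> 0} \<subseteq> carrier M"
    by (auto simp: monoid_algebra_carrier)
  have "(\<lambda>(a, b). a \<otimes>\<^bsub>M\<^esub> b) ` ({m. u m \<noteq> 0} \<times> {m. w m \<noteq> 0}) \<subseteq> carrier M"
    using s by auto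
  moreover have "finite ((\<lambda>(a, b). a \<otimes>\<^bsub>M\<^esub> b) ` ({m. u m \<noteq> 0} \<times> {m. w m \<noteq> 0}))"
    using f by simp
  ultimately show ?thesis
    unfolding monoid_algebra_carrier using monoid_algebra_mult_supp[OF f, of M]
    by (meson finite_subset order_trans)
qed

text \<open>A coefficient of a product is an iterated linear extension of an indicator function. In
  this form associativity, the unit laws and distributivity reduce to the monoid laws and the
  linearity of \<open>lin\<close>.\<close>

lemma monoid_algebra_mult_lin:
  assumes "finite {m. u m \<noteq> 0}" "finite {m. w m \<noteq> (0::'f::field)}"
  shows "(u \<otimes>\<^bsub>monoid_algebra M\<^esub> w) p = lin (\<lambda>a. lin (\<lambda>b. if a \<otimes>\<^bsub>M\<^esub> b = p then 1 else 0) w) u"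
    (is "_ = ?r")
proof -
  have "?r = (\<Sum>a | u a \<noteq> 0. \<Sum>b | w b \<noteq> 0. if a \<otimes>\<^bsub>M\<^esub> b = p then u a * w b else 0)"
    unfolding lin_def by (auto simp: sum_distrib_left intro!: sum.cong)
  then show ?thesis by (simp add: monoid_algebra_mult[OF assms])
qed

lemma lin_mult_lin:
  assumes "finite {m. u m \<noteq> 0}" "finite {m. w m \<noteq> (0::'f::field)}"
  shows "lin \<theta> (u \<otimes>\<^bsub>monoid_algebra M\<^esub> w) = lin (\<lambda>a. lin (\<lambda>b. \<theta> (a \<otimes>\<^bsub>M\<^esub> b)) w) u"
  unfolding lin_mult[OF assms] by (simp add: lin_def sum_distrib_left mult.assoc)

lemma lin_lin_swap:
  "lin (\<lambda>a. lin (\<lambda>b. \<theta> a b) w) u = lin (\<lambda>b. lin (\<lambda>a. \<theta> a b) u) (w :: 'b \<Rightarrow> 'f::field)"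
  unfolding lin_def by (simp add: sum_distrib_left mult.left_commute) (rule sum.swap)

lemma lin_times: "lin (\<lambda>a. \<theta> a * c) u = lin \<theta> u * c" "lin (\<lambda>a. c * \<theta> a) u = c * lin \<theta> u"
  unfolding lin_def by (simp_all add: sum_distrib_left sum_distrib_right mult_ac)

lemma lin_plus: "lin (\<lambda>a. \<theta> a + \<theta>' a) u = lin \<theta> u + lin \<theta>' u"
  unfolding lin_def by (simp add: distrib_left sum.distrib)

lemma mbasis_mult:
  "mbasis a \<otimes>\<^bsub>monoid_algebra M\<^esub> mbasis b = (mbasis (a \<otimes>\<^bsub>M\<^esub> b) :: 'm \<Rightarrow> 'f::field)"
  by (rule ext) (simp add: monoid_algebra_mult_lin mbasis_def[of "a \<otimes>\<^bsub>M\<^esub> b"])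

text \<open>A unital associative algebra over a field whose scalars form a whole type, so the axioms
  carry no membership condition on c and d.\<close>

locale falgebra = ring R for R :: "('f::field, 'a) module" (structure) +
  assumes smult_closed [simp]: "x \<in> carrier R \<Longrightarrow> c \<odot> x \<in> carrier R"
    and smult_l_distr: "x \<in> carrier R \<Longrightarrow> (c + d) \<odot> x = c \<odot> x \<oplus> d \<odot> x"
    and smult_r_distr: "x \<in> carrier R \<Longrightarrow> y \<in> carrier R \<Longrightarrow> c \<odot> (x \<oplus> y) = c \<odot> x \<oplus> c \<odot> y"
    and smult_assoc: "x \<in> carrier R \<Longrightarrow> (c * d) \<odot> x = c \<odot> (d \<odot> x)"
    and smult_one [simp]: "x \<in> carrier R \<Longrightarrow> 1 \<odot> x = x"
    and smult_mult_l: "x \<in> carrier R \<Longrightarrow> y \<in> carrier R \<Longrightarrow> (c \<odot> x) \<otimes> y = c \<odot> (x \<otimes> y)"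
    and smult_mult_r: "x \<in> carrier R \<Longrightarrow> y \<in> carrier R \<Longrightarrow> x \<otimes> (c \<odot> y) = c \<odot> (x \<otimes> y)"

lemma monoid_algebra_falgebra:
  assumes "monoid M"
  shows "falgebra (monoid_algebra M :: ('f::field, 'm \<Rightarrow> 'f) module)"
proof -
  interpret M: monoid M by fact
  let ?T = "monoid_algebra M :: ('f, 'm \<Rightarrow> 'f) module"
  note C = monoid_algebra_carrier and S = monoid_algebra_simps
  note mc = monoid_algebra_mult_carrier[OF assms]
  have fa: "finite {m. u m + w m \<noteq> 0}" if "finite {m. u m \<noteq> 0}" "finite {m. w m \<noteq> 0}" for u w :: "'m \<Rightarrow> 'f"
    by (rule finite_subset[OF _ finite_UnI[OF that]]) auto
  have fs: "finite {m. c * u m \<noteq> 0}" if "finite {m. u m \<noteq> 0}" for c and u :: "'m \<Rightarrow> 'f"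
    by (rule finite_subset[OF _ that]) auto
  have ag: "abelian_group ?T"
  proof (rule abelian_groupI)
    fix u w assume "u \<in> carrier ?T" "w \<in> carrier ?T"
    moreover have "{m. u m + w m \<noteq> 0} \<subseteq> {m. u m \<noteq> 0} \<union> {m. w m \<noteq> 0}" by auto
    ultimately show "u \<oplus>\<^bsub>?T\<^esub> w \<in> carrier ?T"
      unfolding C S by (blast intro: fa)
  next
    fix u assume u: "u \<in> carrier ?T"
    then have "(\<lambda>m. - u m) \<in> carrier ?T" unfolding C by simp
    then show "\<exists>w\<in>carrier ?T. w \<oplus>\<^bsub>?T\<^esub> u = \<zero>\<^bsub>?T\<^esub>"
      by (rule bexI[rotated]) (simp add: S)
  qed (auto simp: C S add_ac)
  have mon: "monoid ?T"
  proof (rule monoidI)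
    fix u w v assume "u \<in> carrier ?T" "w \<in> carrier ?T" "v \<in> carrier ?T"
    note h = this
    have f: "finite {m. u m \<noteq> 0}" "finite {m. w m \<noteq> 0}" "finite {m. v m \<noteq> 0}"
       "finite {m. (u \<otimes>\<^bsub>?T\<^esub> w) m \<noteq> 0}" "finite {m. (w \<otimes>\<^bsub>?T\<^esub> v) m \<noteq> 0}"
      using h mc[OF h(1,2)] mc[OF h(2,3)] by (auto simp: C)
    have c: "x \<in> carrier M" if "u x \<noteq> 0 \<or> w x \<noteq> 0 \<or> v x \<noteq> 0" for x
      using that h unfolding C by blast
    show "u \<otimes>\<^bsub>?T\<^esub> w \<otimes>\<^bsub>?T\<^esub> v = u \<otimes>\<^bsub>?T\<^esub> (w \<otimes>\<^bsub>?T\<^esub> v)"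
    proof
      fix p
      \<comment> \<open>Both bracketings expand to a threefold linear extension. The monoid law is
        applied only on the supports, which lie in the carrier.\<close>
      have "(u \<otimes>\<^bsub>?T\<^esub> w \<otimes>\<^bsub>?T\<^esub> v) p
          = lin (\<lambda>a. lin (\<lambda>b. lin (\<lambda>c. if (a \<otimes>\<^bsub>M\<^esub> b) \<otimes>\<^bsub>M\<^esub> c = p then 1 else 0) v) w) u"
        by (simp only: monoid_algebra_mult_lin[OF f(4,3), where M = M] lin_mult_lin[OF f(1,2)])
      also have "\<dots> = lin (\<lambda>a. lin (\<lambda>b. lin (\<lambda>c. if a \<otimes>\<^bsub>M\<^esub> (b \<otimes>\<^bsub>M\<^esub> c) = p then 1 else 0) v) w) u"
        by (intro lin_cong) (simp add: c M.m_assoc)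
      also have "\<dots> = (u \<otimes>\<^bsub>?T\<^esub> (w \<otimes>\<^bsub>?T\<^esub> v)) p"
        by (simp only: monoid_algebra_mult_lin[OF f(1,5), where M = M] lin_mult_lin[OF f(2,3)])
      finally show "(u \<otimes>\<^bsub>?T\<^esub> w \<otimes>\<^bsub>?T\<^esub> v) p = (u \<otimes>\<^bsub>?T\<^esub> (w \<otimes>\<^bsub>?T\<^esub> v)) p" .
    qed
  next
    fix u assume h: "u \<in> carrier ?T"
    then have f: "finite {m. u m \<noteq> 0}" by (simp add: C)
    have d: "lin (\<lambda>b. if b = p then 1 else 0) u = u p" for p
      unfolding lin_def using f by (simp add: if_distrib sum.delta cong: if_cong)
    have c: "x \<in> carrier M" if "u x \<noteq> 0" for x
      using that h unfolding C by blast
    show "\<one>\<^bsub>?T\<^esub> \<otimes>\<^bsub>?T\<^esub> u = u"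
    proof
      fix p
      have "(\<one>\<^bsub>?T\<^esub> \<otimes>\<^bsub>?T\<^esub> u) p = lin (\<lambda>b. if \<one>\<^bsub>M\<^esub> \<otimes>\<^bsub>M\<^esub> b = p then 1 else 0) u"
        unfolding S by (simp add: monoid_algebra_mult_lin f)
      also have "\<dots> = lin (\<lambda>b. if b = p then 1 else 0) u"
        by (intro lin_cong) (simp add: c)
      also note d
      finally show "(\<one>\<^bsub>?T\<^esub> \<otimes>\<^bsub>?T\<^esub> u) p = u p" .
    qed
    show "u \<otimes>\<^bsub>?T\<^esub> \<one>\<^bsub>?T\<^esub> = u"
    proof
      fix p
      have "(u \<otimes>\<^bsub>?T\<^esub> \<one>\<^bsub>?T\<^esub>) p = lin (\<lambda>b. if b \<otimes>\<^bsub>M\<^esub> \<one>\<^bsub>M\<^esub> = p then 1 else 0) u"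
        unfolding S by (simp add: monoid_algebra_mult_lin f)
      also have "\<dots> = lin (\<lambda>b. if b = p then 1 else 0) u"
        by (intro lin_cong) (simp add: c)
      also note d
      finally show "(u \<otimes>\<^bsub>?T\<^esub> \<one>\<^bsub>?T\<^esub>) p = u p" .
    qed
  next
    show "\<one>\<^bsub>?T\<^esub> \<in> carrier ?T" by (simp add: S)
  qed (rule mc)
  have "ring ?T"
  proof (rule ringI[OF ag mon])
    fix u w v assume "u \<in> carrier ?T" "w \<in> carrier ?T" "v \<in> carrier ?T"
    then have f: "finite {m. u m \<noteq> 0}" "finite {m. w m \<noteq> 0}" "finite {m. v m \<noteq> 0}"
      by (auto simp: C)
    show "(u \<oplus>\<^bsub>?T\<^esub> w) \<otimes>\<^bsub>?T\<^esub> v = u \<otimes>\<^bsub>?T\<^esub> v \<oplus>\<^bsub>?T\<^esub> w \<otimes>\<^bsub>?T\<^esub> v"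
      by (rule ext) (simp add: S monoid_algebra_mult_lin f fa lin_add)
    show "v \<otimes>\<^bsub>?T\<^esub> (u \<oplus>\<^bsub>?T\<^esub> w) = v \<otimes>\<^bsub>?T\<^esub> u \<oplus>\<^bsub>?T\<^esub> v \<otimes>\<^bsub>?T\<^esub> w"
      by (rule ext) (simp add: S monoid_algebra_mult_lin f fa lin_add lin_plus)
  qed
  then show ?thesis
  proof (rule falgebra.intro, unfold_locales)
    fix u w :: "'m \<Rightarrow> 'f" and c d :: 'f
    assume u: "u \<in> carrier ?T"
    then have f: "finite {m. u m \<noteq> 0}" by (simp add: C)
    from u show "c \<odot>\<^bsub>?T\<^esub> u \<in> carrier ?T" by (auto simp: C S)
    show "(c + d) \<odot>\<^bsub>?T\<^esub> u = c \<odot>\<^bsub>?T\<^esub> u \<oplus>\<^bsub>?T\<^esub> d \<odot>\<^bsub>?T\<^esub> u"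
      "(c * d) \<odot>\<^bsub>?T\<^esub> u = c \<odot>\<^bsub>?T\<^esub> (d \<odot>\<^bsub>?T\<^esub> u)" "1 \<odot>\<^bsub>?T\<^esub> u = u"
      by (simp_all add: S algebra_simps)
    assume w: "w \<in> carrier ?T"
    then have g: "finite {m. w m \<noteq> 0}" by (simp add: C)
    show "c \<odot>\<^bsub>?T\<^esub> (u \<oplus>\<^bsub>?T\<^esub> w) = c \<odot>\<^bsub>?T\<^esub> u \<oplus>\<^bsub>?T\<^esub> c \<odot>\<^bsub>?T\<^esub> w"
      by (simp add: S algebra_simps)
    show "(c \<odot>\<^bsub>?T\<^esub> u) \<otimes>\<^bsub>?T\<^esub> w = c \<odot>\<^bsub>?T\<^esub> (u \<otimes>\<^bsub>?T\<^esub> w)"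
      by (rule ext) (simp add: S monoid_algebra_mult_lin f g fs lin_smult del: mult_eq_0_iff)
    show "u \<otimes>\<^bsub>?T\<^esub> (c \<odot>\<^bsub>?T\<^esub> w) = c \<odot>\<^bsub>?T\<^esub> (u \<otimes>\<^bsub>?T\<^esub> w)"
      by (rule ext) (simp add: S monoid_algebra_mult_lin f g fs lin_smult lin_times del: mult_eq_0_iff)
  qed
qed

lemma monoid_algebra_minus:
  fixes u w :: "'m \<Rightarrow> 'f::field"
  assumes "monoid M" "u \<in> carrier (monoid_algebra M)" "w \<in> carrier (monoid_algebra M)"
  shows "u \<ominus>\<^bsub>monoid_algebra M\<^esub> w = (\<lambda>m. u m - w m)"
proof -
  interpret falgebra "monoid_algebra M :: ('f, 'm \<Rightarrow> 'f) module"
    by (rule monoid_algebra_falgebra) fact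
  have "(\<lambda>m. - w m) \<in> carrier (monoid_algebra M)"
    using assms by (simp add: monoid_algebra_carrier)
  moreover have "(\<lambda>m. - w m) \<oplus>\<^bsub>monoid_algebra M\<^esub> w = \<zero>\<^bsub>monoid_algebra M\<^esub>"
    by (simp add: monoid_algebra_simps)
  ultimately have "\<ominus>\<^bsub>monoid_algebra M\<^esub> w = (\<lambda>m. - w m)"
    using assms by (intro minus_equality)
  then show ?thesis by (simp add: a_minus_def monoid_algebra_simps)
qed

lemma lin_minus:
  assumes "monoid M" "u \<in> carrier (monoid_algebra M)" "w \<in> carrier (monoid_algebra M)"
  shows "lin \<theta> (u \<ominus>\<^bsub>monoid_algebra M\<^esub> w) = lin \<theta> u - (lin \<theta> w :: 'f::field)"
proof -
  have "finite {m. u m \<noteq> 0}" "finite {m. (- 1) * w m \<noteq> 0}"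
    using assms by (auto simp: monoid_algebra_carrier)
  from lin_add[OF this] show ?thesis
    using lin_smult[of \<theta> "- 1" w] by (simp add: monoid_algebra_minus[OF assms])
qed

lemma mbasis_central:
  assumes "u \<in> carrier (monoid_algebra M)" "\<And>m'. m' \<in> carrier M \<Longrightarrow> m \<otimes>\<^bsub>M\<^esub> m' = m' \<otimes>\<^bsub>M\<^esub> m"
  shows "mbasis m \<otimes>\<^bsub>monoid_algebra M\<^esub> u = u \<otimes>\<^bsub>monoid_algebra M\<^esub> (mbasis m :: 'm \<Rightarrow> 'f::field)"
proof
  fix p
  have f: "finite {m. u m \<noteq> 0}" and s: "{m. u m \<noteq> 0} \<subseteq> carrier M"
    using assms by (auto simp: monoid_algebra_carrier)
  have "lin (\<lambda>b. if m \<otimes>\<^bsub>M\<^esub> b = p then 1 else 0) u = lin (\<lambda>b. if b \<otimes>\<^bsub>M\<^esub> m = p then 1 else 0) u"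
    by (rule lin_cong) (use s assms(2) in auto)
  then show "(mbasis m \<otimes>\<^bsub>monoid_algebra M\<^esub> u) p = (u \<otimes>\<^bsub>monoid_algebra M\<^esub> mbasis m) p"
    by (simp add: monoid_algebra_mult_lin f)
qed

section \<open>Linear functionals and quotients\<close>

definition linfun :: "('f::field, 'a) module \<Rightarrow> ('a \<Rightarrow> 'f) \<Rightarrow> bool" where
  "linfun R \<phi> \<longleftrightarrow> (\<forall>x\<in>carrier R. \<forall>y\<in>carrier R. \<phi> (x \<oplus>\<^bsub>R\<^esub> y) = \<phi> x + \<phi> y) \<and>
     (\<forall>c. \<forall>x\<in>carrier R. \<phi> (c \<odot>\<^bsub>R\<^esub> x) = c * \<phi> x)"

lemma linfun_add: "linfun R \<phi> \<Longrightarrow> x \<in> carrier R \<Longrightarrow> y \<in> carrier R \<Longrightarrow> \<phi> (x \<oplus>\<^bsub>R\<^esub> y) = \<phi> x + \<phi> y"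
  and linfun_smult: "linfun R \<phi> \<Longrightarrow> x \<in> carrier R \<Longrightarrow> \<phi> (c \<odot>\<^bsub>R\<^esub> x) = c * \<phi> x"
  by (auto simp: linfun_def)

lemma linfun_lin: "linfun (monoid_algebra M) (lin \<theta>)"
  by (auto simp: linfun_def monoid_algebra_simps monoid_algebra_carrier lin_add lin_smult)

lemma (in falgebra) linfun_zero: "linfun R \<phi> \<Longrightarrow> \<phi> \<zero> = 0"
  using linfun_add[of R \<phi> \<zero> \<zero>] by (metis add_cancel_right_right l_zero zero_closed)

lemma (in falgebra) linfun_mult_left:
  "linfun R \<phi> \<Longrightarrow> a \<in> carrier R \<Longrightarrow> linfun R (\<lambda>x. \<phi> (a \<otimes> x))"
  by (auto simp: linfun_def r_distr smult_mult_r)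

lemma (in falgebra) linfun_mult_right:
  "linfun R \<phi> \<Longrightarrow> a \<in> carrier R \<Longrightarrow> linfun R (\<lambda>x. \<phi> (x \<otimes> a))"
  by (auto simp: linfun_def l_distr smult_mult_l)

lemma (in falgebra) scalar_central:
  "x \<in> carrier R \<Longrightarrow> (c \<odot> \<one>) \<otimes> x = c \<odot> x" "x \<in> carrier R \<Longrightarrow> x \<otimes> (c \<odot> \<one>) = c \<odot> x"
  by (simp_all add: smult_mult_l smult_mult_r)

text \<open>Extending the record leaves the carrier and the operations unchanged, but the ring
  axioms have to be re-established at the larger record type.\<close>

lemma ring_extend:
  assumes "ring (S :: 'a ring)"
  shows "ring (ring.extend S E)"
proof -
  interpret S: ring S by fact
  let ?E = "ring.extend S E"
  have [simp]: "carrier ?E = carrier S" "monoid.mult ?E = monoid.mult S" "one ?E = one S"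
    "zero ?E = zero S" "add ?E = add S"
    by (simp_all add: ring.defs)
  have "abelian_group ?E"
    by (rule abelian_groupI) (use S.a_assoc S.a_comm in \<open>auto intro: S.a_inv_closed S.l_neg\<close>)
  moreover have "monoid ?E"
    by (rule monoidI) (use S.m_assoc in auto)
  ultimately show ?thesis
    by (rule ringI) (simp_all add: S.l_distr S.r_distr)
qed

lemma quot_algebra_simps:
  "carrier (quot_algebra R I) = a_rcosets\<^bsub>R\<^esub> I"
  "monoid.mult (quot_algebra R I) = rcoset_mult R I"
  "\<one>\<^bsub>quot_algebra R I\<^esub> = I +>\<^bsub>R\<^esub> \<one>\<^bsub>R\<^esub>"
  "\<zero>\<^bsub>quot_algebra R I\<^esub> = I"
  "add (quot_algebra R I) = set_add R"
  "c \<odot>\<^bsub>quot_algebra R I\<^esub> C = (\<Union>x\<in>C. I +>\<^bsub>R\<^esub> (c \<odot>\<^bsub>R\<^esub> x))"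
  by (simp_all add: quot_algebra_def ring.defs module.defs FactRing_def)

locale falgebra_ideal = falgebra R + ideal I R for R :: "('f::field, 'a) module" (structure) and I
begin

abbreviation "Q \<equiv> quot_algebra R I"

lemma quot_carrier: "C \<in> carrier Q \<longleftrightarrow> (\<exists>x\<in>carrier R. C = I +> x)"
  by (auto simp: quot_algebra_simps A_RCOSETS_defs a_r_coset_def)

lemma quot_mem [simp]: "x \<in> carrier R \<Longrightarrow> I +> x \<in> carrier Q"
  using quot_carrier by blast

lemma quot_mult: "x \<in> carrier R \<Longrightarrow> y \<in> carrier R \<Longrightarrow> (I +> x) \<otimes>\<^bsub>Q\<^esub> (I +> y) = I +> (x \<otimes> y)"
  by (simp add: quot_algebra_simps rcoset_mult_add)

lemma quot_add: "x \<in> carrier R \<Longrightarrow> y \<in> carrier R \<Longrightarrow> (I +> x) \<oplus>\<^bsub>Q\<^esub> (I +> y) = I +> (x \<oplus> y)"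
  by (simp add: quot_algebra_simps a_rcos_sum)

lemma coset_memE:
  assumes "y \<in> I +> x" "x \<in> carrier R"
  obtains h where "h \<in> I" "y = h \<oplus> x"
  using assms by (auto simp: a_r_coset_def')

lemma coset_eqI: "x \<in> carrier R \<Longrightarrow> y \<in> carrier R \<Longrightarrow> x \<ominus> y \<in> I \<Longrightarrow> I +> x = I +> y"
  by (metis a_coset_join2 a_l_coset_subset_G a_repr_independence a_rcos_self a_rcosI additive_subgroup.a_Hcarr
      quotient_eq_iff_same_a_r_cos ideal_axioms)

lemma smult_ideal: "h \<in> I \<Longrightarrow> c \<odot> h \<in> I"
  using I_l_closed[of h "c \<odot> \<one>"] by (simp add: scalar_central)

lemma quot_smult:
  assumes "x \<in> carrier R"
  shows "c \<odot>\<^bsub>Q\<^esub> (I +> x) = I +> (c \<odot> x)"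
proof -
  \<comment> \<open>The scalar multiple of a coset is a union over its representatives; all of them
    contribute the same coset.\<close>
  have "I +> (c \<odot> y) = I +> (c \<odot> x)" if "y \<in> I +> x" for y
  proof -
    from that assms obtain h where h: "h \<in> I" "y = h \<oplus> x" by (rule coset_memE)
    then have hc: "h \<in> carrier R" by simp
    have "c \<odot> y = c \<odot> h \<oplus> c \<odot> x" using h hc assms by (simp add: smult_r_distr)
    then have "c \<odot> y \<in> I +> (c \<odot> x)"
      using smult_ideal[OF h(1), of c] by (auto simp: a_r_coset_def')
    then show ?thesis using assms by (metis a_repr_independence smult_closed is_additive_subgroup a_subgroup)
  qed
  moreover have "x \<in> I +> x" using assms by (rule a_rcos_self)
  ultimately show ?thesis unfolding quot_algebra_simps by blast
qed

lemma quot_falgebra: "falgebra Q"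
proof -
  have "ring Q" unfolding quot_algebra_def by (rule ring_extend[OF quotient_is_ring])
  then show ?thesis
  proof (rule falgebra.intro, unfold_locales)
    fix C D c d
    assume "C \<in> carrier Q"
    then obtain x where x: "x \<in> carrier R" "C = I +> x" by (auto simp: quot_carrier)
    show "c \<odot>\<^bsub>Q\<^esub> C \<in> carrier Q" "(c + d) \<odot>\<^bsub>Q\<^esub> C = c \<odot>\<^bsub>Q\<^esub> C \<oplus>\<^bsub>Q\<^esub> d \<odot>\<^bsub>Q\<^esub> C"
      "(c * d) \<odot>\<^bsub>Q\<^esub> C = c \<odot>\<^bsub>Q\<^esub> (d \<odot>\<^bsub>Q\<^esub> C)" "1 \<odot>\<^bsub>Q\<^esub> C = C"
      using x by (simp_all add: quot_smult quot_add smult_l_distr smult_assoc)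
    assume "D \<in> carrier Q"
    then obtain y where y: "y \<in> carrier R" "D = I +> y" by (auto simp: quot_carrier)
    show "c \<odot>\<^bsub>Q\<^esub> (C \<oplus>\<^bsub>Q\<^esub> D) = c \<odot>\<^bsub>Q\<^esub> C \<oplus>\<^bsub>Q\<^esub> c \<odot>\<^bsub>Q\<^esub> D"
      "(c \<odot>\<^bsub>Q\<^esub> C) \<otimes>\<^bsub>Q\<^esub> D = c \<odot>\<^bsub>Q\<^esub> (C \<otimes>\<^bsub>Q\<^esub> D)"
      "C \<otimes>\<^bsub>Q\<^esub> (c \<odot>\<^bsub>Q\<^esub> D) = c \<odot>\<^bsub>Q\<^esub> (C \<otimes>\<^bsub>Q\<^esub> D)"
      using x y by (simp_all add: quot_smult quot_add quot_mult smult_r_distr smult_mult_l smult_mult_r)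
  qed
qed

text \<open>Elements of a quotient given by generators and relations are later shown to be nonzero
  by evaluating functionals that descend in this way.\<close>

lemma quot_linfun:
  assumes "linfun R \<phi>" "\<And>x. x \<in> I \<Longrightarrow> \<phi> x = 0"
  obtains \<psi> where "linfun Q \<psi>" "\<And>x. x \<in> carrier R \<Longrightarrow> \<psi> (I +> x) = \<phi> x"
proof -
  define \<psi> where "\<psi> C = \<phi> (SOME x. x \<in> C)" for C
  have v: "\<psi> (I +> x) = \<phi> x" if x: "x \<in> carrier R" for x
  proof -
    have "x \<in> I +> x" using x by (rule a_rcos_self)
    then have "(SOME y. y \<in> I +> x) \<in> I +> x" by (rule someI)
    then obtain h where "h \<in> I" "(SOME y. y \<in> I +> x) = h \<oplus> x" using x by (rule coset_memE)
    then show ?thesis using assms x by (simp add: \<psi>_def linfun_add)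
  qed
  have "linfun Q \<psi>"
    unfolding linfun_def
    by (auto simp: quot_carrier quot_add quot_smult v linfun_add[OF assms(1)] linfun_smult[OF assms(1)])
  with v show ?thesis by (rule that[rotated])
qed

end

lemma subalgebra_falgebra:
  assumes "falgebra R" "S \<subseteq> carrier R"
  shows "falgebra (R\<lparr>carrier := subalgebra_gen R S\<rparr>)" "subalgebra_gen R S \<subseteq> carrier R"
    "S \<subseteq> subalgebra_gen R S"
proof -
  interpret falgebra R by fact
  let ?H = "range (\<lambda>c. c \<odot>\<^bsub>R\<^esub> \<one>\<^bsub>R\<^esub>) \<union> S"
  have H: "?H \<subseteq> carrier R" using assms by auto
  show sub: "subalgebra_gen R S \<subseteq> carrier R"
    unfolding subalgebra_gen_def by (rule generate_ring_incl[OF H])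
  show "S \<subseteq> subalgebra_gen R S"
    unfolding subalgebra_gen_def by (auto intro: generate_ring.incl)
  have "ring (R\<lparr>carrier := subalgebra_gen R S\<rparr>)"
    unfolding subalgebra_gen_def by (rule generate_ring_is_ring[OF H])
  moreover have "c \<odot>\<^bsub>R\<^esub> x \<in> subalgebra_gen R S" if "x \<in> subalgebra_gen R S" for c x
  proof -
    have "(c \<odot>\<^bsub>R\<^esub> \<one>\<^bsub>R\<^esub>) \<otimes>\<^bsub>R\<^esub> x \<in> subalgebra_gen R S"
      using that unfolding subalgebra_gen_def by (auto intro: generate_ring.incl generate_ring.eng_mult)
    then show ?thesis using that sub by (auto simp: scalar_central)
  qed
  ultimately show "falgebra (R\<lparr>carrier := subalgebra_gen R S\<rparr>)"
    using sub
    by (intro falgebra.intro falgebra_axioms.intro)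
       (auto simp: smult_l_distr smult_r_distr smult_assoc smult_mult_l smult_mult_r subset_iff)
qed

lemma linfun_subset: "linfun R \<phi> \<Longrightarrow> S \<subseteq> carrier R \<Longrightarrow> linfun (R\<lparr>carrier := S\<rparr>) \<phi>"
  unfolding linfun_def by (simp add: subset_iff)

section \<open>Tensor products\<close>

locale tensor_product = R: falgebra R + S: falgebra S
  for R :: "('f::field, 'a) module" and S :: "('f, 'b) module"
begin

abbreviation "T \<equiv> monoid_algebra (R \<times>\<times> S) :: ('f, 'a \<times> 'b \<Rightarrow> 'f) module"

lemma monoid_RS: "monoid (R \<times>\<times> S)"
  by (rule DirProd_monoid) (rule R.monoid_axioms, rule S.monoid_axioms)

sublocale T: falgebra T
  by (rule monoid_algebra_falgebra[OF monoid_RS])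

lemma tensor_rels_carrier: "tensor_rels R S \<subseteq> carrier T"
  unfolding tensor_rels_def Let_def by (auto intro!: T.minus_closed)

sublocale TI: falgebra_ideal T "tensor_ideal R S"
  by (intro falgebra_ideal.intro T.falgebra_axioms)
     (simp add: tensor_ideal_def T.genideal_ideal[OF tensor_rels_carrier])

lemma tensor_falgebra: "falgebra (tensor_algebra R S)"
  unfolding tensor_algebra_def by (rule TI.quot_falgebra)

lemma tensor_closed [simp]:
  "a \<in> carrier R \<Longrightarrow> b \<in> carrier S \<Longrightarrow> tensor R S a b \<in> carrier (tensor_algebra R S)"
  unfolding tensor_def tensor_algebra_def by (rule TI.quot_mem) simp

lemma tensor_mult:
  assumes "a \<in> carrier R" "b \<in> carrier S" "a' \<in> carrier R" "b' \<in> carrier S"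
  shows "tensor R S a b \<otimes>\<^bsub>tensor_algebra R S\<^esub> tensor R S a' b' = tensor R S (a \<otimes>\<^bsub>R\<^esub> a') (b \<otimes>\<^bsub>S\<^esub> b')"
  unfolding tensor_def tensor_algebra_def using assms
  by (subst TI.quot_mult) (auto simp: mbasis_mult)

lemma tensor_one: "\<one>\<^bsub>tensor_algebra R S\<^esub> = tensor R S \<one>\<^bsub>R\<^esub> \<one>\<^bsub>S\<^esub>"
  by (simp add: tensor_def tensor_algebra_def quot_algebra_simps monoid_algebra_simps)

lemma tensor_rel: "u \<ominus>\<^bsub>T\<^esub> w \<in> tensor_rels R S \<Longrightarrow> u \<in> carrier T \<Longrightarrow> w \<in> carrier T \<Longrightarrow>
    tensor_ideal R S +>\<^bsub>T\<^esub> u = tensor_ideal R S +>\<^bsub>T\<^esub> w"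
  using T.genideal_self[OF tensor_rels_carrier] by (intro TI.coset_eqI) (auto simp: tensor_ideal_def)

lemma tensor_smult_left:
  assumes "a \<in> carrier R" "b \<in> carrier S"
  shows "tensor R S (c \<odot>\<^bsub>R\<^esub> a) b = c \<odot>\<^bsub>tensor_algebra R S\<^esub> tensor R S a b"
proof -
  have "mbasis (c \<odot>\<^bsub>R\<^esub> a, b) \<ominus>\<^bsub>T\<^esub> (c \<odot>\<^bsub>T\<^esub> mbasis (a, b)) \<in> tensor_rels R S"
    using assms unfolding tensor_rels_def Let_def by blast
  from tensor_rel[OF this] show ?thesis
    using assms by (simp add: tensor_def tensor_algebra_def TI.quot_smult)
qed

lemma tensor_smult_right:
  assumes "a \<in> carrier R" "b \<in> carrier S"
  shows "tensor R S a (c \<odot>\<^bsub>S\<^esub> b) = c \<odot>\<^bsub>tensor_algebra R S\<^esub> tensor R S a b"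
proof -
  have "mbasis (a, c \<odot>\<^bsub>S\<^esub> b) \<ominus>\<^bsub>T\<^esub> (c \<odot>\<^bsub>T\<^esub> mbasis (a, b)) \<in> tensor_rels R S"
    using assms unfolding tensor_rels_def Let_def by blast
  from tensor_rel[OF this] show ?thesis
    using assms by (simp add: tensor_def tensor_algebra_def TI.quot_smult)
qed

lemma tensor_central:
  assumes "a \<in> carrier R" "b \<in> carrier S"
    and "\<And>x. x \<in> carrier R \<Longrightarrow> a \<otimes>\<^bsub>R\<^esub> x = x \<otimes>\<^bsub>R\<^esub> a"
    and "\<And>y. y \<in> carrier S \<Longrightarrow> b \<otimes>\<^bsub>S\<^esub> y = y \<otimes>\<^bsub>S\<^esub> b"
    and "z \<in> carrier (tensor_algebra R S)"
  shows "tensor R S a b \<otimes>\<^bsub>tensor_algebra R S\<^esub> z = z \<otimes>\<^bsub>tensor_algebra R S\<^esub> tensor R S a b"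
proof -
  obtain u where u: "u \<in> carrier T" "z = tensor_ideal R S +>\<^bsub>T\<^esub> u"
    using assms(5) unfolding tensor_algebra_def TI.quot_carrier by blast
  have m: "mbasis (a, b) \<in> carrier T" using assms by simp
  have "mbasis (a, b) \<otimes>\<^bsub>T\<^esub> u = u \<otimes>\<^bsub>T\<^esub> mbasis (a, b)"
    by (rule mbasis_central[OF u(1)]) (use assms in auto)
  then show ?thesis
    unfolding tensor_def tensor_algebra_def u(2) using u(1) m by (simp add: TI.quot_mult)
qed

lemma tensor_linfun:
  assumes "linfun R \<alpha>" "linfun S \<beta>"
  obtains \<psi> where "linfun (tensor_algebra R S) \<psi>"
    "\<And>a b. a \<in> carrier R \<Longrightarrow> b \<in> carrier S \<Longrightarrow> \<psi> (tensor R S a b) = \<alpha> a * \<beta> b"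
proof -
  define \<Theta> where "\<Theta> \<alpha> \<beta> = (\<lambda>(x, y). \<alpha> x * \<beta> y)" for \<alpha> :: "'a \<Rightarrow> 'f" and \<beta> :: "'b \<Rightarrow> 'f"
  \<comment> \<open>Quantifying over all pairs of functionals, not only the given one, is what makes
    J a two-sided ideal: multiplication by a basis pair p replaces \<alpha> and \<beta> by their
    compositions with multiplication by the components of p, and these are again linear.\<close>
  define J where "J = {u \<in> carrier T. \<forall>\<alpha> \<beta>. linfun R \<alpha> \<longrightarrow> linfun S \<beta> \<longrightarrow> lin (\<Theta> \<alpha> \<beta>) u = 0}"
  have JI: "u \<in> J" if "u \<in> carrier T" "\<And>\<alpha> \<beta>. linfun R \<alpha> \<Longrightarrow> linfun S \<beta> \<Longrightarrow> lin (\<Theta> \<alpha> \<beta>) u = 0" for u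
    using that by (auto simp: J_def)
  have JD: "lin (\<Theta> \<alpha> \<beta>) u = 0" if "u \<in> J" "linfun R \<alpha>" "linfun S \<beta>" for u \<alpha> \<beta>
    using that by (auto simp: J_def)
  have Jc: "u \<in> carrier T" if "u \<in> J" for u using that by (auto simp: J_def)
  have fin: "finite {m. u m \<noteq> 0}" if "u \<in> carrier T" for u using that by (simp add: monoid_algebra_carrier)
  have car: "fst m \<in> carrier R \<and> snd m \<in> carrier S" if "u \<in> carrier T" "u m \<noteq> 0" for u m
    using that by (cases m) (auto simp: monoid_algebra_carrier)
  have Tp: "\<Theta> \<alpha> \<beta> (a, b) = \<alpha> a * \<beta> b" for \<alpha> \<beta> a b by (simp add: \<Theta>_def)
  have DP: "m \<otimes>\<^bsub>R \<times>\<times> S\<^esub> m' = (fst m \<otimes>\<^bsub>R\<^esub> fst m', snd m \<otimes>\<^bsub>S\<^esub> snd m')" for m m'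
    by (cases m, cases m') simp
  have "ideal J T"
  proof (rule idealI[OF T.ring_axioms])
    show "subgroup J (add_monoid T)"
    proof (rule T.add.subgroupI)
      show "J \<subseteq> carrier T" by (auto simp: J_def)
      show "J \<noteq> {}" using JI[OF T.zero_closed] by (auto simp: monoid_algebra_simps)
      fix u w assume h: "u \<in> J" "w \<in> J"
      show "u \<oplus>\<^bsub>T\<^esub> w \<in> J"
        using h by (intro JI) (simp_all add: Jc linfun_add[OF linfun_lin] JD)
      have "\<ominus>\<^bsub>T\<^esub> u = \<zero>\<^bsub>T\<^esub> \<ominus>\<^bsub>T\<^esub> u" using Jc[OF h(1)] by (simp add: a_minus_def)
      then show "\<ominus>\<^bsub>T\<^esub> u \<in> J"
        using h by (intro JI) (simp_all add: Jc lin_minus[OF monoid_RS T.zero_closed] JD,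
            simp add: monoid_algebra_simps)
    qed
    fix u w assume h: "u \<in> J" "w \<in> carrier T"
    note uc = Jc[OF h(1)]
    show "w \<otimes>\<^bsub>T\<^esub> u \<in> J"
    proof (rule JI)
      fix \<alpha> \<beta> assume l: "linfun R \<alpha>" "linfun S \<beta>"
      have "lin (\<Theta> \<alpha> \<beta>) (w \<otimes>\<^bsub>T\<^esub> u) = lin (\<lambda>p. lin (\<lambda>q. \<Theta> \<alpha> \<beta> (p \<otimes>\<^bsub>R \<times>\<times> S\<^esub> q)) u) w"
        by (rule lin_mult_lin[OF fin[OF h(2)] fin[OF uc]])
      also have "\<dots> = lin (\<lambda>p. 0) w"
      proof (rule lin_cong)
        fix p assume p: "w p \<noteq> 0"
        have "lin (\<lambda>q. \<Theta> \<alpha> \<beta> (p \<otimes>\<^bsub>R \<times>\<times> S\<^esub> q)) u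
            = lin (\<Theta> (\<lambda>x. \<alpha> (fst p \<otimes>\<^bsub>R\<^esub> x)) (\<lambda>x. \<beta> (snd p \<otimes>\<^bsub>S\<^esub> x))) u"
          by (rule lin_cong) (simp add: \<Theta>_def case_prod_beta DP)
        also have "\<dots> = 0"
          using car[OF h(2) p] l
          by (intro JD[OF h(1)] R.linfun_mult_left S.linfun_mult_left) auto
        finally show "lin (\<lambda>q. \<Theta> \<alpha> \<beta> (p \<otimes>\<^bsub>R \<times>\<times> S\<^esub> q)) u = 0" .
      qed
      finally show "lin (\<Theta> \<alpha> \<beta>) (w \<otimes>\<^bsub>T\<^esub> u) = 0" by (simp add: lin_def)
    qed (use uc h in auto)
    show "u \<otimes>\<^bsub>T\<^esub> w \<in> J"
    proof (rule JI)
      fix \<alpha> \<beta> assume l: "linfun R \<alpha>" "linfun S \<beta>"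
      have "lin (\<Theta> \<alpha> \<beta>) (u \<otimes>\<^bsub>T\<^esub> w) = lin (\<lambda>p. lin (\<lambda>q. \<Theta> \<alpha> \<beta> (p \<otimes>\<^bsub>R \<times>\<times> S\<^esub> q)) w) u"
        by (rule lin_mult_lin[OF fin[OF uc] fin[OF h(2)]])
      also have "\<dots> = lin (\<lambda>q. lin (\<lambda>p. \<Theta> \<alpha> \<beta> (p \<otimes>\<^bsub>R \<times>\<times> S\<^esub> q)) u) w"
        by (rule lin_lin_swap)
      also have "\<dots> = lin (\<lambda>p. 0) w"
      proof (rule lin_cong)
        fix p assume p: "w p \<noteq> 0"
        have "lin (\<lambda>q. \<Theta> \<alpha> \<beta> (q \<otimes>\<^bsub>R \<times>\<times> S\<^esub> p)) u
            = lin (\<Theta> (\<lambda>x. \<alpha> (x \<otimes>\<^bsub>R\<^esub> fst p)) (\<lambda>x. \<beta> (x \<otimes>\<^bsub>S\<^esub> snd p))) u"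
          by (rule lin_cong) (simp add: \<Theta>_def case_prod_beta DP)
        also have "\<dots> = 0"
          using car[OF h(2) p] l
          by (intro JD[OF h(1)] R.linfun_mult_right S.linfun_mult_right) auto
        finally show "lin (\<lambda>q. \<Theta> \<alpha> \<beta> (q \<otimes>\<^bsub>R \<times>\<times> S\<^esub> p)) u = 0" .
      qed
      finally show "lin (\<Theta> \<alpha> \<beta>) (u \<otimes>\<^bsub>T\<^esub> w) = 0" by (simp add: lin_def)
    qed (use uc h in auto)
  qed
  moreover have "tensor_rels R S \<subseteq> J"
  proof
    fix r assume r: "r \<in> tensor_rels R S"
    then have rc: "r \<in> carrier T" using tensor_rels_carrier by auto
    show "r \<in> J"
    proof (rule JI[OF rc])
      fix \<alpha> \<beta> assume l: "linfun R \<alpha>" "linfun S \<beta>"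
      have [simp]: "lin (\<Theta> \<alpha> \<beta>) (u \<ominus>\<^bsub>T\<^esub> w) = lin (\<Theta> \<alpha> \<beta>) u - lin (\<Theta> \<alpha> \<beta>) w"
        if "u \<in> carrier T" "w \<in> carrier T" for u w
        using that by (rule lin_minus[OF monoid_RS])
      have [simp]: "(x, y) \<in> carrier (R \<times>\<times> S) \<longleftrightarrow> x \<in> carrier R \<and> y \<in> carrier S" for x y
        by simp
      from r show "lin (\<Theta> \<alpha> \<beta>) r = 0"
        unfolding tensor_rels_def Let_def
        by (elim UnE)
           (auto simp: linfun_add[OF linfun_lin] linfun_smult[OF linfun_lin] linfun_add[OF l(1)] linfun_add[OF l(2)]
            linfun_smult[OF l(1)] linfun_smult[OF l(2)] Tp algebra_simps)
    qed
  qed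
  ultimately have "tensor_ideal R S \<subseteq> J"
    unfolding tensor_ideal_def by (rule T.genideal_minimal)
  then have "\<And>u. u \<in> tensor_ideal R S \<Longrightarrow> lin (\<Theta> \<alpha> \<beta>) u = 0"
    using JD assms by blast
  from TI.quot_linfun[OF linfun_lin this]
  obtain \<psi> where \<psi>: "linfun (quot_algebra T (tensor_ideal R S)) \<psi>"
     "\<And>x. x \<in> carrier T \<Longrightarrow> \<psi> (tensor_ideal R S +>\<^bsub>T\<^esub> x) = lin (\<Theta> \<alpha> \<beta>) x" by blast
  show ?thesis
  proof (rule that)
    show "linfun (tensor_algebra R S) \<psi>" using \<psi>(1) by (simp add: tensor_algebra_def)
    show "\<psi> (tensor R S a b) = \<alpha> a * \<beta> b" if "a \<in> carrier R" "b \<in> carrier S" for a b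
      using that unfolding tensor_def by (subst \<psi>(2)) (auto simp: \<Theta>_def)
  qed
qed

end

section \<open>The algebras attached to a quantum datum\<close>

lemma additive_zmul:
  fixes f :: "'y::ab_group_add \<Rightarrow> int"
  assumes "Modules.additive f"
  shows "f (zmul n y) = n * f y"
proof -
  interpret Z: Modules.module "zmul :: int \<Rightarrow> 'y \<Rightarrow> 'y" by (rule module_zmul)
  note add = additive.add[OF assms] and minus = additive.minus[OF assms]
  have nat: "f (zmul (int n) y) = int n * f y" for n
  proof (induction n)
    case 0 then show ?case by (simp add: additive.zero[OF assms])
  next
    case (Suc n)
    have "zmul (int (Suc n)) y = zmul (int n) y + y"
      using Z.scale_left_distrib[of "int n" 1 y] by (simp add: add.commute)
    then show ?case using Suc by (simp add: add algebra_simps)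
  qed
  show ?thesis
  proof (cases "n \<ge> 0")
    case True then show ?thesis using nat[of "nat n"] by simp
  next
    case False
    then have "zmul n y = - zmul (int (nat (- n))) y" by simp
    then show ?thesis using nat[of "nat (- n)"] False by (simp add: minus)
  qed
qed

lemma monoid_additive_group: "monoid additive_group"
  by (rule comm_group.axioms(1)[OF comm_group_additive_group, THEN comm_monoid.axioms(1)])

lemma monoid_word_monoid: "monoid word_monoid"
  by (rule monoidI) (auto simp: word_monoid_def)

lemma word_monoid_simps [simp]:
  "v \<otimes>\<^bsub>word_monoid\<^esub> w = v @ w" "\<one>\<^bsub>word_monoid\<^esub> = []" "w \<in> carrier word_monoid"
  by (simp_all add: word_monoid_def)

lemma additive_group_simps [simp]:
  "v \<otimes>\<^bsub>additive_group\<^esub> w = v + w" "\<one>\<^bsub>additive_group\<^esub> = 0" "w \<in> carrier additive_group"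
  by (simp_all add: additive_group_def)

lemma qroot_nonzero [simp]: "qroot \<noteq> 0"
  by (simp add: qroot_def Zero_fract_def eq_fract)

lemma qi_nonzero [simp]: "qi D i \<noteq> 0"
  by (simp add: qi_def)

text \<open>The entries of the representation of \<open>\<B>\<^sub>q\<close> by lower triangular matrices of size two in
  which \<open>f\<^sub>i\<close> acts by the matrix unit in position \<open>(1,0)\<close>, every other \<open>f\<^sub>j\<close> by zero, and \<open>q\<^sup>y\<close>
  by \<open>diag(1, a y)\<close>.\<close>

fun diag_entry :: "('y \<Rightarrow> 'f::field) \<Rightarrow> ('i, 'y) bq_gen list \<Rightarrow> 'f" where
  "diag_entry a [] = 1"
| "diag_entry a (QGen y # w) = a y * diag_entry a w"
| "diag_entry a (FGen j # w) = 0"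

fun off_entry :: "'i \<Rightarrow> ('y \<Rightarrow> 'f::field) \<Rightarrow> ('i, 'y) bq_gen list \<Rightarrow> 'f" where
  "off_entry i a [] = 0"
| "off_entry i a (QGen y # w) = a y * off_entry i a w"
| "off_entry i a (FGen j # w) = (if j = i then diag_entry (\<lambda>_. 1) w else 0)"

lemma diag_entry_append: "diag_entry a (v @ w) = diag_entry a v * diag_entry a w"
  by (induction a v rule: diag_entry.induct) (auto simp: mult.assoc)

text \<open>The (1,0) entry of a product of two lower triangular matrices; the constant function 1
  yields the upper left entry, and \<open>a\<close> the lower right one.\<close>

lemma off_entry_append:
  "off_entry i a (v @ w) = off_entry i a v * diag_entry (\<lambda>_. 1) w + diag_entry a v * off_entry i a w"
  by (induction i a v rule: off_entry.induct) (auto simp: diag_entry_append algebra_simps)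

interpretation free: falgebra "free_algebra :: (qfield, 'g list \<Rightarrow> qfield) module"
  by (rule monoid_algebra_falgebra[OF monoid_word_monoid])

section \<open>Relations in \<open>\<B>\<^sub>q\<close>, in its tensor square and in A~_q\<close>

locale qdatum =
  fixes D :: "('i::finite, 'x::ab_group_add, 'y::ab_group_add) quantum_datum"
  assumes D: "quantum_datum D"
begin

lemma additive_pairing: "Modules.additive (\<lambda>y. pairing D y x)"
  using D unfolding quantum_datum_def root_datum_def perfect_pairing_def by blast

lemma pairing_coroot: "pairing D (zmul n (coroot D i)) (sroot D j) = n * cartan D i j"
  using D additive_zmul[OF additive_pairing]
  unfolding quantum_datum_def root_datum_def by simp

lemma Bq_rels_carrier: "Bq_rels D \<subseteq> carrier free_algebra"
  unfolding Bq_rels_def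
  by (auto intro!: free.minus_closed free.smult_closed simp: monoid_algebra_simps(1))

sublocale BI: falgebra_ideal free_algebra "Bq_ideal D"
  by (intro falgebra_ideal.intro free.falgebra_axioms)
     (simp add: Bq_ideal_def free.genideal_ideal[OF Bq_rels_carrier])

sublocale B: falgebra "Bq D"
  unfolding Bq_def by (rule BI.quot_falgebra)

lemma Bq_rel:
  "u \<ominus>\<^bsub>free_algebra\<^esub> w \<in> Bq_rels D \<Longrightarrow> u \<in> carrier free_algebra \<Longrightarrow> w \<in> carrier free_algebra \<Longrightarrow>
    Bq_ideal D +>\<^bsub>free_algebra\<^esub> u = Bq_ideal D +>\<^bsub>free_algebra\<^esub> w"
  using free.genideal_self[OF Bq_rels_carrier] by (intro BI.coset_eqI) (auto simp: Bq_ideal_def)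

lemma Bq_q_closed [simp]: "Bq_q D y \<in> carrier (Bq D)"
  unfolding Bq_q_def Bq_def by (rule BI.quot_mem) simp

lemma Bq_f_closed [simp]: "Bq_f D i \<in> carrier (Bq D)"
  unfolding Bq_f_def Bq_def by (rule BI.quot_mem) simp

lemma Bq_q_zero: "Bq_q D 0 = \<one>\<^bsub>Bq D\<^esub>"
proof -
  have "mbasis [QGen 0] \<ominus>\<^bsub>free_algebra\<^esub> \<one>\<^bsub>free_algebra\<^esub> \<in> Bq_rels D"
    unfolding Bq_rels_def by blast
  from Bq_rel[OF this] show ?thesis
    by (simp add: Bq_q_def Bq_def quot_algebra_simps)
qed

lemma Bq_q_add: "Bq_q D y \<otimes>\<^bsub>Bq D\<^esub> Bq_q D z = Bq_q D (y + z)"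
proof -
  have "mbasis [QGen y, QGen z] \<ominus>\<^bsub>free_algebra\<^esub> mbasis [QGen (y + z)] \<in> Bq_rels D"
    unfolding Bq_rels_def by blast
  from Bq_rel[OF this] show ?thesis
    by (simp add: Bq_q_def Bq_def BI.quot_mult mbasis_mult)
qed

lemma Bq_q_f: "Bq_q D y \<otimes>\<^bsub>Bq D\<^esub> Bq_f D i =
  (qroot powi (- pairing D y (sroot D i))) \<odot>\<^bsub>Bq D\<^esub> (Bq_f D i \<otimes>\<^bsub>Bq D\<^esub> Bq_q D y)"
proof -
  let ?c = "qroot powi (- pairing D y (sroot D i))"
  have "mbasis [QGen y, FGen i, QGen (- y)] \<ominus>\<^bsub>free_algebra\<^esub> ?c \<odot>\<^bsub>free_algebra\<^esub> mbasis [FGen i] \<in> Bq_rels D"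
    unfolding Bq_rels_def by blast
  from Bq_rel[OF this]
  have "Bq_q D y \<otimes>\<^bsub>Bq D\<^esub> Bq_f D i \<otimes>\<^bsub>Bq D\<^esub> Bq_q D (- y) = ?c \<odot>\<^bsub>Bq D\<^esub> Bq_f D i"
    by (simp add: Bq_q_def Bq_f_def Bq_def BI.quot_mult BI.quot_smult mbasis_mult)
  then have "Bq_q D y \<otimes>\<^bsub>Bq D\<^esub> Bq_f D i \<otimes>\<^bsub>Bq D\<^esub> (Bq_q D (- y) \<otimes>\<^bsub>Bq D\<^esub> Bq_q D y)
      = (?c \<odot>\<^bsub>Bq D\<^esub> Bq_f D i) \<otimes>\<^bsub>Bq D\<^esub> Bq_q D y"
    by (simp add: B.m_assoc[symmetric])
  then show ?thesis by (simp add: Bq_q_add Bq_q_zero B.smult_mult_l)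
qed

lemma Bq_f_f: "Bq_f D i \<otimes>\<^bsub>Bq D\<^esub> Bq_f D j =
  (qi D i powi (- orient D i j * cartan D i j)) \<odot>\<^bsub>Bq D\<^esub> (Bq_f D j \<otimes>\<^bsub>Bq D\<^esub> Bq_f D i)"
proof -
  let ?c = "qi D i powi (- orient D i j * cartan D i j)"
  have "mbasis [FGen i, FGen j] \<ominus>\<^bsub>free_algebra\<^esub> ?c \<odot>\<^bsub>free_algebra\<^esub> mbasis [FGen j, FGen i] \<in> Bq_rels D"
    unfolding Bq_rels_def by blast
  from Bq_rel[OF this] show ?thesis
    by (simp add: Bq_f_def Bq_def BI.quot_mult BI.quot_smult mbasis_mult)
qed

lemma Bq_k_inv: "inv\<^bsub>Bq D\<^esub> Bq_k D i = Bq_q D (- zmul (wt D i) (coroot D i))"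
  by (rule B.inv_char) (simp_all add: Bq_k_def Bq_q_add Bq_q_zero)

lemma Bq_functionals:
  obtains \<phi> \<psi> where "linfun (Bq D) \<phi>" "linfun (Bq D) \<psi>"
    "\<And>y. \<phi> (Bq_q D y) = 1" "\<psi> (Bq_f D i) = 1"
proof -
  \<comment> \<open>With q^y = diag(1, a y) and f_i the matrix unit in position (1,0), conjugating
    f_i by q^y multiplies it by a y, so the defining relation dictates this value. Both sides of
    every relation between two f's act by zero.\<close>
  define a where "a y = qroot powi (- pairing D y (sroot D i))" for y
  have a: "a (y + z) = a y * a z" for y z
    by (simp add: a_def power_int_diff power_int_minus divide_inverse additive.add[OF additive_pairing])
  have a0: "a 0 = 1" by (simp add: a_def additive.zero[OF additive_pairing])
  let ?X = "\<lambda>a :: 'y \<Rightarrow> qfield. lin (diag_entry a)" and ?d = "lin (off_entry i a)"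
  \<comment> \<open>The (1,0) entry of a product involves both diagonal entries, so the three
    entries are required to vanish together in order that J be an ideal.\<close>
  define J where "J = {u \<in> carrier free_algebra. ?X (\<lambda>_. 1) u = 0 \<and> ?X a u = 0 \<and> ?d u = 0}"
  have fin: "finite {m. u m \<noteq> 0}" if "u \<in> carrier free_algebra" for u :: "('i, 'y) bq_gen list \<Rightarrow> qfield"
    using that by (simp add: monoid_algebra_carrier)
  have X: "?X b (u \<otimes>\<^bsub>free_algebra\<^esub> w) = ?X b u * ?X b w"
    if "u \<in> carrier free_algebra" "w \<in> carrier free_algebra" for b and u w :: "('i, 'y) bq_gen list \<Rightarrow> qfield"
    by (simp only: lin_mult_lin[OF fin[OF that(1)] fin[OF that(2)]] word_monoid_simps
          diag_entry_append lin_times)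
  have d: "?d (u \<otimes>\<^bsub>free_algebra\<^esub> w) = ?d u * ?X (\<lambda>_. 1) w + ?X a u * ?d w"
    if "u \<in> carrier free_algebra" "w \<in> carrier free_algebra" for u w
    by (simp only: lin_mult_lin[OF fin[OF that(1)] fin[OF that(2)]] word_monoid_simps
          off_entry_append lin_times lin_plus)
  have "ideal J free_algebra"
  proof (rule idealI[OF free.ring_axioms])
    show "subgroup J (add_monoid free_algebra)"
    proof (rule free.add.subgroupI)
      show "J \<subseteq> carrier free_algebra" by (auto simp: J_def)
      have "\<zero>\<^bsub>free_algebra\<^esub> \<in> J" by (simp add: J_def, simp add: monoid_algebra_simps)
      then show "J \<noteq> {}" by blast
      fix u w assume h: "u \<in> J" "w \<in> J"
      then show "u \<oplus>\<^bsub>free_algebra\<^esub> w \<in> J"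
        by (simp add: J_def linfun_add[OF linfun_lin])
      have u: "u \<in> carrier free_algebra" using h by (simp add: J_def)
      then have "\<ominus>\<^bsub>free_algebra\<^esub> u = \<zero>\<^bsub>free_algebra\<^esub> \<ominus>\<^bsub>free_algebra\<^esub> u" by (simp add: a_minus_def)
      moreover have "lin \<theta> \<zero>\<^bsub>free_algebra\<^esub> = 0" for \<theta> :: "('i, 'y) bq_gen list \<Rightarrow> qfield"
        by (simp add: monoid_algebra_simps)
      ultimately show "\<ominus>\<^bsub>free_algebra\<^esub> u \<in> J"
        using h u by (simp add: J_def lin_minus[OF monoid_word_monoid free.zero_closed u])
    qed
  qed (auto simp: J_def X d)
  moreover have "Bq_rels D \<subseteq> J"
  proof
    fix r assume r: "r \<in> Bq_rels D"
    then have "r \<in> carrier free_algebra" using Bq_rels_carrier by auto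
    with r show "r \<in> J"
      unfolding Bq_rels_def J_def monoid_algebra_simps(1)
      by (elim UnE) (auto simp: lin_minus[OF monoid_word_monoid] linfun_smult[OF linfun_lin] a a0
          simp flip: a_def)
  qed
  ultimately have "Bq_ideal D \<subseteq> J"
    unfolding Bq_ideal_def by (rule free.genideal_minimal)
  then have z: "?X (\<lambda>_. 1) u = 0" "?d u = 0" if "u \<in> Bq_ideal D" for u
    using that by (auto simp: J_def)
  obtain \<phi> where \<phi>: "linfun (Bq D) \<phi>"
    "\<And>x. x \<in> carrier free_algebra \<Longrightarrow> \<phi> (Bq_ideal D +>\<^bsub>free_algebra\<^esub> x) = ?X (\<lambda>_. 1) x"
    using BI.quot_linfun[OF linfun_lin z(1)] unfolding Bq_def by blast
  obtain \<psi> where \<psi>: "linfun (Bq D) \<psi>"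
    "\<And>x. x \<in> carrier free_algebra \<Longrightarrow> \<psi> (Bq_ideal D +>\<^bsub>free_algebra\<^esub> x) = ?d x"
    using BI.quot_linfun[OF linfun_lin z(2)] unfolding Bq_def by blast
  show ?thesis
    by (rule that[OF \<phi>(1) \<psi>(1)]) (simp_all add: Bq_q_def Bq_f_def \<phi>(2) \<psi>(2))
qed

sublocale BB: tensor_product "Bq D" "Bq D" ..

sublocale BqBq: falgebra "BqBq D"
  unfolding BqBq_def by (rule BB.tensor_falgebra)

lemma f1_BqBq [simp]: "Aqt0_f1 D i \<in> carrier (BqBq D)"
  by (simp add: Aqt0_f1_def BqBq_def)

lemma f2_BqBq [simp]: "Aqt0_f2 D i \<in> carrier (BqBq D)"
  by (simp add: Aqt0_f2_def BqBq_def Bq_k_inv)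

lemma f1_f1_BqBq: "Aqt0_f1 D i \<otimes>\<^bsub>BqBq D\<^esub> Aqt0_f1 D j =
    (qi D i powi (- orient D i j * cartan D i j)) \<odot>\<^bsub>BqBq D\<^esub> (Aqt0_f1 D j \<otimes>\<^bsub>BqBq D\<^esub> Aqt0_f1 D i)"
  by (simp add: Aqt0_f1_def BqBq_def BB.tensor_mult Bq_f_f[of i j] BB.tensor_smult_left)

lemma f2_f2_BqBq: "Aqt0_f2 D i \<otimes>\<^bsub>BqBq D\<^esub> Aqt0_f2 D j =
    (qi D i powi (- orient D i j * cartan D i j)) \<odot>\<^bsub>BqBq D\<^esub> (Aqt0_f2 D j \<otimes>\<^bsub>BqBq D\<^esub> Aqt0_f2 D i)"
  by (simp add: Aqt0_f2_def BqBq_def BB.tensor_mult Bq_f_f[of i j] BB.tensor_smult_right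
      Bq_k_inv Bq_q_add add.commute)

text \<open>The scalar arises in the first tensor factor alone: the k_j^-1 inside f_j2 passes f_i
  with the factor q^(d_j a_ji) = q_j^(a_ji).\<close>

lemma f2_f1_BqBq: "Aqt0_f2 D j \<otimes>\<^bsub>BqBq D\<^esub> Aqt0_f1 D i =
    (qi D j powi cartan D j i) \<odot>\<^bsub>BqBq D\<^esub> (Aqt0_f1 D i \<otimes>\<^bsub>BqBq D\<^esub> Aqt0_f2 D j)"
proof -
  have "- pairing D (- zmul (wt D j) (coroot D j)) (sroot D i) = wt D j * cartan D j i"
    by (simp add: additive.minus[OF additive_pairing] pairing_coroot)
  then have "Bq_q D (- zmul (wt D j) (coroot D j)) \<otimes>\<^bsub>Bq D\<^esub> Bq_f D i =
      (qi D j powi cartan D j i) \<odot>\<^bsub>Bq D\<^esub> (Bq_f D i \<otimes>\<^bsub>Bq D\<^esub> Bq_q D (- zmul (wt D j) (coroot D j)))"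
    by (simp only: Bq_q_f qi_def power_int_mult)
  then show ?thesis
    by (simp add: Aqt0_f1_def Aqt0_f2_def BqBq_def BB.tensor_mult BB.tensor_smult_left Bq_k_inv)
qed

lemma Aqt0_gens: "range (Aqt0_f1 D) \<union> range (Aqt0_f2 D) \<subseteq> carrier (BqBq D)"
  by auto

sublocale A0: falgebra "Aqt0 D"
  unfolding Aqt0_def by (rule subalgebra_falgebra(1)[OF BqBq.falgebra_axioms Aqt0_gens])

lemma Aqt0_closed [simp]: "Aqt0_f1 D i \<in> carrier (Aqt0 D)" "Aqt0_f2 D i \<in> carrier (Aqt0 D)"
  using subalgebra_falgebra(3)[OF BqBq.falgebra_axioms Aqt0_gens] by (auto simp: Aqt0_def)

lemma Aqt0_ops: "monoid.mult (Aqt0 D) = monoid.mult (BqBq D)" "module.smult (Aqt0 D) = module.smult (BqBq D)"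
  by (simp_all add: Aqt0_def)

lemma linfun_Aqt0: "linfun (BqBq D) \<phi> \<Longrightarrow> linfun (Aqt0 D) \<phi>"
  unfolding Aqt0_def
  by (rule linfun_subset[OF _ subalgebra_falgebra(2)[OF BqBq.falgebra_axioms Aqt0_gens]])

sublocale U: falgebra "Uq0 :: (qfield, 'y \<Rightarrow> qfield) module"
  unfolding Uq0_def by (rule monoid_algebra_falgebra[OF monoid_additive_group])

sublocale AU: tensor_product "Aqt0 D" "Uq0 :: (qfield, 'y \<Rightarrow> qfield) module" ..

sublocale A: falgebra "Aqt D"
  unfolding Aqt_def by (rule AU.tensor_falgebra)

lemma Aqt_falgebra: "falgebra (Aqt D)" ..

lemma mbasis_Uq0 [simp]: "mbasis y \<in> carrier Uq0"
  by (simp add: Uq0_def)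

lemma Aqt_closed [simp]:
  "Aqt_f1 D i \<in> carrier (Aqt D)" "Aqt_f2 D i \<in> carrier (Aqt D)" "Aqt_q D y \<in> carrier (Aqt D)"
  by (simp_all add: Aqt_f1_def Aqt_f2_def Aqt_q_def Aqt_def)

lemma f1_f1_Aqt: "Aqt_f1 D i \<otimes>\<^bsub>Aqt D\<^esub> Aqt_f1 D j =
    (qi D i powi (- orient D i j * cartan D i j)) \<odot>\<^bsub>Aqt D\<^esub> (Aqt_f1 D j \<otimes>\<^bsub>Aqt D\<^esub> Aqt_f1 D i)"
  using A0.m_closed[of "Aqt0_f1 D j" "Aqt0_f1 D i"]
  by (simp add: Aqt_f1_def Aqt_def AU.tensor_mult Aqt0_ops f1_f1_BqBq[of i j]
      AU.tensor_smult_left[unfolded Aqt0_ops])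

lemma f2_f2_Aqt: "Aqt_f2 D i \<otimes>\<^bsub>Aqt D\<^esub> Aqt_f2 D j =
    (qi D i powi (- orient D i j * cartan D i j)) \<odot>\<^bsub>Aqt D\<^esub> (Aqt_f2 D j \<otimes>\<^bsub>Aqt D\<^esub> Aqt_f2 D i)"
  using A0.m_closed[of "Aqt0_f2 D j" "Aqt0_f2 D i"]
  by (simp add: Aqt_f2_def Aqt_def AU.tensor_mult Aqt0_ops f2_f2_BqBq[of i j]
      AU.tensor_smult_left[unfolded Aqt0_ops])

lemma f2_f1_Aqt: "Aqt_f2 D j \<otimes>\<^bsub>Aqt D\<^esub> Aqt_f1 D i =
    (qi D j powi cartan D j i) \<odot>\<^bsub>Aqt D\<^esub> (Aqt_f1 D i \<otimes>\<^bsub>Aqt D\<^esub> Aqt_f2 D j)"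
  using A0.m_closed[of "Aqt0_f1 D i" "Aqt0_f2 D j"]
  by (simp add: Aqt_f1_def Aqt_f2_def Aqt_def AU.tensor_mult Aqt0_ops f2_f1_BqBq[of j i]
      AU.tensor_smult_left[unfolded Aqt0_ops])

lemma Aqt_q_zero: "Aqt_q D 0 = \<one>\<^bsub>Aqt D\<^esub>"
  by (simp add: Aqt_q_def Aqt_def AU.tensor_one) (simp add: Uq0_def monoid_algebra_simps)

lemma Aqt_q_add: "Aqt_q D y \<otimes>\<^bsub>Aqt D\<^esub> Aqt_q D z = Aqt_q D (y + z)"
  by (simp add: Aqt_q_def Aqt_def AU.tensor_mult) (simp add: Uq0_def mbasis_mult)

lemma Aqt_q_central:
  assumes "z \<in> carrier (Aqt D)"
  shows "Aqt_q D y \<otimes>\<^bsub>Aqt D\<^esub> z = z \<otimes>\<^bsub>Aqt D\<^esub> Aqt_q D y"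
  unfolding Aqt_q_def Aqt_def
  by (rule AU.tensor_central)
     (use assms in \<open>auto simp: Aqt_def Uq0_def add.commute intro: mbasis_central\<close>)

text \<open>Functionals on the tensor factors multiply. Using \<psi>, \<phi> and the sum of
  coefficients on U_q^0 gives the value 1 on f_i1; exchanging \<psi> and \<phi> gives 1 on f_i2,
  because \<phi> is 1 on every q^y and hence on k_i^-1.\<close>

lemma Aqt_f_nonzero: "Aqt_f1 D i \<noteq> \<zero>\<^bsub>Aqt D\<^esub>" "Aqt_f2 D i \<noteq> \<zero>\<^bsub>Aqt D\<^esub>"
proof -
  obtain \<phi> \<psi> where h: "linfun (Bq D) \<phi>" "linfun (Bq D) \<psi>"
    "\<And>y. \<phi> (Bq_q D y) = 1" "\<psi> (Bq_f D i) = 1" using Bq_functionals[of i] by blast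
  have one: "\<phi> \<one>\<^bsub>Bq D\<^esub> = 1" using h(3)[of 0] by (simp add: Bq_q_zero)
  have U: "linfun Uq0 (lin (\<lambda>_. 1) :: ('y \<Rightarrow> qfield) \<Rightarrow> qfield)"
    unfolding Uq0_def by (rule linfun_lin)
  have U1: "lin (\<lambda>_. 1) \<one>\<^bsub>Uq0\<^esub> = (1 :: qfield)"
    by (simp add: Uq0_def monoid_algebra_simps)
  obtain \<chi> where \<chi>: "linfun (BqBq D) \<chi>"
    "\<And>a b. a \<in> carrier (Bq D) \<Longrightarrow> b \<in> carrier (Bq D) \<Longrightarrow> \<chi> (tensor (Bq D) (Bq D) a b) = \<psi> a * \<phi> b"
    using BB.tensor_linfun[OF h(2,1)] unfolding BqBq_def by blast
  obtain \<omega> where \<omega>: "linfun (Aqt D) \<omega>"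
    "\<And>a b. a \<in> carrier (Aqt0 D) \<Longrightarrow> b \<in> carrier Uq0 \<Longrightarrow> \<omega> (tensor (Aqt0 D) Uq0 a b) = \<chi> a * lin (\<lambda>_. 1) b"
    using AU.tensor_linfun[OF linfun_Aqt0[OF \<chi>(1)] U] unfolding Aqt_def by blast
  have "\<omega> (Aqt_f1 D i) = 1"
    unfolding Aqt_f1_def by (simp add: \<omega>(2) U1) (simp add: Aqt0_f1_def \<chi>(2) h one)
  then show "Aqt_f1 D i \<noteq> \<zero>\<^bsub>Aqt D\<^esub>" using A.linfun_zero[OF \<omega>(1)] by auto
  obtain \<chi>' where \<chi>': "linfun (BqBq D) \<chi>'"
    "\<And>a b. a \<in> carrier (Bq D) \<Longrightarrow> b \<in> carrier (Bq D) \<Longrightarrow> \<chi>' (tensor (Bq D) (Bq D) a b) = \<phi> a * \<psi> b"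
    using BB.tensor_linfun[OF h(1,2)] unfolding BqBq_def by blast
  obtain \<omega>' where \<omega>': "linfun (Aqt D) \<omega>'"
    "\<And>a b. a \<in> carrier (Aqt0 D) \<Longrightarrow> b \<in> carrier Uq0 \<Longrightarrow> \<omega>' (tensor (Aqt0 D) Uq0 a b) = \<chi>' a * lin (\<lambda>_. 1) b"
    using AU.tensor_linfun[OF linfun_Aqt0[OF \<chi>'(1)] U] unfolding Aqt_def by blast
  have "\<omega>' (Aqt_f2 D i) = 1"
    unfolding Aqt_f2_def by (simp add: \<omega>'(2) U1) (simp add: Aqt0_f2_def \<chi>'(2) h one Bq_k_inv)
  then show "Aqt_f2 D i \<noteq> \<zero>\<^bsub>Aqt D\<^esub>" using A.linfun_zero[OF \<omega>'(1)] by auto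
qed

end

section \<open>Central scalars and quasi-commuting elements in a skew field\<close>

lemma exponential_beats_polynomial: "\<exists>j. (n * j + 1) ^ L < (2::nat) ^ j"
proof -
  \<comment> \<open>The witness is j = 2 ^ t. Since n * 2 ^ t + 1 \<le> 2 ^ (n + t), it is enough
    that (n + t) * L < 2 ^ t, and t = 3 * u is chosen so that (n + t) * L \<le> u ^ 3 < 2 ^
    t.\<close>
  define u where "u = n + L + 4"
  define t where "t = 3 * u"
  have "(n + t) * L \<le> (4 * u) * u"
    by (rule mult_mono) (auto simp: t_def u_def)
  also have "\<dots> \<le> u * u * u" by (rule mult_right_mono, rule mult_right_mono) (simp_all add: u_def)
  also have "\<dots> < 2 ^ u * 2 ^ u * 2 ^ u"
  proof -
    have "u < 2 ^ u" by simp
    then show ?thesis by (intro mult_strict_mono) auto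
  qed
  also have "\<dots> = 2 ^ t" by (simp add: t_def power_add[symmetric])
  finally have t: "(n + t) * L < 2 ^ t" .
  have "n * 2 ^ t + 1 \<le> (n + 1) * (2::nat) ^ t" by simp
  also have "\<dots> \<le> 2 ^ n * 2 ^ t"
    using less_exp[of n] by (intro mult_right_mono) (simp_all add: Suc_leI)
  finally have "n * 2 ^ t + 1 \<le> (2::nat) ^ (n + t)" by (simp add: power_add)
  then have "(n * 2 ^ t + 1) ^ L \<le> ((2::nat) ^ (n + t)) ^ L" by (rule power_mono) simp
  also have "\<dots> = 2 ^ ((n + t) * L)" by (simp add: power_mult)
  also have "\<dots> < 2 ^ (2 ^ t)" using t by simp
  finally show ?thesis by blast
qed

locale central_scalars =
  fixes sc :: "'f::field \<Rightarrow> 'k::division_ring"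
  assumes sc_add: "sc (c + d) = sc c + sc d"
    and sc_mult: "sc (c * d) = sc c * sc d"
    and sc_one [simp]: "sc 1 = 1"
    and sc_central: "sc c * k = k * sc c"
begin

lemma sc_zero [simp]: "sc 0 = 0"
  using sc_add[of 0 0] by simp

lemma sc_minus: "sc (- c) = - sc c"
  using sc_add[of c "- c"] by (simp add: eq_neg_iff_add_eq_0 add.commute)

lemma sc_eq_0 [simp]: "sc c = 0 \<longleftrightarrow> c = 0"
  using sc_mult[of c "inverse c"] by (cases "c = 0") auto

lemma sc_eq_iff: "sc c = sc d \<longleftrightarrow> c = d"
  using sc_eq_0[of "c - d"] sc_add[of c "- d"] by (simp add: sc_minus del: sc_eq_0)

lemma sc_inverse: "sc (inverse c) = inverse (sc c)"
proof (cases "c = 0")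
  case False
  then have "sc (inverse c) * sc c = 1" by (simp flip: sc_mult)
  then show ?thesis by (metis inverse_unique sc_central)
qed simp

lemma sc_power: "sc (c ^ n) = sc c ^ n"
  by (induction n) (auto simp: sc_mult)

lemma sc_powi: "sc (c powi n) = sc c powi n"
  by (simp add: power_int_def sc_power sc_inverse)

lemma sc_left_commute: "k * (sc c * l) = sc c * (k * l)"
  by (metis mult.assoc sc_central)

sublocale VS: vector_space "\<lambda>c x. sc c * x"
  by unfold_locales (simp_all add: distrib_left distrib_right sc_add sc_mult mult.assoc)

text \<open>Requiring c to be nonzero makes the relation symmetric up to inverting c, which in turn
  lets it pass to inverses of x and y.\<close>

definition qc :: "'f \<Rightarrow> 'k \<Rightarrow> 'k \<Rightarrow> bool" where
  "qc c x y \<longleftrightarrow> c \<noteq> 0 \<and> x * y = sc c * (y * x)"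

lemma qcI: "c \<noteq> 0 \<Longrightarrow> x * y = sc c * (y * x) \<Longrightarrow> qc c x y"
  by (simp add: qc_def)

lemma qcD: "qc c x y \<Longrightarrow> x * y = sc c * (y * x)"
  by (simp add: qc_def)

lemma qc_sym: "qc c x y \<Longrightarrow> qc (inverse c) y x"
  by (auto simp: qc_def sc_inverse mult.assoc[symmetric])

lemma qc_mult_right: "qc c x y \<Longrightarrow> qc d x z \<Longrightarrow> qc (c * d) x (y * z)"
  unfolding qc_def
proof (elim conjE, intro conjI)
  assume h: "c \<noteq> 0" "d \<noteq> 0" "x * y = sc c * (y * x)" "x * z = sc d * (z * x)"
  have "x * (y * z) = sc c * (y * (x * z))" by (simp add: mult.assoc[symmetric] h(3))
  also have "\<dots> = sc c * (sc d * (y * (z * x)))" unfolding h(4) sc_left_commute[of y] ..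
  finally show "x * (y * z) = sc (c * d) * (y * z * x)" unfolding sc_mult mult.assoc .
qed auto

lemma qc_mult_left: "qc c x z \<Longrightarrow> qc d y z \<Longrightarrow> qc (c * d) (x * y) z"
  using qc_sym[OF qc_mult_right[OF qc_sym qc_sym]] by (simp add: mult.commute)

lemma qc_inverse_right: "qc c x y \<Longrightarrow> qc (inverse c) x (inverse y)"
proof (cases "y = 0")
  case False
  assume h: "qc c x y"
  then have "inverse y * (x * y) * inverse y = inverse y * (sc c * (y * x)) * inverse y"
    by (simp add: qcD)
  then have "inverse y * x = sc c * (x * inverse y)"
    using False by (simp add: sc_left_commute[of "inverse y"] mult.assoc) (simp add: mult.assoc[symmetric])
  moreover have "c \<noteq> 0" using h by (simp add: qc_def)
  ultimately show ?thesis by (auto intro: qc_sym qcI)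
qed (simp add: qc_def)

lemma qc_inverse_left: "qc c x y \<Longrightarrow> qc (inverse c) (inverse x) y"
  using qc_sym[OF qc_inverse_right[OF qc_sym]] by simp

lemma qc_power_left: "qc c x y \<Longrightarrow> qc (c ^ n) (x ^ n) y"
  by (induction n) (auto intro: qc_mult_left, simp add: qc_def)

section \<open>The Ore condition for algebras generated by quasi-commuting elements\<close>

text \<open>Ordered monomials in the list, each exponent bounded separately by n. Their number is at
  most polynomial in n, of degree the length of the list.\<close>

fun mons :: "'k list \<Rightarrow> nat \<Rightarrow> 'k set" where
  "mons [] n = {1}"
| "mons (x # xs) n = (\<lambda>(e, m). x ^ e * m) ` ({..n} \<times> mons xs n)"

lemma finite_mons: "finite (mons xs n)"
  by (induction xs) auto

lemma card_mons: "card (mons xs n) \<le> (n + 1) ^ length xs"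
proof (induction xs)
  case (Cons x xs)
  have "card (mons (x # xs) n) \<le> card ({..n} \<times> mons xs n)"
    by (simp only: mons.simps) (rule card_image_le, simp add: finite_mons)
  also have "\<dots> \<le> (n + 1) * (n + 1) ^ length xs"
    unfolding card_cartesian_product by (rule mult_mono) (use Cons in auto)
  finally show ?case by (simp only: list.size(4) power_Suc add_Suc_right add_0_right)
qed simp

lemma mons_mono: "n \<le> n' \<Longrightarrow> mons xs n \<subseteq> mons xs n'"
  by (induction xs) (force simp: image_iff)+

lemma mons_one: "1 \<in> mons xs n"
  by (induction xs) (auto simp: image_iff intro!: bexI[of _ "0::nat"] bexI[of _ "1::'k"])

lemma mons_append: "m \<in> mons xs n \<Longrightarrow> m' \<in> mons ys n \<Longrightarrow> m * m' \<in> mons (xs @ ys) n"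
  by (induction xs arbitrary: m) (force simp: mult.assoc image_iff)+

lemma mons_qc:
  "m \<in> mons xs n \<Longrightarrow> (\<And>y. y \<in> set xs \<Longrightarrow> \<exists>c. qc c y z) \<Longrightarrow> \<exists>c. qc c m z"
proof (induction xs arbitrary: m)
  case Nil
  then show ?case by (auto intro!: exI[of _ 1] qcI)
next
  case (Cons x xs)
  then obtain e m' where m: "m = x ^ e * m'" "m' \<in> mons xs n" by auto
  obtain c d where "qc c x z" "qc d m' z" using Cons m(2) by (metis list.set_intros)
  then show ?case unfolding m(1) by (blast intro: qc_mult_left qc_power_left)
qed

text \<open>Moving the power of x from the second monomial leftwards past the tail of the first
  costs only a scalar; the two tails are handled by induction.\<close>

lemma mons_mult:
  assumes "\<And>x y. x \<in> set xs \<Longrightarrow> y \<in> set xs \<Longrightarrow> \<exists>c. qc c x y"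
  shows "m \<in> mons xs n \<Longrightarrow> m' \<in> mons xs n' \<Longrightarrow> \<exists>c. \<exists>m''\<in>mons xs (n + n'). m * m' = sc c * m''"
  using assms
proof (induction xs arbitrary: m m')
  case Nil
  then show ?case by (auto intro!: exI[of _ 1])
next
  case (Cons x xs)
  from Cons.prems obtain e m1 e' m1' where m: "m = x ^ e * m1" "m1 \<in> mons xs n" "e \<le> n"
    "m' = x ^ e' * m1'" "m1' \<in> mons xs n'" "e' \<le> n'" by auto
  obtain c m'' where c: "m'' \<in> mons xs (n + n')" "m1 * m1' = sc c * m''"
    using Cons.IH[OF m(2,5)] Cons.prems(3) by (metis list.set_intros(2))
  obtain d where "qc d m1 x" using mons_qc[OF m(2)] Cons.prems(3) by (metis list.set_intros)
  then obtain d where d: "qc d m1 (x ^ e')" by (meson qc_power_left qc_sym)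
  have "m * m' = x ^ e * (m1 * x ^ e') * m1'" by (simp add: m mult.assoc)
  also have "\<dots> = sc d * (x ^ e * x ^ e' * (m1 * m1'))"
    unfolding qcD[OF d] sc_left_commute[of "x ^ e"] mult.assoc ..
  also have "\<dots> = sc (d * c) * (x ^ (e + e') * m'')"
    unfolding c(2) power_add sc_mult mult.assoc
      sc_left_commute[of "x ^ e'" c] sc_left_commute[of "x ^ e" c] ..
  finally have "m * m' = sc (d * c) * (x ^ (e + e') * m'')" .
  moreover have "x ^ (e + e') * m'' \<in> mons (x # xs) (n + n')"
    using c(1) m(3,6) by (force simp: image_iff)
  ultimately show ?case by blast
qed

lemma span_mons_mult:
  assumes "\<And>x y. x \<in> set xs \<Longrightarrow> y \<in> set xs \<Longrightarrow> \<exists>c. qc c x y"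
    and "a \<in> VS.span (mons xs n)" "b \<in> VS.span (mons xs n')"
  shows "a * b \<in> VS.span (mons xs (n + n'))"
  using assms(2)
proof (induction rule: VS.span_induct_alt)
  case (step c x y)
  from assms(3) have "x * b \<in> VS.span (mons xs (n + n'))"
  proof (induction rule: VS.span_induct_alt)
    case (step c' x' y')
    obtain d m where "m \<in> mons xs (n + n')" "x * x' = sc d * m"
      using mons_mult[OF assms(1) \<open>x \<in> mons xs n\<close> step(1)] by metis
    then have "x * x' \<in> VS.span (mons xs (n + n'))" by (auto intro: VS.span_scale VS.span_base)
    then show ?case
      using step by (simp add: distrib_left sc_left_commute[of x] VS.span_add VS.span_scale)
  qed (simp add: VS.span_zero)
  then show ?case using step by (simp add: distrib_right mult.assoc VS.span_add VS.span_scale)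
qed (simp add: VS.span_zero)

text \<open>There may be infinitely many generators q^\<mu>, but each element involves only a finite
  list of them, and it is this list that bounds the growth.\<close>

definition monomial_span :: "'k set \<Rightarrow> 'k set" where
  "monomial_span gens = {a. \<exists>xs n. set xs \<subseteq> gens \<and> a \<in> VS.span (mons xs n)}"

lemma monomial_span_common:
  assumes "a \<in> monomial_span gens" "b \<in> monomial_span gens"
  obtains xs n where "set xs \<subseteq> gens" "a \<in> VS.span (mons xs n)" "b \<in> VS.span (mons xs n)"
proof -
  obtain xs n ys k where h: "set xs \<subseteq> gens" "a \<in> VS.span (mons xs n)" "set ys \<subseteq> gens" "b \<in> VS.span (mons ys k)"
    using assms unfolding monomial_span_def by blast
  have "mons xs n \<subseteq> mons (xs @ ys) (max n k)"
    using mons_append[OF _ mons_one, of _ xs "max n k" ys] mons_mono[of n "max n k" xs] by auto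
  moreover have "mons ys k \<subseteq> mons (xs @ ys) (max n k)"
    using mons_append[OF mons_one, of _ ys "max n k" xs] mons_mono[of k "max n k" ys] by auto
  ultimately show ?thesis
    using h by (intro that[of "xs @ ys" "max n k"]) (auto dest: VS.span_mono)
qed

lemma monomial_span_closed:
  assumes "\<And>x y. x \<in> gens \<Longrightarrow> y \<in> gens \<Longrightarrow> \<exists>c. qc c x y"
  shows "sc c \<in> monomial_span gens" "x \<in> gens \<Longrightarrow> x \<in> monomial_span gens"
    "a \<in> monomial_span gens \<Longrightarrow> b \<in> monomial_span gens \<Longrightarrow> a + b \<in> monomial_span gens"
    "a \<in> monomial_span gens \<Longrightarrow> b \<in> monomial_span gens \<Longrightarrow> a * b \<in> monomial_span gens"
    "a \<in> monomial_span gens \<Longrightarrow> - a \<in> monomial_span gens"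
proof -
  have "sc c \<in> VS.span (mons [] 0)"
    using VS.span_scale[OF VS.span_base, of 1 "mons [] 0" c] by simp
  then show "sc c \<in> monomial_span gens" 
    unfolding monomial_span_def by (intro CollectI exI[of _ "[]"] exI[of _ 0]) simp
  have "x \<in> mons [x] 1" by (force simp: image_iff)
  then show "x \<in> gens \<Longrightarrow> x \<in> monomial_span gens"
    unfolding monomial_span_def by (force intro: VS.span_base exI[of _ "[x]"])
  assume a: "a \<in> monomial_span gens"
  then show "- a \<in> monomial_span gens" unfolding monomial_span_def using VS.span_neg by blast
  assume "b \<in> monomial_span gens"
  then obtain xs n where h: "set xs \<subseteq> gens" "a \<in> VS.span (mons xs n)" "b \<in> VS.span (mons xs n)"
    using monomial_span_common[OF a] by blast
  then show "a + b \<in> monomial_span gens" unfolding monomial_span_def using VS.span_add by blast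
  have "a * b \<in> VS.span (mons xs (n + n))"
    by (rule span_mons_mult[OF _ h(2,3)]) (use assms h(1) in blast)
  then show "a * b \<in> monomial_span gens" unfolding monomial_span_def using h(1) by blast
qed

text \<open>If \<open>a A\<close> and \<open>s A\<close> met only in zero, then the \<open>2\<^sup>j\<close> words of length \<open>j\<close> in \<open>a\<close> and \<open>s\<close>
  would be linearly independent, whereas they lie in a space of polynomially bounded dimension.\<close>

lemma right_Ore:
  assumes qc: "\<And>x y. x \<in> gens \<Longrightarrow> y \<in> gens \<Longrightarrow> \<exists>c. qc c x y"
    and A: "A \<subseteq> monomial_span gens" "\<And>c. sc c \<in> A"
      "\<And>x y. x \<in> A \<Longrightarrow> y \<in> A \<Longrightarrow> x + y \<in> A" "\<And>x y. x \<in> A \<Longrightarrow> y \<in> A \<Longrightarrow> x * y \<in> A"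
    and as: "a \<in> A" "s \<in> A" "s \<noteq> 0"
  shows "\<exists>a'\<in>A. \<exists>s'\<in>A. s' \<noteq> 0 \<and> s * a' = a * s'"
proof (rule ccontr)
  assume "\<not> ?thesis"
  then have no: "s' = 0" if "a' \<in> A" "s' \<in> A" "s * a' = a * s'" for a' s' using that by blast
  have A0: "0 \<in> A" and A1: "1 \<in> A" using A(2)[of 0] A(2)[of 1] by auto
  have a0: "a \<noteq> 0" using no[of 0 1] A0 A1 by auto
  \<comment> \<open>Failure of the Ore condition in additive form: the sum aA + sA is direct, and
    neither a nor s kills a nonzero element of A.\<close>
  have both: "x = 0 \<and> y = 0" if "x \<in> A" "y \<in> A" "a * x + s * y = 0" for x y
  proof -
    have "s * (sc (-1) * y) = a * x"
      using that(3) by (simp add: sc_minus eq_neg_iff_add_eq_0[symmetric])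
    moreover have "sc (-1) * y \<in> A" using A that by blast
    ultimately have "x = 0" using no that by blast
    then show ?thesis using that as by simp
  qed
  define W where "W j = {w :: bool list. length w = j}" for j
  define ev where "ev w = prod_list (map (\<lambda>b. if b then a else s) w)" for w :: "bool list"
  have fW: "finite (W j)" and cW: "card (W j) = 2 ^ j" for j
    using finite_lists_length_eq[of "UNIV :: bool set" j] card_lists_length_eq[of "UNIV :: bool set" j]
    by (simp_all add: W_def)
  have WS: "(\<Sum>w\<in>W (Suc j). h w) = (\<Sum>w\<in>W j. h (True # w)) + (\<Sum>w\<in>W j. h (False # w))"
    for j and h :: "bool list \<Rightarrow> 'k"
  proof -
    have "W (Suc j) = (#) True ` W j \<union> (#) False ` W j"
      unfolding W_def by (auto simp: length_Suc_conv image_iff)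
    then have "(\<Sum>w\<in>W (Suc j). h w) = (\<Sum>w\<in>(#) True ` W j. h w) + (\<Sum>w\<in>(#) False ` W j. h w)"
      using fW by (simp, intro sum.union_disjoint) auto
    then show ?thesis by (simp add: sum.reindex)
  qed
  have ev_Cons: "ev (b # w) = (if b then a else s) * ev w" for b w by (simp add: ev_def)
  have evA: "ev w \<in> A" for w
    by (induction w) (auto simp: ev_def A1 A(4) as)
  have sumA: "(\<Sum>w\<in>S. sc (u w) * ev w) \<in> A" for S u
    by (induction S rule: infinite_finite_induct) (auto simp: A0 A evA)
  have indep: "\<forall>w\<in>W j. u w = 0" if "(\<Sum>w\<in>W j. sc (u w) * ev w) = 0" for j u
    using that
  proof (induction j arbitrary: u)
    case 0
    then show ?case by (simp add: W_def ev_def)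
  next
    case (Suc j)
    \<comment> \<open>Sorting the words by their first letter turns the relation into a times one
      sum plus s times another. Both sums lie in A, so both vanish and the induction hypothesis
      applies to each.\<close>
    have "a * (\<Sum>w\<in>W j. sc (u (True # w)) * ev w) + s * (\<Sum>w\<in>W j. sc (u (False # w)) * ev w) = 0"
      using Suc.prems unfolding WS ev_Cons sum_distrib_left sc_left_commute[of a] sc_left_commute[of s] if_True if_False .
    from both[OF sumA sumA this]
    have "(\<Sum>w\<in>W j. sc (u (True # w)) * ev w) = 0" "(\<Sum>w\<in>W j. sc (u (False # w)) * ev w) = 0"
      by (rule conjunct1, rule conjunct2)
    then have h: "\<forall>w\<in>W j. u (True # w) = 0" "\<forall>w\<in>W j. u (False # w) = 0"
      using Suc.IH[of "\<lambda>w. u (True # w)"] Suc.IH[of "\<lambda>w. u (False # w)"] by auto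
    show ?case
    proof
      fix w assume "w \<in> W (Suc j)"
      then obtain b v where "w = b # v" "v \<in> W j" by (auto simp: W_def length_Suc_conv)
      then show "u w = 0" using h by (cases b) auto
    qed
  qed
  have inj: "inj_on ev (W j)" for j
  proof (rule inj_onI, rule ccontr)
    fix v w assume h: "v \<in> W j" "w \<in> W j" "ev v = ev w" "v \<noteq> w"
    have "(\<Sum>x\<in>W j. sc (if x = v then 1 else if x = w then -1 else 0) * ev x)
        = (\<Sum>x\<in>{v, w}. sc (if x = v then 1 else if x = w then -1 else 0) * ev x)"
      using h fW by (intro sum.mono_neutral_right) auto
    also have "\<dots> = 0" using h by (simp add: sc_minus)
    finally have "\<forall>x\<in>W j. (if x = v then 1 else if x = w then -1 else 0) = (0::'f)" by (rule indep)
    with h(1) show False by auto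
  qed
  have "VS.independent (ev ` W j)" for j
  proof (rule VS.independent_if_scalars_zero)
    fix f x assume "(\<Sum>x\<in>ev ` W j. sc (f x) * x) = 0" "x \<in> ev ` W j"
    then show "f x = 0" using indep[of "f \<circ> ev" j] by (auto simp: sum.reindex[OF inj])
  qed (simp add: fW)
  moreover obtain xs n where xs: "set xs \<subseteq> gens" "a \<in> VS.span (mons xs n)" "s \<in> VS.span (mons xs n)"
    using monomial_span_common[of a gens s] A(1) as by blast
  have "ev w \<in> VS.span (mons xs (n * length w))" for w
  proof (induction w)
    case Nil
    then show ?case by (simp add: ev_def mons_one VS.span_base)
  next
    case (Cons b w)
    have "(if b then a else s) * ev w \<in> VS.span (mons xs (n + n * length w))"
      by (rule span_mons_mult[OF _ _ Cons]) (use qc xs in auto)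
    then show ?case by (simp add: ev_def)
  qed
  then have "ev ` W j \<subseteq> VS.span (mons xs (n * j))" for j by (auto simp: W_def)
  \<comment> \<open>The 2^j independent words of length j lie in the span of the ordered monomials
    with exponents at most n * j, whose number is polynomial in j.\<close>
  ultimately have "card (ev ` W j) \<le> card (mons xs (n * j))" for j
    using VS.independent_span_bound[OF finite_mons] by blast
  then have "2 ^ j \<le> (n * j + 1) ^ length xs" for j
    using card_mons[of xs "n * j"] by (metis (no_types) card_image cW inj le_trans)
  moreover obtain j where "(n * j + 1) ^ length xs < (2::nat) ^ j"
    using exponential_beats_polynomial by blast
  ultimately show False by (meson not_less)
qed

end

section \<open>Fractions over an Ore subring of a skew field\<close>

text \<open>Since A sits inside a skew field, its fractions are actual elements of \<open>'k\<close>
  and no equivalence classes occur. The Ore condition is the right-hand one, matching fractions a *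
  inverse s.\<close>

locale ore_subring =
  fixes A :: "'k::division_ring set"
  assumes one_A: "1 \<in> A"
    and add_A: "x \<in> A \<Longrightarrow> y \<in> A \<Longrightarrow> x + y \<in> A"
    and mult_A: "x \<in> A \<Longrightarrow> y \<in> A \<Longrightarrow> x * y \<in> A"
    and minus_A: "x \<in> A \<Longrightarrow> - x \<in> A"
    and ore: "a \<in> A \<Longrightarrow> s \<in> A \<Longrightarrow> s \<noteq> 0 \<Longrightarrow> \<exists>a'\<in>A. \<exists>s'\<in>A. s' \<noteq> 0 \<and> s * a' = a * s'"
begin

definition fracs :: "'k set" where
  "fracs = {a * inverse s | a s. a \<in> A \<and> s \<in> A \<and> s \<noteq> 0}"

lemma fracsI: "a \<in> A \<Longrightarrow> s \<in> A \<Longrightarrow> s \<noteq> 0 \<Longrightarrow> a * inverse s \<in> fracs"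
  unfolding fracs_def by blast

lemma A_fracs: "a \<in> A \<Longrightarrow> a \<in> fracs"
  using fracsI[of a 1] one_A by simp

lemma cancel_right:
  fixes u :: 'k
  assumes "u \<noteq> 0" "s \<noteq> 0" shows "a * inverse s = (a * u) * inverse (s * u)"
proof -
  have "(a * u) * inverse (s * u) = a * (u * inverse u) * inverse s"
    unfolding nonzero_inverse_mult_distrib[OF assms(2,1)] mult.assoc ..
  then show ?thesis using assms by simp
qed

lemma fracs_common:
  assumes "s \<in> A" "s \<noteq> 0" "t \<in> A" "t \<noteq> 0"
  obtains u v where "u \<in> A" "v \<in> A" "u \<noteq> 0" "v \<noteq> 0" "s * u = t * v"
proof -
  obtain u v where "u \<in> A" "v \<in> A" "v \<noteq> 0" "s * u = t * v" using ore[of t s] assms by blast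
  moreover from this have "u \<noteq> 0" using assms by auto
  ultimately show ?thesis using that by blast
qed

text \<open>The Ore condition replaces inverse s * b by b' * inverse s', which moves the inner
  denominator to the right.\<close>

lemma fracs_mult_rep:
  assumes "a \<in> A" "s \<in> A" "s \<noteq> 0" "b \<in> A" "t \<in> A" "t \<noteq> 0"
  obtains b' s' where "b' \<in> A" "s' \<in> A" "s' \<noteq> 0" "s * b' = b * s'"
    "(a * inverse s) * (b * inverse t) = (a * b') * inverse (t * s')"
proof -
  obtain b' s' where h: "b' \<in> A" "s' \<in> A" "s' \<noteq> 0" "s * b' = b * s'" using ore assms by metis
  have b': "b' = inverse s * (b * s')" using assms(3) by (simp flip: h(4)) (simp flip: mult.assoc)
  have "(a * b') * inverse (t * s') = a * inverse s * b * (s' * inverse s') * inverse t"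
    unfolding nonzero_inverse_mult_distrib[OF assms(6) h(3)] b' mult.assoc ..
  also have "\<dots> = (a * inverse s) * (b * inverse t)" using h(3) by (simp add: mult.assoc)
  finally show ?thesis using that[OF h] by simp
qed

lemma fracs_add: "x \<in> fracs \<Longrightarrow> y \<in> fracs \<Longrightarrow> x + y \<in> fracs"
proof -
  assume "x \<in> fracs" "y \<in> fracs"
  then obtain a s b t where h: "a \<in> A" "s \<in> A" "s \<noteq> 0" "x = a * inverse s"
    "b \<in> A" "t \<in> A" "t \<noteq> 0" "y = b * inverse t" unfolding fracs_def by blast
  obtain u v where uv: "u \<in> A" "v \<in> A" "u \<noteq> 0" "v \<noteq> 0" "s * u = t * v"
    using fracs_common h by metis
  have "x + y = (a * u + b * v) * inverse (s * u)"
    using cancel_right[of u s a] cancel_right[of v t b] h uv by (simp add: distrib_right)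
  then show ?thesis using h uv by (auto intro!: fracsI add_A mult_A)
qed

lemma fracs_mult: "x \<in> fracs \<Longrightarrow> y \<in> fracs \<Longrightarrow> x * y \<in> fracs"
proof -
  assume "x \<in> fracs" "y \<in> fracs"
  then obtain a s b t where h: "a \<in> A" "s \<in> A" "s \<noteq> 0" "x = a * inverse s"
    "b \<in> A" "t \<in> A" "t \<noteq> 0" "y = b * inverse t" unfolding fracs_def by blast
  obtain b' s' where "b' \<in> A" "s' \<in> A" "s' \<noteq> 0" "x * y = (a * b') * inverse (t * s')"
    using fracs_mult_rep[OF h(1-3) h(5-7)] unfolding h by metis
  then show ?thesis using h by (auto intro!: fracsI mult_A)
qed

lemma fracs_inverse: "x \<in> fracs \<Longrightarrow> inverse x \<in> fracs"
proof -
  assume "x \<in> fracs"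
  then obtain a s where h: "a \<in> A" "s \<in> A" "s \<noteq> 0" "x = a * inverse s" unfolding fracs_def by blast
  show ?thesis
  proof (cases "a = 0")
    case True
    then show ?thesis using h \<open>x \<in> fracs\<close> by simp
  next
    case False
    then have "inverse x = s * inverse a" using h by (simp add: nonzero_inverse_mult_distrib)
    then show ?thesis using h False by (simp add: fracsI)
  qed
qed

lemma fracs_power: "x \<in> fracs \<Longrightarrow> x ^ n \<in> fracs"
  by (induction n) (auto simp: one_A A_fracs fracs_mult)

lemma fracs_powi: "x \<in> fracs \<Longrightarrow> x powi n \<in> fracs"
  by (auto simp: power_int_def fracs_power fracs_inverse)

end

text \<open>The values of \<psi> are not assumed to lie in A: substituting \<open>phi\<close> for
  the generators introduces denominators.\<close>

locale ore_embedding = ore_subring A for A :: "'k::division_ring set" +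
  fixes \<psi> :: "'k \<Rightarrow> 'k"
  assumes \<psi>_add: "x \<in> A \<Longrightarrow> y \<in> A \<Longrightarrow> \<psi> (x + y) = \<psi> x + \<psi> y"
    and \<psi>_mult: "x \<in> A \<Longrightarrow> y \<in> A \<Longrightarrow> \<psi> (x * y) = \<psi> x * \<psi> y"
    and \<psi>_one: "\<psi> 1 = 1"
    and \<psi>_inj: "x \<in> A \<Longrightarrow> \<psi> x = 0 \<Longrightarrow> x = 0"
begin

definition ext :: "'k \<Rightarrow> 'k" where
  "ext k = (SOME z. \<exists>a\<in>A. \<exists>s\<in>A. s \<noteq> 0 \<and> k = a * inverse s \<and> z = \<psi> a * inverse (\<psi> s))"

text \<open>Independence of the representation: over a common denominator s * u = t * v the
  numerators coincide, and \<psi> can be applied to both equations. Injectivity keeps the images of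
  the denominators nonzero.\<close>

lemma ext_frac:
  assumes "a \<in> A" "s \<in> A" "s \<noteq> 0"
  shows "ext (a * inverse s) = \<psi> a * inverse (\<psi> s)"
  unfolding ext_def
proof (rule some_equality)
  fix z assume "\<exists>a'\<in>A. \<exists>s'\<in>A. s' \<noteq> 0 \<and> a * inverse s = a' * inverse s' \<and> z = \<psi> a' * inverse (\<psi> s')"
  then obtain b t where h: "b \<in> A" "t \<in> A" "t \<noteq> 0" "a * inverse s = b * inverse t"
    "z = \<psi> b * inverse (\<psi> t)" by blast
  obtain u v where uv: "u \<in> A" "v \<in> A" "u \<noteq> 0" "v \<noteq> 0" "s * u = t * v"
    using fracs_common assms h by metis
  have "(a * u) * inverse (s * u) = (b * v) * inverse (s * u)"
    using cancel_right[of u s a] cancel_right[of v t b] h uv assms by simp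
  then have "a * u = b * v" using uv(3) assms by (metis mult_eq_0_iff mult_right_cancel nonzero_imp_inverse_nonzero)
  then have e: "\<psi> a * \<psi> u = \<psi> b * \<psi> v" "\<psi> s * \<psi> u = \<psi> t * \<psi> v"
    using \<psi>_mult assms h uv by metis+
  have nz: "\<psi> s \<noteq> 0" "\<psi> t \<noteq> 0" "\<psi> u \<noteq> 0" "\<psi> v \<noteq> 0" using \<psi>_inj assms h uv by blast+
  show "z = \<psi> a * inverse (\<psi> s)"
    unfolding h using cancel_right[OF nz(3,1), of "\<psi> a"] cancel_right[OF nz(4,2), of "\<psi> b"] e by simp
qed (use assms in blast)

lemma ext_A: "a \<in> A \<Longrightarrow> ext a = \<psi> a"
  using ext_frac[of a 1] by (simp add: one_A \<psi>_one)

lemma ext_add: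
  assumes "x \<in> fracs" "y \<in> fracs"
  shows "ext (x + y) = ext x + ext y"
proof -
  obtain a s b t where h: "a \<in> A" "s \<in> A" "s \<noteq> 0" "x = a * inverse s"
    "b \<in> A" "t \<in> A" "t \<noteq> 0" "y = b * inverse t" using assms unfolding fracs_def by blast
  obtain u v where uv: "u \<in> A" "v \<in> A" "u \<noteq> 0" "v \<noteq> 0" "s * u = t * v"
    using fracs_common h by metis
  have x: "x = (a * u) * inverse (s * u)" and y: "y = (b * v) * inverse (s * u)"
    using cancel_right[of u s a] cancel_right[of v t b] h uv by simp_all
  have w: "s * u \<in> A" "s * u \<noteq> 0" using h uv by (auto simp: mult_A)
  have aw: "a * u \<in> A" "b * v \<in> A" using h uv by (auto simp: mult_A)
  have xy: "x + y = (a * u + b * v) * inverse (s * u)" by (simp only: x y distrib_right)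
  have "ext x = \<psi> (a * u) * inverse (\<psi> (s * u))" "ext y = \<psi> (b * v) * inverse (\<psi> (s * u))"
    by (simp_all only: x y ext_frac[OF aw(1) w] ext_frac[OF aw(2) w])
  moreover have "ext (x + y) = (\<psi> (a * u) + \<psi> (b * v)) * inverse (\<psi> (s * u))"
    by (simp only: xy ext_frac[OF add_A[OF aw] w] \<psi>_add[OF aw])
  ultimately show ?thesis by (simp only: distrib_right)
qed

lemma ext_mult:
  assumes "x \<in> fracs" "y \<in> fracs"
  shows "ext (x * y) = ext x * ext y"
proof -
  obtain a s b t where h: "a \<in> A" "s \<in> A" "s \<noteq> 0" "x = a * inverse s"
    "b \<in> A" "t \<in> A" "t \<noteq> 0" "y = b * inverse t" using assms unfolding fracs_def by blast
  obtain b' s' where m: "b' \<in> A" "s' \<in> A" "s' \<noteq> 0" "s * b' = b * s'" "x * y = (a * b') * inverse (t * s')"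
    using fracs_mult_rep[OF h(1-3) h(5-7)] unfolding h by metis
  have e: "\<psi> s * \<psi> b' = \<psi> b * \<psi> s'" using m h \<psi>_mult by metis
  have nz: "\<psi> s \<noteq> 0" "\<psi> t \<noteq> 0" "\<psi> s' \<noteq> 0" using \<psi>_inj h m by blast+
  have b': "\<psi> b' = inverse (\<psi> s) * (\<psi> b * \<psi> s')" using nz by (simp flip: e) (simp flip: mult.assoc)
  have "ext (x * y) = (\<psi> a * \<psi> b') * inverse (\<psi> t * \<psi> s')"
    unfolding m(5) using h m by (simp add: ext_frac mult_A \<psi>_mult)
  also have "\<dots> = \<psi> a * inverse (\<psi> s) * \<psi> b * (\<psi> s' * inverse (\<psi> s')) * inverse (\<psi> t)"
    unfolding nonzero_inverse_mult_distrib[OF nz(2,3)] b' mult.assoc ..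
  also have "\<dots> = (\<psi> a * inverse (\<psi> s)) * (\<psi> b * inverse (\<psi> t))"
    using nz by (simp add: mult.assoc)
  also have "\<dots> = ext x * ext y" unfolding h using h by (simp add: ext_frac)
  finally show ?thesis .
qed

lemma ext_zero: "ext 0 = 0"
  using ext_add[of 0 0] A_fracs[OF add_A[OF one_A minus_A[OF one_A]]] by simp

lemma ext_one: "ext 1 = 1"
  by (simp add: ext_A one_A \<psi>_one)

lemma ext_eq_0: "x \<in> fracs \<Longrightarrow> ext x = 0 \<longleftrightarrow> x = 0"
  using ext_mult[of x "inverse x"] fracs_inverse[of x] ext_zero ext_one by (cases "x = 0") auto

lemma ext_minus: "x \<in> fracs \<Longrightarrow> ext (- x) = - ext x"
proof -
  assume x: "x \<in> fracs"
  have "- 1 \<in> fracs" using A_fracs[OF minus_A[OF one_A]] .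
  then have "- x \<in> fracs" using fracs_mult[of "- 1" x] x by simp
  then show ?thesis using ext_add[of x "- x"] x ext_zero by (simp add: eq_neg_iff_add_eq_0 add.commute)
qed

lemma ext_inj: "inj_on ext fracs"
proof (rule inj_onI)
  fix x y assume h: "x \<in> fracs" "y \<in> fracs" "ext x = ext y"
  have "- 1 \<in> fracs" using A_fracs[OF minus_A[OF one_A]] .
  then have m: "- y \<in> fracs" using fracs_mult[of "- 1" y] h by simp
  then have "ext (x + - y) = 0" using h by (simp add: ext_add ext_minus del: add_uminus_conv_diff)
  then show "x = y" using ext_eq_0[OF fracs_add[OF h(1) m]] by simp
qed

lemma ext_inverse: "x \<in> fracs \<Longrightarrow> ext (inverse x) = inverse (ext x)"
proof (cases "x = 0")
  case False
  assume x: "x \<in> fracs"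
  have "ext x * ext (inverse x) = 1"
    using False x by (simp add: fracs_inverse ext_one flip: ext_mult)
  then show ?thesis by (rule inverse_unique[symmetric])
qed (simp add: ext_zero)

lemma ext_power: "x \<in> fracs \<Longrightarrow> ext (x ^ n) = ext x ^ n"
  by (induction n) (auto simp: ext_one ext_mult fracs_power)

lemma ext_powi: "x \<in> fracs \<Longrightarrow> ext (x powi n) = ext x powi n"
  by (auto simp: power_int_def ext_power ext_inverse fracs_inverse)

end

section \<open>Laurent polynomial functions on the central units\<close>

definition central_units :: "'k::division_ring set" where
  "central_units = {x. x \<noteq> 0 \<and> (\<forall>k. x * k = k * x)}"

lemma central_units_nonzero: "x \<in> central_units \<Longrightarrow> x \<noteq> 0"
  by (simp add: central_units_def)

lemma central_units_commute: "x \<in> central_units \<Longrightarrow> k * x = x * k"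
  by (simp add: central_units_def)

lemma central_units_one: "1 \<in> central_units"
  by (simp add: central_units_def)

lemma central_unitsI: "x \<noteq> 0 \<Longrightarrow> (\<And>k. x * k = k * x) \<Longrightarrow> x \<in> central_units"
  unfolding central_units_def by blast

lemma central_units_mult:
  fixes x y :: "'k::division_ring"
  assumes "x \<in> central_units" "y \<in> central_units"
  shows "x * y \<in> central_units"
proof (rule central_unitsI)
  show "x * y \<noteq> 0" using assms by (simp add: central_units_nonzero)
  show "x * y * k = k * (x * y)" for k
    using central_units_commute[OF assms(1), of k] central_units_commute[OF assms(2), of k]
    by (metis mult.assoc)
qed

lemma central_units_inverse:
  assumes "x \<in> central_units" shows "inverse x \<in> central_units"
proof (rule central_unitsI)
  show "inverse x \<noteq> 0" using assms by (simp add: central_units_nonzero)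
  show "inverse x * k = k * inverse x" for k
    by (rule mult_commute_imp_mult_inverse_commute) (rule central_units_commute[OF assms, symmetric])
qed

lemma central_units_power: "x \<in> central_units \<Longrightarrow> x ^ n \<in> central_units"
  by (induction n) (auto simp: central_units_one central_units_mult)

lemma central_units_powi: "x \<in> central_units \<Longrightarrow> x powi n \<in> central_units"
  by (auto simp: power_int_def central_units_power central_units_inverse)

lemma powi_mult_distrib_central:
  fixes x y :: "'k::division_ring"
  assumes "x \<in> central_units"
  shows "(x * y) powi n = x powi n * y powi n"
proof -
  have "(x * y) ^ k = x ^ k * y ^ k" if x: "x \<in> central_units" for x y :: 'k and k
  proof (induction k)
    case (Suc k)
    have "y * x ^ k = x ^ k * y" by (rule central_units_commute[OF central_units_power[OF x]])
    then show ?case using Suc by (simp add: mult.assoc) (simp flip: mult.assoc)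
  qed simp
  moreover have "inverse (x * y) = inverse x * inverse y"
  proof (cases "y = 0")
    case False
    then have "inverse (x * y) = inverse y * inverse x"
      using assms by (simp add: central_units_nonzero nonzero_inverse_mult_distrib)
    then show ?thesis using central_units_commute[OF central_units_inverse[OF assms], of "inverse y"] by simp
  qed simp
  ultimately show ?thesis
    using assms central_units_inverse[OF assms] by (simp add: power_int_def)
qed

text \<open>Only the values at central units count. The coefficients are arbitrary elements written
  on the left; since x is central, products of such functions are again of this form.\<close>

definition laurent :: "('k::division_ring \<Rightarrow> 'k) \<Rightarrow> bool" where
  "laurent p \<longleftrightarrow> (\<exists>S a. finite (S :: int set) \<and> (\<forall>x\<in>central_units. p x = (\<Sum>k\<in>S. a k * x powi k)))"

lemma laurent_monom: "laurent (\<lambda>x. a * x powi k)"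
  unfolding laurent_def by (intro exI[of _ "{k}"] exI[of _ "\<lambda>_. a"]) simp

lemma laurent_cong: "laurent p \<Longrightarrow> (\<And>x. x \<in> central_units \<Longrightarrow> p x = p' x) \<Longrightarrow> laurent p'"
  unfolding laurent_def by metis

lemma laurent_const: "laurent (\<lambda>x. a)"
  using laurent_monom[of a 0] by simp

lemma laurent_add:
  assumes "laurent p" "laurent p'"
  shows "laurent (\<lambda>x. p x + p' x)"
proof -
  obtain S a S' a' where h: "finite S" "\<And>x. x \<in> central_units \<Longrightarrow> p x = (\<Sum>k\<in>S. a k * x powi k)"
    "finite S'" "\<And>x. x \<in> central_units \<Longrightarrow> p' x = (\<Sum>k\<in>S'. a' k * x powi k)"
    using assms unfolding laurent_def by metis
  let ?b = "\<lambda>k. (if k \<in> S then a k else 0) + (if k \<in> S' then a' k else 0)"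
  have "p x + p' x = (\<Sum>k\<in>S \<union> S'. ?b k * x powi k)" if x: "x \<in> central_units" for x
  proof -
    have "(\<Sum>k\<in>S. a k * x powi k) = (\<Sum>k\<in>S \<union> S'. (if k \<in> S then a k else 0) * x powi k)"
      using h by (intro sum.mono_neutral_cong_left) auto
    moreover have "(\<Sum>k\<in>S'. a' k * x powi k) = (\<Sum>k\<in>S \<union> S'. (if k \<in> S' then a' k else 0) * x powi k)"
      using h by (intro sum.mono_neutral_cong_left) auto
    ultimately show ?thesis by (simp only: h(2,4)[OF x] distrib_right sum.distrib)
  qed
  then show ?thesis unfolding laurent_def using h by (intro exI[of _ "S \<union> S'"] exI[of _ ?b]) auto
qed

lemma laurent_sum: "(\<And>k. k \<in> S \<Longrightarrow> laurent (p k)) \<Longrightarrow> laurent (\<lambda>x. \<Sum>k\<in>S. p k x)"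
  by (induction S rule: infinite_finite_induct) (auto intro: laurent_const laurent_add)

lemma laurent_mult:
  assumes "laurent p" "laurent p'"
  shows "laurent (\<lambda>x. p x * p' x)"
proof -
  obtain S a S' a' where h: "finite S" "\<And>x. x \<in> central_units \<Longrightarrow> p x = (\<Sum>k\<in>S. a k * x powi k)"
    "finite S'" "\<And>x. x \<in> central_units \<Longrightarrow> p' x = (\<Sum>k\<in>S'. a' k * x powi k)"
    using assms unfolding laurent_def by metis
  have "laurent (\<lambda>x. \<Sum>k\<in>S. \<Sum>l\<in>S'. (a k * a' l) * x powi (k + l))"
    by (intro laurent_sum laurent_monom)
  then show ?thesis
  proof (rule laurent_cong)
    fix x :: 'a assume x: "x \<in> central_units"
    have "(a k * a' l) * x powi (k + l) = (a k * x powi k) * (a' l * x powi l)" for k l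
    proof -
      have "a' l * x powi k = x powi k * a' l" by (rule central_units_commute[OF central_units_powi[OF x]])
      then show ?thesis
        using central_units_nonzero[OF x] by (simp add: power_int_add mult.assoc) (simp flip: mult.assoc)
    qed
    then show "(\<Sum>k\<in>S. \<Sum>l\<in>S'. (a k * a' l) * x powi (k + l)) = p x * p' x"
      by (simp add: h(2,4)[OF x] sum_product)
  qed
qed

text \<open>Passing from \<open>p(x)\<close> to \<open>p(q x) - q\<^sup>l p(x)\<close> removes the exponent \<open>l\<close>.\<close>

lemma laurent_coeffs_zero:
  fixes q x0 :: "'k::division_ring"
  assumes "finite S" "q \<in> central_units" "x0 \<in> central_units"
    and q: "\<And>k l :: int. q powi k = q powi l \<Longrightarrow> k = l"
    and "\<And>n::nat. (\<Sum>k\<in>S. a k * (q ^ n * x0) powi k) = 0"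
  shows "\<forall>k\<in>S. a k = 0"
  using assms(1,5)
proof (induction S arbitrary: a rule: finite_induct)
  case (insert l S)
  have step: "(q ^ Suc n * x0) powi k = q powi k * (q ^ n * x0) powi k" for n k
    using powi_mult_distrib_central[OF assms(2), of "q ^ n * x0" k] by (simp add: mult.assoc)
  have com: "y * q powi k = q powi k * y" for y k
    by (rule central_units_commute[OF central_units_powi[OF assms(2)]])
  have "(\<Sum>k\<in>S. ((q powi k - q powi l) * a k) * (q ^ n * x0) powi k) = 0" for n
  proof -
    let ?y = "q ^ n * x0"
    have 1: "(\<Sum>k\<in>insert l S. q powi k * (a k * ?y powi k)) = 0"
    proof -
      have "a k * (q ^ Suc n * x0) powi k = q powi k * (a k * ?y powi k)" for k
        unfolding step mult.assoc[symmetric] com ..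
      then show ?thesis using insert.prems[of "Suc n"] by simp
    qed
    have 2: "(\<Sum>k\<in>insert l S. q powi l * (a k * ?y powi k)) = 0"
      using insert.prems[of n] by (simp only: sum_distrib_left[symmetric]) simp
    have "(\<Sum>k\<in>insert l S. (q powi k - q powi l) * (a k * ?y powi k)) = 0"
      using 1 2 by (simp add: left_diff_distrib sum_subtractf del: sum.insert)
    then show ?thesis using insert.hyps by (simp add: mult.assoc)
  qed
  then have "\<forall>k\<in>S. (q powi k - q powi l) * a k = 0" by (rule insert.IH)
  \<comment> \<open>Here the injectivity of the powers of q enters: for k in S, which differs from
    l, the factor in front of a k is nonzero.\<close>
  then have S: "\<forall>k\<in>S. a k = 0" using q insert.hyps by force
  then have "a l * x0 powi l = 0" using insert.prems[of 0] insert.hyps by simp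
  then have "a l = 0" using central_units_nonzero[OF assms(3)] by simp
  then show ?case using S by simp
qed simp

lemma laurent_vanish:
  fixes q x0 :: "'k::division_ring"
  assumes "laurent p" "q \<in> central_units" "x0 \<in> central_units"
    and "\<And>k l :: int. q powi k = q powi l \<Longrightarrow> k = l"
    and "\<And>n::nat. p (q ^ n * x0) = 0" "x \<in> central_units"
  shows "p x = 0"
proof -
  obtain S a where h: "finite S" "\<And>x. x \<in> central_units \<Longrightarrow> p x = (\<Sum>k\<in>S. a k * x powi k)"
    using assms(1) unfolding laurent_def by metis
  have "(\<Sum>k\<in>S. a k * (q ^ n * x0) powi k) = 0" for n
    using h(2)[of "q ^ n * x0"] assms by (simp add: central_units_mult central_units_power)
  from laurent_coeffs_zero[OF h(1) assms(2-4) this] have "\<forall>k\<in>S. a k = 0" by blast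
  then show ?thesis using h(2)[OF assms(6)] by simp
qed

section \<open>Commutation relations in the skew field of fractions\<close>

lemma qroot_power_neq_one: "0 < n \<Longrightarrow> qroot ^ n \<noteq> 1"
proof
  assume n: "0 < n" and "qroot ^ n = 1"
  moreover have "qroot ^ n = Fract ([:0, 1:] ^ n) 1"
    by (induction n) (auto simp: qroot_def One_fract_def)
  ultimately have "[:0, 1 :: rat:] ^ n = 1" by (simp add: One_fract_def eq_fract)
  then have "degree ([:0, 1 :: rat:] ^ n) = 0" by simp
  then show False using n by (simp add: degree_power_eq)
qed

lemma qroot_powi_inj: "qroot powi m = qroot powi n \<Longrightarrow> m = n"
proof (induction m n rule: linorder_wlog)
  case (le m n)
  then have "qroot powi (n - m) = 1" by (simp add: power_int_diff)
  then have "qroot ^ nat (n - m) = 1" using le by (simp add: power_int_def)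
  then show ?case using qroot_power_neq_one[of "nat (n - m)"] le by fastforce
qed auto

text \<open>The bicommutant of u0. It is commutative, contains u0 and the centre, and is closed
  under sums, products and inverses. It thus contains all rational expressions in u0 with central
  coefficients without any description of them.\<close>

definition double_centralizer :: "'k::division_ring \<Rightarrow> 'k set" where
  "double_centralizer u0 = {u. \<forall>v. v * u0 = u0 * v \<longrightarrow> u * v = v * u}"

lemma double_centralizerI: "(\<And>v. v * u0 = u0 * v \<Longrightarrow> u * v = v * u) \<Longrightarrow> u \<in> double_centralizer u0"
  unfolding double_centralizer_def by blast

lemma double_centralizerD: "u \<in> double_centralizer u0 \<Longrightarrow> v * u0 = u0 * v \<Longrightarrow> u * v = v * u"
  unfolding double_centralizer_def by blast

lemma double_centralizer_commute:
  "u \<in> double_centralizer u0 \<Longrightarrow> v \<in> double_centralizer u0 \<Longrightarrow> u * v = v * u"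
  using double_centralizerD[of v u0 u0] double_centralizerD[of u u0 v] by simp

lemma double_centralizer_self: "u0 \<in> double_centralizer u0"
  by (rule double_centralizerI) simp

lemma double_centralizer_central: "(\<And>k. c * k = k * c) \<Longrightarrow> c \<in> double_centralizer u0"
  by (rule double_centralizerI) simp

lemma double_centralizer_one: "1 \<in> double_centralizer u0"
  by (rule double_centralizerI) simp

lemma double_centralizer_mult:
  assumes "u \<in> double_centralizer u0" "v \<in> double_centralizer u0"
  shows "u * v \<in> double_centralizer u0"
proof (rule double_centralizerI)
  fix w assume "w * u0 = u0 * w"
  note d = double_centralizerD[OF assms(1) this] double_centralizerD[OF assms(2) this]
  have "u * v * w = u * w * v" unfolding mult.assoc d(2) ..
  then show "u * v * w = w * (u * v)" unfolding d(1) mult.assoc .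
qed

lemma double_centralizer_add:
  assumes "u \<in> double_centralizer u0" "v \<in> double_centralizer u0"
  shows "u + v \<in> double_centralizer u0"
  by (rule double_centralizerI)
     (simp add: distrib_left distrib_right double_centralizerD[OF assms(1)] double_centralizerD[OF assms(2)])

lemma double_centralizer_inverse:
  assumes "u \<in> double_centralizer u0" shows "inverse u \<in> double_centralizer u0"
  by (rule double_centralizerI, rule mult_commute_imp_mult_inverse_commute)
     (rule double_centralizerD[OF assms])

lemma inverse_mult_cancel: "u \<noteq> 0 \<Longrightarrow> inverse u * (u * k) = (k :: 'k::division_ring)"
  by (simp flip: mult.assoc)

definition cj :: "'k::division_ring \<Rightarrow> 'k \<Rightarrow> 'k" where
  "cj u k = u * k * inverse u"

lemma cj_eqI: "u \<noteq> 0 \<Longrightarrow> u * k = l * u \<Longrightarrow> cj u k = l"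
  by (simp add: cj_def mult.assoc)

lemma cj_mult: "u \<noteq> 0 \<Longrightarrow> cj u (k * l) = cj u k * cj u l"
proof -
  assume "u \<noteq> 0"
  then have "u * (k * l) * inverse u = u * k * (inverse u * u) * l * inverse u" by (simp add: mult.assoc)
  then show ?thesis unfolding cj_def by (simp only: mult.assoc)
qed

lemma cj_add: "cj u (k + l) = cj u k + cj u l"
  by (simp add: cj_def distrib_left distrib_right)

lemma cj_central: "u \<noteq> 0 \<Longrightarrow> (\<And>k. c * k = k * c) \<Longrightarrow> cj u c = c"
  by (rule cj_eqI) auto

lemma cj_one: "u \<noteq> 0 \<Longrightarrow> cj u 1 = 1"
  by (simp add: cj_def)

lemma cj_inverse: "u \<noteq> 0 \<Longrightarrow> cj u (inverse k) = inverse (cj u k)"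
proof (cases "k = 0")
  case False
  assume u: "u \<noteq> 0"
  have "cj u k * cj u (inverse k) = 1" using u False by (simp add: cj_one flip: cj_mult)
  then show ?thesis by (rule inverse_unique[symmetric])
qed (simp add: cj_def)

section \<open>Quasi-commutation of f_i1, f_i2 and g_j among the fractions\<close>

locale qfractions =
  fixes D :: "('i::finite, 'x::ab_group_add, 'y::ab_group_add) quantum_datum"
    and \<iota> :: "('i, 'y) aqt_elem \<Rightarrow> 'k::division_ring"
  assumes D: "quantum_datum D"
    and fractions: "skew_field_of_fractions (Aqt D) \<iota>"
begin

lemma qdatum: "qdatum D"
  using D by (rule qdatum.intro)

lemmas Aqt_facts = qdatum.Aqt_q_zero[OF qdatum] qdatum.Aqt_q_central[OF qdatum]
  qdatum.Aqt_f_nonzero[OF qdatum]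

lemmas f1_f1 = qdatum.f1_f1_Aqt[OF qdatum]
lemmas f2_f2 = qdatum.f2_f2_Aqt[OF qdatum]
lemmas f2_f1 = qdatum.f2_f1_Aqt[OF qdatum]

sublocale A: falgebra "Aqt D"
  by (rule qdatum.Aqt_falgebra[OF qdatum])

declare qdatum.Aqt_closed[OF qdatum, simp]

lemma iota_mult: "x \<in> carrier (Aqt D) \<Longrightarrow> y \<in> carrier (Aqt D) \<Longrightarrow> \<iota> (x \<otimes>\<^bsub>Aqt D\<^esub> y) = \<iota> x * \<iota> y"
  and iota_add: "x \<in> carrier (Aqt D) \<Longrightarrow> y \<in> carrier (Aqt D) \<Longrightarrow> \<iota> (x \<oplus>\<^bsub>Aqt D\<^esub> y) = \<iota> x + \<iota> y"
  and iota_one: "\<iota> \<one>\<^bsub>Aqt D\<^esub> = 1"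
  using fractions unfolding skew_field_of_fractions_def
  by (auto simp: ring_hom_def ring_of_type_algebra_def)

lemma iota_zero: "\<iota> \<zero>\<^bsub>Aqt D\<^esub> = 0"
  using iota_add[of "\<zero>\<^bsub>Aqt D\<^esub>" "\<zero>\<^bsub>Aqt D\<^esub>"] by simp

lemma iota_nonzero: "x \<in> carrier (Aqt D) \<Longrightarrow> x \<noteq> \<zero>\<^bsub>Aqt D\<^esub> \<Longrightarrow> \<iota> x \<noteq> 0"
  using fractions iota_zero unfolding skew_field_of_fractions_def
  by (metis A.zero_closed inj_onD)

text \<open>Every element is a right fraction, and z commutes with its numerator and with the
  inverse of its denominator.\<close>

lemma iota_central:
  assumes z: "z \<in> carrier (Aqt D)" "\<And>x. x \<in> carrier (Aqt D) \<Longrightarrow> z \<otimes>\<^bsub>Aqt D\<^esub> x = x \<otimes>\<^bsub>Aqt D\<^esub> z"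
  shows "\<iota> z * k = k * \<iota> z"
proof -
  obtain a s where h: "a \<in> carrier (Aqt D)" "s \<in> carrier (Aqt D)" "k = \<iota> a * inverse (\<iota> s)"
    using fractions unfolding skew_field_of_fractions_def by blast
  have c: "\<iota> z * \<iota> x = \<iota> x * \<iota> z" if "x \<in> carrier (Aqt D)" for x
    using z that by (metis iota_mult)
  have "inverse (\<iota> s) * \<iota> z = \<iota> z * inverse (\<iota> s)"
    by (rule mult_commute_imp_mult_inverse_commute) (rule c[OF h(2), symmetric])
  then have "\<iota> a * inverse (\<iota> s) * \<iota> z = \<iota> a * \<iota> z * inverse (\<iota> s)" by (simp add: mult.assoc)
  then show ?thesis unfolding h(3) by (simp add: c[OF h(1)] flip: mult.assoc)
qed

abbreviation sc :: "qfield \<Rightarrow> 'k" where "sc \<equiv> scal D \<iota>"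
abbreviation fa :: "'i \<Rightarrow> 'k" where "fa \<equiv> f1 D \<iota>"
abbreviation fb :: "'i \<Rightarrow> 'k" where "fb \<equiv> f2 D \<iota>"
abbreviation gg :: "'i \<Rightarrow> 'k" where "gg \<equiv> g D \<iota>"
abbreviation qq :: "'y \<Rightarrow> 'k" where "qq \<equiv> qpow D \<iota>"

lemma iota_smult: "x \<in> carrier (Aqt D) \<Longrightarrow> \<iota> (c \<odot>\<^bsub>Aqt D\<^esub> x) = sc c * \<iota> x"
  unfolding scal_def by (subst iota_mult[symmetric]) (simp_all add: A.scalar_central)

sublocale S: central_scalars sc
proof
  fix c d k
  show "sc (c + d) = sc c + sc d"
    unfolding scal_def by (simp add: A.smult_l_distr iota_add)
  show "sc (c * d) = sc c * sc d"
    by (subst scal_def) (simp add: A.smult_assoc iota_smult iota_one)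
  show "sc 1 = 1" by (simp add: scal_def iota_one)
  show "sc c * k = k * sc c"
    unfolding scal_def by (rule iota_central) (simp_all add: A.scalar_central)
qed

lemma qq_zero: "qq 0 = 1"
  by (simp add: qpow_def Aqt_facts iota_one)

lemma qq_add: "qq (y + z) = qq y * qq z"
  unfolding qpow_def by (simp add: iota_mult flip: qdatum.Aqt_q_add[OF qdatum])

lemma qq_units: "qq y \<in> central_units"
proof (rule central_unitsI)
  have "qq y * qq (- y) = 1" by (simp add: qq_zero flip: qq_add)
  then show "qq y \<noteq> 0" by auto
  show "qq y * k = k * qq y" for k
    unfolding qpow_def by (rule iota_central) (simp_all add: Aqt_facts)
qed

lemma sc_units: "c \<noteq> 0 \<Longrightarrow> sc c \<in> central_units"
  by (rule central_unitsI) (simp_all add: S.sc_central)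

lemma fa_nonzero: "fa i \<noteq> 0" and fb_nonzero: "fb i \<noteq> 0"
  unfolding f1_def f2_def by (simp_all add: iota_nonzero Aqt_facts)

lemma gg_nonzero: "gg i \<noteq> 0"
  by (simp add: g_def fa_nonzero fb_nonzero)

lemma lcd_pos: "lcd D > 0"
proof -
  have "0 \<notin> range (\<lambda>i. snd (quotient_of (symm D i)))"
  proof
    assume "0 \<in> range (\<lambda>i. snd (quotient_of (symm D i)))"
    then obtain i where "snd (quotient_of (symm D i)) = 0" by force
    then show False using quotient_of_denom_pos'[of "symm D i"] by simp
  qed
  then have "lcd D \<noteq> 0" unfolding lcd_def by (subst Lcm_0_iff) auto
  moreover have "lcd D \<ge> 0" unfolding lcd_def by simp
  ultimately show ?thesis by simp
qed

text \<open>The floor in \<open>wt\<close> is exact because the denominator of d_i divides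
  d.\<close>

lemma wt_rat: "of_int (wt D i) = of_int (lcd D) * symm D i"
proof -
  obtain p s where ps: "quotient_of (symm D i) = (p, s)" by (cases "quotient_of (symm D i)")
  then have "s dvd lcd D" unfolding lcd_def by (intro dvd_Lcm) (metis rangeI snd_conv)
  then obtain t where t: "lcd D = s * t" by blast
  have "s > 0" using quotient_of_denom_pos[OF ps] .
  then have "of_int (lcd D) * symm D i = of_int (t * p)"
    unfolding t quotient_of_div[OF ps] by simp
  then show ?thesis unfolding wt_def by (simp only: floor_of_int)
qed

lemma wt_pos: "wt D i > 0"
proof -
  have "symm D i > 0" using D unfolding quantum_datum_def symmetrized_by_def by blast
  then have "(of_int (wt D i) :: rat) > 0" unfolding wt_rat using lcd_pos by simp
  then show ?thesis by simp
qed

lemma wt_sym: "wt D i * cartan D i j = wt D j * cartan D j i"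
proof -
  have "symm D i * of_int (cartan D i j) = symm D j * of_int (cartan D j i)"
    using D unfolding quantum_datum_def symmetrized_by_def by blast
  then have "(of_int (wt D i * cartan D i j) :: rat) = of_int (wt D j * cartan D j i)"
    by (simp add: wt_rat)
  then show ?thesis by (simp only: of_int_eq_iff)
qed

lemma qi_sym: "qi D i powi cartan D i j = qi D j powi cartan D j i"
  unfolding qi_def by (simp flip: power_int_mult add: wt_sym)

lemma qi_powi_inj: "qi D i powi k = qi D i powi l \<Longrightarrow> k = l"
  unfolding qi_def using qroot_powi_inj[of "wt D i * k" "wt D i * l"] wt_pos[of i]
  by (simp add: power_int_mult)

lemma qc_fa_fa: "S.qc (qi D i powi (- orient D i j * cartan D i j)) (fa i) (fa j)"
  by (rule S.qcI) (simp_all add: f1_def iota_smult flip: iota_mult, simp add: f1_f1[of i j] iota_smult)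

lemma qc_fb_fb: "S.qc (qi D i powi (- orient D i j * cartan D i j)) (fb i) (fb j)"
  by (rule S.qcI) (simp_all add: f2_def iota_smult flip: iota_mult, simp add: f2_f2[of i j] iota_smult)

lemma qc_fb_fa: "S.qc (qi D i powi cartan D i j) (fb i) (fa j)"
  by (rule S.qcI) (simp_all add: f1_def f2_def iota_smult flip: iota_mult, simp add: f2_f1[of i j] iota_smult)

lemma qc_fa_fb: "S.qc (qi D i powi (- cartan D i j)) (fa i) (fb j)"
  using S.qc_sym[OF qc_fb_fa[of j i]] by (simp add: power_int_minus qi_sym)

text \<open>Moving f_i1 past f_j1^-1 contributes the exponent \<epsilon>_ij a_ij, and moving it past
  f_j2 contributes -a_ij.\<close>

lemma qc_fa_gg: "S.qc (qi D i powi ((orient D i j - 1) * cartan D i j)) (fa i) (gg j)"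
proof -
  have "S.qc (inverse (qi D i powi (- orient D i j * cartan D i j)) * qi D i powi (- cartan D i j)) (fa i) (gg j)"
    unfolding g_def by (intro S.qc_mult_right S.qc_inverse_right qc_fa_fa qc_fa_fb)
  moreover have "inverse (qi D i powi (- orient D i j * cartan D i j)) * qi D i powi (- cartan D i j)
      = qi D i powi ((orient D i j - 1) * cartan D i j)"
    by (simp add: power_int_minus[symmetric] power_int_add[symmetric] algebra_simps)
  ultimately show ?thesis by simp
qed

lemma qc_fb_gg: "S.qc (qi D i powi (- (orient D i j + 1) * cartan D i j)) (fb i) (gg j)"
proof -
  have "S.qc (inverse (qi D i powi cartan D i j) * qi D i powi (- orient D i j * cartan D i j)) (fb i) (gg j)"
    unfolding g_def by (intro S.qc_mult_right S.qc_inverse_right qc_fb_fa qc_fb_fb)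
  moreover have "inverse (qi D i powi cartan D i j) * qi D i powi (- orient D i j * cartan D i j)
      = qi D i powi (- (orient D i j + 1) * cartan D i j)"
    by (simp add: power_int_minus[symmetric] power_int_add[symmetric] algebra_simps)
  ultimately show ?thesis by simp
qed

text \<open>The parts of the exponents that do not contain \<epsilon>_ij cancel between f_i1^-1 and
  f_i2. In particular g_i and g_j commute when \<epsilon>_ij = 0.\<close>

lemma qc_gg_gg: "S.qc (qi D i powi (- 2 * orient D i j * cartan D i j)) (gg i) (gg j)"
proof -
  have "S.qc (inverse (qi D i powi ((orient D i j - 1) * cartan D i j)) *
      qi D i powi (- (orient D i j + 1) * cartan D i j)) (gg i) (gg j)"
    using S.qc_mult_left[OF S.qc_inverse_left[OF qc_fa_gg] qc_fb_gg] by (simp add: g_def)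
  moreover have "inverse (qi D i powi ((orient D i j - 1) * cartan D i j)) *
      qi D i powi (- (orient D i j + 1) * cartan D i j) = qi D i powi (- 2 * orient D i j * cartan D i j)"
    by (simp add: power_int_minus[symmetric] power_int_add[symmetric] algebra_simps)
  ultimately show ?thesis by simp
qed

lemma cartan_diag: "cartan D i i = 2"
  using D unfolding quantum_datum_def generalized_cartan_matrix_def by blast

lemma orientation: "orientation (cartan D) (orient D)"
  using D unfolding quantum_datum_def by blast

lemma orient_diag: "orient D i i = 0"
  using orientation unfolding orientation_def by simp

lemma orient_cases: "orient D i j = 1 \<or> orient D i j = - 1 \<or> orient D i j = 0"
  using orientation unfolding orientation_def by (cases "i \<noteq> j \<and> cartan D i j \<noteq> 0") metis+

lemma orient_zero: "i \<noteq> j \<Longrightarrow> orient D i j = 0 \<Longrightarrow> cartan D i j = 0"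
  using orientation unfolding orientation_def by (metis zero_neq_neg_one zero_neq_one)

lemma orient_pos: "orient D i j \<noteq> 0 \<Longrightarrow> cartan D i j \<le> 0"
  using D orient_diag[of i] unfolding quantum_datum_def generalized_cartan_matrix_def by metis

section \<open>Conjugation by \<open>f\<^sub>i\<^sub>1 + f\<^sub>i\<^sub>2\<close>\<close>

definition ff :: "'i \<Rightarrow> 'k" where "ff i = fa i + fb i"

text \<open>With c central, this is the shape of every numerator and denominator in
  \<open>phi\<close> and of the factor 1 + g_i in F.\<close>

definition ee :: "'i \<Rightarrow> 'k \<Rightarrow> 'k" where "ee i c = 1 + c * gg i"

abbreviation qs :: "'i \<Rightarrow> int \<Rightarrow> 'k" where "qs i k \<equiv> sc (qi D i powi k)"

lemma qs_units: "qs i k \<in> central_units"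
  by (rule sc_units) simp

lemma qs_add: "qs i (k + l) = qs i k * qs i l"
  by (simp add: power_int_add S.sc_mult)

lemma qs_inj: "qs i k = qs i l \<Longrightarrow> k = l"
  using qi_powi_inj by (simp add: S.sc_eq_iff)

lemma fa_gg: "fa i * gg j = qs i ((orient D i j - 1) * cartan D i j) * (gg j * fa i)"
  using S.qcD[OF qc_fa_gg] .

lemma gg_gg: "gg i * gg j = qs i (- 2 * orient D i j * cartan D i j) * (gg j * gg i)"
  using S.qcD[OF qc_gg_gg] .

lemma fa_ee:
  assumes "c \<in> central_units"
  shows "fa i * ee i c = ee i (qs i (- 2) * c) * fa i"
proof -
  have "fa i * (c * gg i) = c * (fa i * gg i)"
    using central_units_commute[OF assms, of "fa i"] by (simp flip: mult.assoc)
  also have "\<dots> = c * qs i (- 2) * (gg i * fa i)"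
    using fa_gg[of i i] by (simp add: orient_diag cartan_diag mult.assoc)
  also have "\<dots> = qs i (- 2) * c * gg i * fa i" by (simp add: S.sc_central mult.assoc)
  finally show ?thesis by (simp add: ee_def distrib_left distrib_right)
qed

text \<open>If c g_i = -1, then conjugation by f_i1 would also give q_i^-2 c g_i = -1, hence q_i^-2
  = 1.\<close>

lemma ee_nonzero:
  assumes "c \<in> central_units"
  shows "ee i c \<noteq> 0"
proof
  assume z: "ee i c = 0"
  have "ee i (qs i (- 2) * c) * fa i = 0" using fa_ee[OF assms, of i] z by simp
  then have "1 + qs i (- 2) * (c * gg i) = 0" using fa_nonzero[of i] by (simp add: ee_def mult.assoc)
  moreover have "c * gg i = - 1" using z by (simp add: ee_def add_eq_0_iff)
  ultimately have "qs i (- 2) = qs i 0" by simp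
  then show False using qs_inj by fastforce
qed

lemma ee_dc: "c \<in> central_units \<Longrightarrow> ee i c \<in> double_centralizer (gg i)"
  unfolding ee_def
  by (intro double_centralizer_add double_centralizer_one double_centralizer_mult
      double_centralizer_self double_centralizer_central) (rule central_units_commute[symmetric])

lemma gg_ee:
  assumes "c \<in> central_units"
  shows "ee i c * gg j = gg j * ee i (qs i (- 2 * orient D i j * cartan D i j) * c)"
proof -
  let ?q = "qs i (- 2 * orient D i j * cartan D i j)"
  have "c * gg i * gg j = (c * ?q) * gg j * gg i" by (simp only: mult.assoc gg_gg[of i j])
  also have "\<dots> = gg j * (c * ?q) * gg i"
    using central_units_commute[OF central_units_mult[OF assms qs_units], of "gg j"] by simp
  also have "\<dots> = gg j * (?q * c * gg i)" by (simp add: S.sc_central mult.assoc)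
  finally show ?thesis by (simp add: ee_def distrib_left distrib_right)
qed

lemma ff_eq: "ff i = fa i * ee i 1"
  by (simp add: ff_def ee_def distrib_left g_def fa_nonzero flip: mult.assoc)

lemma ff_eq': "ff i = ee i (qs i (- 2)) * fa i"
  unfolding ff_eq using fa_ee[OF central_units_one, of i] by simp

lemma ff_nonzero: "ff i \<noteq> 0"
  by (simp add: ff_eq fa_nonzero ee_nonzero central_units_one)

text \<open>In F = f_i1 (1 + g_i) the second factor commutes with 1 + c g_i, so only f_i1 has an
  effect.\<close>

lemma cj_ee:
  assumes "c \<in> central_units"
  shows "cj (ff i) (ee i c) = ee i (qs i (- 2) * c)"
proof (rule cj_eqI[OF ff_nonzero])
  have "ff i * ee i c = fa i * (ee i c * ee i 1)"
    unfolding ff_eq mult.assoc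
    using double_centralizer_commute[OF ee_dc[OF assms] ee_dc[OF central_units_one], of i] by simp
  also have "\<dots> = ee i (qs i (- 2) * c) * ff i"
    unfolding ff_eq by (simp add: fa_ee[OF assms] flip: mult.assoc)
  finally show "ff i * ee i c = ee i (qs i (- 2) * c) * ff i" .
qed

text \<open>The product in \<open>phi\<close> for \<epsilon>_ij = 1. For \<epsilon>_ij = -1 its
  inverse occurs, by \<open>rr_inverse\<close>.\<close>

definition rr :: "'i \<Rightarrow> nat \<Rightarrow> 'k \<Rightarrow> 'k" where
  "rr i m x = prod_list (map (\<lambda>\<nu>. ee i (qs i (2 * int \<nu>)) *
     inverse (ee i (qs i (2 * int \<nu>) * x powi (- 2)))) [0..<m])"

lemma rr_0 [simp]: "rr i 0 x = 1"
  by (simp add: rr_def)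

lemma rr_Suc: "rr i (Suc m) x =
    rr i m x * (ee i (qs i (2 * int m)) * inverse (ee i (qs i (2 * int m) * x powi (- 2))))"
  by (simp add: rr_def)

lemma den_units: "x \<in> central_units \<Longrightarrow> qs i k * x powi l \<in> central_units"
  by (intro central_units_mult qs_units central_units_powi)

lemma rr_dc: "x \<in> central_units \<Longrightarrow> rr i m x \<in> double_centralizer (gg i)"
  by (induction m)
     (auto simp: rr_Suc double_centralizer_one intro!: double_centralizer_mult double_centralizer_inverse
       ee_dc den_units qs_units)

lemma rr_nonzero: "x \<in> central_units \<Longrightarrow> rr i m x \<noteq> 0"
  by (induction m) (auto simp: rr_Suc ee_nonzero den_units qs_units)

lemma rr_inverse:
  assumes x: "x \<in> central_units"
  shows "prod_list (map (\<lambda>\<nu>. ee i (qs i (2 * int \<nu>) * x powi (- 2)) *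
     inverse (ee i (qs i (2 * int \<nu>)))) [0..<m]) = inverse (rr i m x)"
proof (induction m)
  case (Suc m)
  let ?n = "ee i (qs i (2 * int m))" and ?d = "ee i (qs i (2 * int m) * x powi (- 2))"
  have nz: "?n \<noteq> 0" "?d \<noteq> 0" "rr i m x \<noteq> 0"
    by (auto simp: ee_nonzero qs_units den_units x rr_nonzero)
  have dc: "?n \<in> double_centralizer (gg i)" "?d \<in> double_centralizer (gg i)"
    "rr i m x \<in> double_centralizer (gg i)"
    by (auto simp: ee_dc qs_units den_units x rr_dc)
  have "inverse (rr i (Suc m) x) = ?d * inverse ?n * inverse (rr i m x)"
    using nz by (simp add: rr_Suc nonzero_inverse_mult_distrib)
  also have "\<dots> = inverse (rr i m x) * (?d * inverse ?n)"
    by (rule double_centralizer_commute[of _ "gg i"])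
       (intro double_centralizer_mult double_centralizer_inverse dc)+
  finally show ?case using Suc by simp
qed simp

lemma phi_num: "1 + sc (qi D i ^ (2 * \<nu>)) * gg i = ee i (qs i (2 * int \<nu>))"
  using power_int_of_nat[of "qi D i" "2 * \<nu>"] by (simp add: ee_def)

lemma phi_den: "1 + sc (qi D i ^ (2 * \<nu>)) * x powi (- 2) * gg i = ee i (qs i (2 * int \<nu>) * x powi (- 2))"
  using power_int_of_nat[of "qi D i" "2 * \<nu>"] by (simp add: ee_def)

lemma phi_pos:
  assumes "orient D i j = 1"
  shows "phi D \<iota> i j x = gg j * rr i (nat (- cartan D i j)) x"
  unfolding phi_def Let_def phi_num phi_den using assms by (simp add: rr_def)

lemma phi_neg:
  assumes "orient D i j = - 1" "x \<in> central_units"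
  shows "phi D \<iota> i j x = x powi (- 2 * cartan D i j) * inverse (rr i (nat (- cartan D i j)) x) * gg j"
  unfolding phi_def Let_def phi_num phi_den rr_inverse[OF assms(2)] using assms by simp

lemma phi_diag: "phi D \<iota> i i x = x powi (- 2) * gg i"
  unfolding phi_def Let_def by (simp add: orient_diag)

lemma phi_other: "i \<noteq> j \<Longrightarrow> orient D i j = 0 \<Longrightarrow> phi D \<iota> i j x = gg j"
  unfolding phi_def Let_def by simp

text \<open>The product telescopes under \<open>g\<^sub>i \<mapsto> q\<^sub>i\<^sup>-\<^sup>2 g\<^sub>i\<close>.\<close>

lemma cj_rr:
  assumes x: "x \<in> central_units"
  shows "ee i (qs i (2 * int m - 2)) * inverse (ee i (qs i (- 2))) * cj (ff i) (rr i m x)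
      = rr i m (qs i 1 * x)"
\<comment> \<open>Conjugation turns the numerators with exponents 0, 2, ..., 2m - 2 into those with
  -2, 0, ..., 2m - 4. The prefactor restores the missing top factor and cancels the extra bottom
  one.\<close>
proof (induction m)
  case 0
  show ?case by (simp add: cj_one ff_nonzero ee_nonzero qs_units del: power_int_minus_left)
next
  case (Suc m)
  let ?a = "ee i (qs i (2 * int m))" and ?b = "inverse (ee i (qs i (- 2)))"
    and ?d = "ee i (qs i (2 * int m - 2))" and ?h = "inverse (ee i (qs i (2 * int m - 2) * x powi (- 2)))"
    and ?R = "cj (ff i) (rr i m x)"
  have s: "qs i (- 2) * qs i (2 * int m) = qs i (2 * int m - 2)"
    using qs_add[of i "- 2" "2 * int m"] by simp
  have cjs: "cj (ff i) (rr i (Suc m) x) = ?R * (?d * ?h)"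
    using s by (simp add: rr_Suc cj_mult cj_inverse ff_nonzero cj_ee qs_units den_units x
        flip: mult.assoc)
  \<comment> \<open>The denominators need no correction: replacing x by q_i x lowers their exponents
    by 2, exactly as conjugation does.\<close>
  have xq: "qs i (2 * int m) * (qs i 1 * x) powi (- 2) = qs i (2 * int m - 2) * x powi (- 2)"
  proof -
    have "(qs i 1 * x) powi (- 2) = qs i 1 powi (- 2) * x powi (- 2)"
      by (rule powi_mult_distrib_central[OF qs_units])
    also have "qs i 1 powi (- 2) = qs i (- 2)" by (simp flip: S.sc_powi power_int_mult)
    finally have e: "(qs i 1 * x) powi (- 2) = qs i (- 2) * x powi (- 2)" .
    have "qs i (2 * int m) * qs i (- 2) = qs i (2 * int m - 2)"
      using qs_add[of i "2 * int m" "- 2"] by simp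
    then show ?thesis unfolding e mult.assoc[symmetric] by simp
  qed
  have dc: "?a \<in> double_centralizer (gg i)" "?d \<in> double_centralizer (gg i)"
    "?b \<in> double_centralizer (gg i)"
    by (auto intro!: ee_dc double_centralizer_inverse qs_units)
  \<comment> \<open>Conjugation by F is not known to preserve the double centralizer of g_i. The
    membership of ?R is recovered from the induction hypothesis, whose right-hand side lies
    there.\<close>
  have "?d * ?b * ?R \<in> double_centralizer (gg i)"
    unfolding Suc by (rule rr_dc) (intro central_units_mult qs_units x)
  from double_centralizer_mult[OF double_centralizer_inverse[OF double_centralizer_mult[OF dc(2,3)]] this]
  have "inverse (?d * ?b) * (?d * ?b * ?R) \<in> double_centralizer (gg i)" .
  moreover have "?d * ?b \<noteq> 0" by (simp add: ee_nonzero qs_units)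
  ultimately have R: "?R \<in> double_centralizer (gg i)" by (metis inverse_mult_cancel)
  note bR = double_centralizer_mult[OF dc(3) R]
  have "ee i (qs i (2 * int (Suc m) - 2)) * ?b * cj (ff i) (rr i (Suc m) x) = ?a * (?b * ?R) * ?d * ?h"
    by (simp add: cjs mult.assoc)
  also have "?a * (?b * ?R) * ?d = ?d * (?a * (?b * ?R))"
    by (rule double_centralizer_commute[OF double_centralizer_mult[OF dc(1) bR] dc(2)])
  also have "?a * (?b * ?R) = (?b * ?R) * ?a"
    by (rule double_centralizer_commute[OF dc(1) bR])
  also have "?d * (?b * ?R * ?a) * ?h = (?d * ?b * ?R) * (?a * ?h)" by (simp only: mult.assoc)
  also have "\<dots> = rr i (Suc m) (qs i 1 * x)" by (simp only: Suc rr_Suc xq)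
  finally show ?case .
qed

text \<open>For \<epsilon>_ij = 1 the exponent (\<epsilon>_ij - 1) a_ij vanishes, so f_i1 commutes
  with g_j. Moving 1 + g_i past g_j gives 1 + q_i^(2m) g_i, then f_i1 lowers the exponent to 2m - 2,
  and f_i1 = (1 + q_i^-2 g_i)^-1 F supplies the denominator.\<close>

lemma cj_gg_pos:
  assumes "orient D i j = 1" "m = nat (- cartan D i j)"
  shows "cj (ff i) (gg j) = gg j * (ee i (qs i (2 * int m - 2)) * inverse (ee i (qs i (- 2))))"
proof (rule cj_eqI[OF ff_nonzero])
  have a: "cartan D i j = - int m" using assms orient_pos[of i j] by simp
  have s: "qs i (- 2) * qs i (2 * int m) = qs i (2 * int m - 2)"
    using qs_add[of i "- 2" "2 * int m"] by simp
  have "ff i * gg j = fa i * (gg j * ee i (qs i (2 * int m)))"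
    unfolding ff_eq mult.assoc using gg_ee[OF central_units_one, of i j] a assms(1) by simp
  also have "\<dots> = gg j * (fa i * ee i (qs i (2 * int m)))"
    using fa_gg[of i j] assms(1) by (simp flip: mult.assoc)
  also have "\<dots> = gg j * (ee i (qs i (2 * int m - 2)) * fa i)"
    unfolding fa_ee[OF qs_units] s ..
  also have "fa i = inverse (ee i (qs i (- 2))) * ff i"
    unfolding ff_eq' by (simp add: ee_nonzero qs_units flip: mult.assoc)
  finally show "ff i * gg j = gg j * (ee i (qs i (2 * int m - 2)) * inverse (ee i (qs i (- 2)))) * ff i"
    by (simp only: mult.assoc)
qed

text \<open>For \<epsilon>_ij = -1 moving f_i1 past g_j costs q_i^(2m), the origin of the power
  x^(2m) in \<open>phi\<close>. Factors 1 + c g_i pass g_j with the opposite exponent, so the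
  quotient of the positive case appears inverted and to the left of g_j.\<close>

lemma cj_gg_neg:
  assumes "orient D i j = - 1" "m = nat (- cartan D i j)"
  shows "cj (ff i) (gg j) =
    qs i (2 * int m) * inverse (ee i (qs i (2 * int m - 2)) * inverse (ee i (qs i (- 2)))) * gg j"
proof (rule cj_eqI[OF ff_nonzero])
  have a: "cartan D i j = - int m" using assms orient_pos[of i j] by simp
  have move: "ee i (qs i (2 * int m + k)) * gg j = gg j * ee i (qs i k)" for k
    using gg_ee[OF qs_units[of i "2 * int m + k"], of i j] a assms(1) qs_add[of i "- (2 * int m)" "2 * int m + k"]
    by simp
  let ?d = "ee i (qs i (2 * int m - 2))" and ?b = "ee i (qs i (- 2))"
  have nz: "?d \<noteq> 0" "?b \<noteq> 0" by (simp_all add: ee_nonzero qs_units)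
  have fa: "fa i = inverse ?b * ff i"
    unfolding ff_eq' using nz by (simp flip: mult.assoc)
  have gd: "gg j * inverse ?b = inverse ?d * gg j"
  proof -
    have "?d * gg j = gg j * ?b" using move[of "- 2"] by simp
    then have "inverse ?d * (?d * gg j) * inverse ?b = inverse ?d * (gg j * (?b * inverse ?b))"
      by (simp only: mult.assoc)
    then show ?thesis using nz by (simp add: inverse_mult_cancel)
  qed
  have "ff i * gg j = ?b * (fa i * gg j)" unfolding ff_eq' by (simp only: mult.assoc)
  also have "fa i * gg j = qs i (2 * int m) * (gg j * fa i)"
    using fa_gg[of i j] assms(1) a by simp
  also have "?b * (qs i (2 * int m) * (gg j * fa i)) = qs i (2 * int m) * (?b * (gg j * inverse ?b) * ff i)"
    unfolding fa S.sc_left_commute[of ?b] by (simp only: mult.assoc)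
  also have "\<dots> = qs i (2 * int m) * (?b * inverse ?d) * gg j * ff i"
    unfolding gd by (simp only: mult.assoc)
  also have "?b * inverse ?d = inverse (?d * inverse ?b)"
    using nz by (simp add: nonzero_inverse_mult_distrib)
  finally show "ff i * gg j = qs i (2 * int m) * inverse (?d * inverse ?b) * gg j * ff i" .
qed

lemma cj_units: "x \<in> central_units \<Longrightarrow> cj (ff i) x = x"
  by (rule cj_central[OF ff_nonzero]) (rule central_units_commute[symmetric])

text \<open>For \<epsilon>_ij = 1 or -1 the conjugate of g_j contributes the prefactor of
  \<open>cj_rr\<close>, or its inverse, which is what turns the conjugated product into the product
  at q_i x.\<close>

lemma cj_phi:
  assumes x: "x \<in> central_units"
  shows "cj (ff i) (phi D \<iota> i j x) = phi D \<iota> i j (qs i 1 * x)"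
proof -
  have qx: "qs i 1 * x \<in> central_units" by (intro central_units_mult qs_units x)
  consider "orient D i j = 1" | "orient D i j = - 1" | "i = j" | "i \<noteq> j" "orient D i j = 0"
    using orient_cases by blast
  then show ?thesis
  proof cases
    case 1
    define m where "m = nat (- cartan D i j)"
    show ?thesis
      using cj_rr[OF x, of i m]
      by (simp add: phi_pos[OF 1] cj_mult[OF ff_nonzero] cj_gg_pos[OF 1 refl] mult.assoc flip: m_def)
  next
    case 2
    define m where "m = nat (- cartan D i j)"
    have a: "- 2 * cartan D i j = 2 * int m" using 2 orient_pos[of i j] by (simp add: m_def)
    let ?T = "ee i (qs i (2 * int m - 2)) * inverse (ee i (qs i (- 2)))"
    let ?R = "cj (ff i) (rr i m x)"
    have nz: "?T \<noteq> 0" by (simp add: ee_nonzero qs_units)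
    have "?R \<noteq> 0" using cj_rr[OF x, of i m] rr_nonzero[OF qx, of i m] by auto
    then have inv: "inverse (rr i m (qs i 1 * x)) = inverse ?R * inverse ?T"
      using nonzero_inverse_mult_distrib[OF nz \<open>?R \<noteq> 0\<close>] cj_rr[OF x, of i m] by simp
    have "cj (ff i) (phi D \<iota> i j x) = x powi (2 * int m) * inverse ?R * (qs i (2 * int m) * inverse ?T * gg j)"
      unfolding phi_neg[OF 2 x] a m_def[symmetric]
      by (simp only: cj_mult[OF ff_nonzero] cj_inverse[OF ff_nonzero] cj_units[OF central_units_powi[OF x]]
          cj_gg_neg[OF 2 m_def])
    also have "\<dots> = (qs i (2 * int m) * x powi (2 * int m)) * (inverse ?R * inverse ?T) * gg j"
      using S.sc_left_commute[of "x powi (2 * int m) * inverse ?R"] by (simp only: mult.assoc)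
    also have "qs i (2 * int m) * x powi (2 * int m) = (qs i 1 * x) powi (2 * int m)"
    proof -
      have "qs i (2 * int m) = qs i 1 powi (2 * int m)"
        by (simp flip: S.sc_powi power_int_mult)
      then show ?thesis by (simp only: powi_mult_distrib_central[OF qs_units])
    qed
    finally show ?thesis unfolding phi_neg[OF 2 qx] a m_def[symmetric] inv .
  next
    case 3
    have p: "(qs i 1 * x) powi (- 2) = qs i (- 2) * x powi (- 2)"
      by (subst powi_mult_distrib_central[OF qs_units]) (simp flip: S.sc_powi power_int_mult)
    \<comment> \<open>Since 1 + g_i commutes with g_i, only f_i1 acts, with the factor q_i^-2 that
      x^-2 acquires under x \<mapsto> q_i x.\<close>
    have "ff i * gg i = fa i * (gg i * ee i 1)"
      unfolding ff_eq mult.assoc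
      using double_centralizer_commute[OF ee_dc[OF central_units_one] double_centralizer_self, of i] by simp
    also have "\<dots> = qs i (- 2) * gg i * ff i"
      using fa_gg[of i i] unfolding ff_eq by (simp add: orient_diag cartan_diag flip: mult.assoc)
    finally have "cj (ff i) (gg i) = qs i (- 2) * gg i" by (rule cj_eqI[OF ff_nonzero])
    then show ?thesis
      unfolding 3[symmetric] phi_diag p
      by (simp only: cj_mult[OF ff_nonzero] cj_units[OF central_units_powi[OF x]])
         (simp only: S.sc_central mult.assoc)
  next
    case 4
    have "ff i * gg j = fa i * (gg j * ee i 1)"
      unfolding ff_eq mult.assoc using gg_ee[OF central_units_one, of i j] 4 by simp
    also have "\<dots> = gg j * ff i"
      using fa_gg[of i j] 4 orient_zero[of i j] unfolding ff_eq by (simp flip: mult.assoc)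
    finally have "cj (ff i) (gg j) = gg j" by (rule cj_eqI[OF ff_nonzero])
    then show ?thesis using 4 by (simp add: phi_other)
  qed
qed

text \<open>At x = 1 numerators and denominators coincide. The generators g_j are therefore the
  values at 1 of the families \<open>phi\<close>.\<close>

lemma phi_one: "phi D \<iota> i j 1 = gg j"
proof -
  have r: "rr i m 1 = 1" for m
    by (induction m) (simp_all add: rr_Suc ee_nonzero qs_units)
  consider "orient D i j = 1" | "orient D i j = - 1" | "i = j" | "i \<noteq> j" "orient D i j = 0"
    using orient_cases by blast
  then show ?thesis
    by cases (simp_all add: phi_pos phi_neg central_units_one r phi_diag phi_other)
qed

lemma cj_ff_powi: "ff i powi n * phi D \<iota> i j x * ff i powi (- n) = phi D \<iota> i j (qs i n * x)"
  if x: "x \<in> central_units" for x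
proof -
  let ?F = "ff i" and ?p = "phi D \<iota> i j"
  have nat: "?F ^ n * ?p x * inverse (?F ^ n) = ?p (qs i (int n) * x)" if "x \<in> central_units" for n x
  proof (induction n)
    case (Suc n)
    have "?F ^ Suc n * ?p x * inverse (?F ^ Suc n) = cj ?F (?F ^ n * ?p x * inverse (?F ^ n))"
      using ff_nonzero[of i] by (simp add: cj_def nonzero_inverse_mult_distrib mult.assoc power_commutes)
    also have "\<dots> = ?p (qs i 1 * (qs i (int n) * x))"
      unfolding Suc by (rule cj_phi) (intro central_units_mult qs_units that)
    also have "qs i 1 * (qs i (int n) * x) = qs i (int (Suc n)) * x"
      using qs_add[of i 1 "int n"] by (simp flip: mult.assoc)
    finally show ?case .
  qed simp
  show ?thesis
  proof (cases n)
    case (nonneg k)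
    then show ?thesis using nat[OF x, of k] by (simp add: power_int_minus)
  next
    case (neg k)
    define l where "l = Suc k"
    have n: "n = - int l" using neg by (simp add: l_def)
    \<comment> \<open>A negative power is obtained from the positive one applied at the point q_i^n
      x, from which l steps lead back to x.\<close>
    have u: "qs i n * x \<in> central_units" by (intro central_units_mult qs_units x)
    have "qs i (int l) * qs i n = 1" unfolding qs_add[symmetric] n by simp
    then have "qs i (int l) * (qs i n * x) = x" unfolding mult.assoc[symmetric] by simp
    then have e: "?F ^ l * ?p (qs i n * x) * inverse (?F ^ l) = ?p x" using nat[OF u, of l] by metis
    have "?F ^ l \<noteq> 0" using ff_nonzero[of i] by simp
    then have "inverse (?F ^ l) * ?p x * ?F ^ l = ?p (qs i n * x)"
      unfolding e[symmetric] by (simp add: mult.assoc inverse_mult_cancel)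
    then show ?thesis unfolding n by (simp add: power_int_minus)
  qed
qed

end

context qfractions
begin

section \<open>Rational families in the central variable\<close>

abbreviation dc :: "'i \<Rightarrow> 'k set" where "dc i \<equiv> double_centralizer (gg i)"

text \<open>The values lie in a commutative set and do not vanish, so any two denominators have
  their product as a common multiple, at every central unit.\<close>

definition denominators :: "'i \<Rightarrow> ('k \<Rightarrow> 'k) set" where
  "denominators i = {d. laurent d \<and> (\<forall>x\<in>central_units. d x \<in> dc i \<and> d x \<noteq> 0)}"

definition laurent_fractions :: "'i \<Rightarrow> ('k \<Rightarrow> 'k) set" where
  "laurent_fractions i = {h. \<exists>d\<in>denominators i. laurent (\<lambda>x. h x * d x)}"

definition rationals :: "'i \<Rightarrow> ('k \<Rightarrow> 'k) set" where
  "rationals i = {r \<in> laurent_fractions i. \<forall>x\<in>central_units. r x \<in> dc i}"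

lemma denominators_mult:
  "d \<in> denominators i \<Longrightarrow> d' \<in> denominators i \<Longrightarrow> (\<lambda>x. d x * d' x) \<in> denominators i"
  by (auto simp: denominators_def laurent_mult double_centralizer_mult)

lemma denominators_commute:
  "d \<in> denominators i \<Longrightarrow> u \<in> dc i \<Longrightarrow> x \<in> central_units \<Longrightarrow> d x * u = u * d x"
  by (rule double_centralizer_commute) (auto simp: denominators_def)

lemma laurent_fractions_cong:
  "h \<in> laurent_fractions i \<Longrightarrow> (\<And>x. x \<in> central_units \<Longrightarrow> h x = h' x) \<Longrightarrow> h' \<in> laurent_fractions i"
  unfolding laurent_fractions_def by (auto intro!: bexI elim!: laurent_cong)

lemma laurent_fractions_add:
  assumes "h \<in> laurent_fractions i" "h' \<in> laurent_fractions i"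
  shows "(\<lambda>x. h x + h' x) \<in> laurent_fractions i"
proof -
  obtain d d' where d: "d \<in> denominators i" "laurent (\<lambda>x. h x * d x)"
    "d' \<in> denominators i" "laurent (\<lambda>x. h' x * d' x)"
    using assms unfolding laurent_fractions_def by blast
  have "laurent d" "laurent d'" using d by (auto simp: denominators_def)
  then have "laurent (\<lambda>x. (h x * d x) * d' x + (h' x * d' x) * d x)"
    by (intro laurent_add laurent_mult d)
  then have "laurent (\<lambda>x. (h x + h' x) * (d x * d' x))"
  proof (rule laurent_cong)
    fix x :: 'k assume x: "x \<in> central_units"
    have "d' x * d x = d x * d' x"
      using d x by (intro denominators_commute) (auto simp: denominators_def)
    then show "(h x * d x) * d' x + (h' x * d' x) * d x = (h x + h' x) * (d x * d' x)"
      by (simp add: distrib_right mult.assoc)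
  qed
  then show ?thesis
    unfolding laurent_fractions_def
    by (intro CollectI bexI[of _ "\<lambda>x. d x * d' x"] denominators_mult d)
qed

lemma laurent_fractions_scale:
  assumes "h \<in> laurent_fractions i" shows "(\<lambda>x. u * h x) \<in> laurent_fractions i"
proof -
  obtain d where d: "d \<in> denominators i" "laurent (\<lambda>x. h x * d x)"
    using assms unfolding laurent_fractions_def by blast
  have "laurent (\<lambda>x. u * (h x * d x))" by (intro laurent_mult laurent_const d)
  then show ?thesis unfolding laurent_fractions_def using d by (auto simp: mult.assoc)
qed

lemma rationalsI:
  assumes "d \<in> denominators i" "laurent (\<lambda>x. r x * d x)" "\<And>x. x \<in> central_units \<Longrightarrow> r x \<in> dc i"
  shows "r \<in> rationals i"
  using assms unfolding rationals_def laurent_fractions_def by blast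

lemma rationals_dc: "r \<in> rationals i \<Longrightarrow> x \<in> central_units \<Longrightarrow> r x \<in> dc i"
  by (simp add: rationals_def)

lemma rationalsE:
  assumes "r \<in> rationals i"
  obtains d where "d \<in> denominators i" "laurent (\<lambda>x. r x * d x)"
  using assms unfolding rationals_def laurent_fractions_def by blast

lemma rationals_cong:
  "r \<in> rationals i \<Longrightarrow> (\<And>x. x \<in> central_units \<Longrightarrow> r x = r' x) \<Longrightarrow> r' \<in> rationals i"
  unfolding rationals_def using laurent_fractions_cong[of r i r'] by simp

lemma rationals_mult:
  assumes "r \<in> rationals i" "r' \<in> rationals i"
  shows "(\<lambda>x. r x * r' x) \<in> rationals i"
proof -
  obtain d d' where d: "d \<in> denominators i" "laurent (\<lambda>x. r x * d x)"
    "d' \<in> denominators i" "laurent (\<lambda>x. r' x * d' x)"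
    using assms by (blast elim: rationalsE)
  have "laurent (\<lambda>x. (r x * d x) * (r' x * d' x))" by (intro laurent_mult d)
  then have l: "laurent (\<lambda>x. r x * r' x * (d x * d' x))"
  proof (rule laurent_cong)
    fix x :: 'k assume x: "x \<in> central_units"
    have "d x * r' x = r' x * d x"
      using denominators_commute[OF d(1) rationals_dc[OF assms(2) x] x] .
    then have "r x * (d x * r' x) * d' x = r x * (r' x * d x) * d' x" by simp
    then show "(r x * d x) * (r' x * d' x) = r x * r' x * (d x * d' x)" by (simp only: mult.assoc)
  qed
  show ?thesis
    by (rule rationalsI[OF denominators_mult[OF d(1,3)] l])
       (intro double_centralizer_mult rationals_dc[OF assms(1)] rationals_dc[OF assms(2)])
qed

lemma denominators_one: "(\<lambda>x. 1) \<in> denominators i"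
  by (auto simp: denominators_def laurent_const double_centralizer_one)

lemma rationals_laurent:
  "laurent p \<Longrightarrow> (\<And>x. x \<in> central_units \<Longrightarrow> p x \<in> dc i) \<Longrightarrow> p \<in> rationals i"
  by (rule rationalsI[OF denominators_one]) simp_all

lemma rationals_inverse_denominator: "d \<in> denominators i \<Longrightarrow> (\<lambda>x. inverse (d x)) \<in> rationals i"
  by (rule rationalsI, assumption)
     (auto simp: denominators_def double_centralizer_inverse intro: laurent_cong[OF laurent_const[of 1]])

lemma central_dc: "x \<in> central_units \<Longrightarrow> x \<in> dc i"
  by (rule double_centralizer_central) (rule central_units_commute[symmetric])

lemma rationals_const: "u \<in> dc i \<Longrightarrow> (\<lambda>x. u) \<in> rationals i"
  by (rule rationals_laurent) (auto intro: laurent_const)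

lemma rationals_powi: "(\<lambda>x. x powi k) \<in> rationals i"
  using laurent_monom[of 1 k] by (intro rationals_laurent) (auto intro: central_dc central_units_powi)

lemma denominators_ee: "(\<lambda>x. ee i (qs i k * x powi (- 2))) \<in> denominators i"
proof -
  have "laurent (\<lambda>x. 1 + (qs i k * gg i) * x powi (- 2))"
    by (intro laurent_add laurent_const laurent_monom)
  then have "laurent (\<lambda>x. ee i (qs i k * x powi (- 2)))"
  proof (rule laurent_cong)
    fix x :: 'k assume "x \<in> central_units"
    then have "gg i * x powi (- 2) = x powi (- 2) * gg i"
      by (intro central_units_commute central_units_powi)
    then show "1 + (qs i k * gg i) * x powi (- 2) = ee i (qs i k * x powi (- 2))"
      by (simp only: ee_def mult.assoc)
  qed
  then show ?thesis
    unfolding denominators_def using ee_nonzero ee_dc den_units by blast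
qed

lemma denominators_rationals: "d \<in> denominators i \<Longrightarrow> d \<in> rationals i"
  by (rule rationals_laurent) (auto simp: denominators_def)

lemma rationals_rr: "rr i m \<in> rationals i"
proof (induction m)
  case 0
  then show ?case
    by (rule rationals_cong[OF rationals_const[OF double_centralizer_one]]) simp
next
  case (Suc m)
  have "(\<lambda>x. rr i m x * (ee i (qs i (2 * int m)) * inverse (ee i (qs i (2 * int m) * x powi (- 2)))))
      \<in> rationals i"
    by (intro rationals_mult Suc rationals_const rationals_inverse_denominator denominators_ee ee_dc qs_units)
  then show ?case by (simp only: rr_Suc[symmetric])
qed

lemma rationals_inverse_rr: "(\<lambda>x. inverse (rr i m x)) \<in> rationals i"
proof (induction m)
  case 0
  then show ?case
    by (rule rationals_cong[OF rationals_const[OF double_centralizer_one]]) simp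
next
  case (Suc m)
  have "(\<lambda>x. ee i (qs i (2 * int m) * x powi (- 2)) * inverse (ee i (qs i (2 * int m))) * inverse (rr i m x))
      \<in> rationals i"
    by (intro rationals_mult Suc rationals_const denominators_rationals denominators_ee
        double_centralizer_inverse ee_dc qs_units)
  then show ?case
    by (rule rationals_cong)
       (simp add: rr_Suc nonzero_inverse_mult_distrib rr_nonzero ee_nonzero qs_units den_units)
qed

text \<open>If v commutes with g_i, then so does u v u^-1, because the scalar c cancels. Hence w
  commutes with u v u^-1, and conjugating back gives the claim.\<close>

lemma dc_conj:
  assumes "u \<noteq> 0" "S.qc c u (gg i)" "w \<in> dc i"
  shows "inverse u * w * u \<in> dc i"
proof (rule double_centralizerI)
  fix v assume v: "v * gg i = gg i * v"
  have iu: "inverse u * gg i = sc (inverse c) * (gg i * inverse u)"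
    by (rule S.qcD[OF S.qc_inverse_left[OF assms(2)]])
  have c: "c \<noteq> 0" using assms(2) by (simp add: S.qc_def)
  have "(u * v * inverse u) * gg i = u * v * (inverse u * gg i)" by (simp only: mult.assoc)
  also have "\<dots> = sc (inverse c) * (u * (v * gg i) * inverse u)"
    unfolding iu S.sc_left_commute[of "u * v"] by (simp only: mult.assoc)
  also have "\<dots> = sc (inverse c) * ((u * gg i) * v * inverse u)"
    unfolding v by (simp only: mult.assoc)
  also have "\<dots> = (sc (inverse c) * sc c) * (gg i * (u * v * inverse u))"
    unfolding S.qcD[OF assms(2)] by (simp only: mult.assoc)
  also have "\<dots> = gg i * (u * v * inverse u)" using c by (simp flip: S.sc_mult)
  finally have "w * (u * v * inverse u) = (u * v * inverse u) * w"
    by (rule double_centralizerD[OF assms(3)])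
  then have "inverse u * (w * (u * v * inverse u)) * u = inverse u * ((u * v * inverse u) * w) * u" by simp
  then have "inverse u * w * u * v * (inverse u * u) = inverse u * u * v * inverse u * w * u"
    by (simp only: mult.assoc)
  then show "inverse u * w * u * v = v * (inverse u * w * u)" using assms(1) by (simp add: mult.assoc)
qed

lemma rationals_conj:
  assumes u: "u \<noteq> 0" "S.qc c u (gg i)" and r: "r \<in> rationals i"
  shows "(\<lambda>x. inverse u * r x * u) \<in> rationals i"
proof -
  obtain d where d: "d \<in> denominators i" "laurent (\<lambda>x. r x * d x)" using r by (rule rationalsE)
  have "(\<lambda>x. inverse u * d x * u) \<in> denominators i"
    using d(1) u by (auto simp: denominators_def intro!: laurent_mult laurent_const dc_conj[OF u])
  moreover have "laurent (\<lambda>x. inverse u * (r x * d x) * u)"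
    by (intro laurent_mult laurent_const d)
  then have "laurent (\<lambda>x. (inverse u * r x * u) * (inverse u * d x * u))"
  proof (rule laurent_cong)
    fix x
    have "inverse u * r x * (u * inverse u) * d x * u = inverse u * (r x * d x) * u"
      using u by (simp add: mult.assoc)
    then show "inverse u * (r x * d x) * u = (inverse u * r x * u) * (inverse u * d x * u)"
      by (simp only: mult.assoc)
  qed
  ultimately show ?thesis
    by (rule rationalsI) (intro dc_conj[OF u] rationals_dc[OF r])
qed

text \<open>A normal form: a constant that commutes with g_i up to a scalar, followed by a rational
  family in g_i. It survives multiplication because u r u' r' = u u' (u'^-1 r u') r', and the
  bracket is again rational.\<close>

definition monomial_families :: "'i \<Rightarrow> ('k \<Rightarrow> 'k) set" where
  "monomial_families i = {h. \<exists>u c r. u \<noteq> 0 \<and> S.qc c u (gg i) \<and> r \<in> rationals i \<and>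
     (\<forall>x\<in>central_units. h x = u * r x)}"

lemma monomial_familiesI:
  "u \<noteq> 0 \<Longrightarrow> S.qc c u (gg i) \<Longrightarrow> r \<in> rationals i \<Longrightarrow> (\<And>x. x \<in> central_units \<Longrightarrow> h x = u * r x) \<Longrightarrow>
    h \<in> monomial_families i"
  unfolding monomial_families_def by blast

lemma monomial_families_mult:
  assumes "h \<in> monomial_families i" "h' \<in> monomial_families i"
  shows "(\<lambda>x. h x * h' x) \<in> monomial_families i"
proof -
  obtain u c r u' c' r' where h: "u \<noteq> 0" "S.qc c u (gg i)" "r \<in> rationals i"
    "\<And>x. x \<in> central_units \<Longrightarrow> h x = u * r x"
    "u' \<noteq> 0" "S.qc c' u' (gg i)" "r' \<in> rationals i" "\<And>x. x \<in> central_units \<Longrightarrow> h' x = u' * r' x"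
    using assms unfolding monomial_families_def by blast
  show ?thesis
  proof (rule monomial_familiesI[OF _ S.qc_mult_left[OF h(2,6)]
        rationals_mult[OF rationals_conj[OF h(5,6,3)] h(7)]])
    fix x :: 'k assume x: "x \<in> central_units"
    have "u * u' * (inverse u' * r x * u' * r' x) = u * (u' * inverse u') * (r x * u' * r' x)"
      by (simp only: mult.assoc)
    then show "h x * h' x = u * u' * (inverse u' * r x * u' * r' x)"
      unfolding h(4)[OF x] h(8)[OF x] right_inverse[OF h(5)] mult_1_right by (simp only: mult.assoc)
  qed (use h in simp)
qed

lemma monomial_families_fractions: "h \<in> monomial_families i \<Longrightarrow> h \<in> laurent_fractions i"
  unfolding monomial_families_def rationals_def
  by (auto intro: laurent_fractions_cong[OF laurent_fractions_scale])

text \<open>Sums with different left constants u leave the normal form, but such constants do not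
  interfere with a common denominator on the right.\<close>

inductive_set polynomial_families :: "'i \<Rightarrow> ('k \<Rightarrow> 'k) set" for i where
  monomial: "h \<in> monomial_families i \<Longrightarrow> h \<in> polynomial_families i"
| add: "h \<in> polynomial_families i \<Longrightarrow> h' \<in> polynomial_families i \<Longrightarrow> (\<lambda>x. h x + h' x) \<in> polynomial_families i"

lemma polynomial_families_mult:
  assumes "h \<in> polynomial_families i" "h' \<in> polynomial_families i"
  shows "(\<lambda>x. h x * h' x) \<in> polynomial_families i"
  using assms(1)
proof induction
  case (monomial h)
  from assms(2) show ?case
  proof induction
    case (monomial h')
    then show ?case using \<open>h \<in> monomial_families i\<close>
      by (intro polynomial_families.monomial monomial_families_mult)
  next
    case (add h1 h2)
    then show ?case using polynomial_families.add[OF add.IH] by (simp add: distrib_left)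
  qed
next
  case (add h1 h2)
  then show ?case using polynomial_families.add[OF add.IH] by (simp add: distrib_right)
qed

lemma polynomial_families_fractions: "h \<in> polynomial_families i \<Longrightarrow> h \<in> laurent_fractions i"
  by (induction rule: polynomial_families.induct)
     (auto intro: monomial_families_fractions laurent_fractions_add)

section \<open>Specialization of the central variable\<close>

text \<open>Polynomial expressions are represented by the functions of x they define, for one fixed
  i. Being a homomorphic image of A_q is then a question about values of functions and not about
  words in generators.\<close>

inductive_set families :: "'i \<Rightarrow> ('k \<Rightarrow> 'k) set" for i where
  families_sc: "(\<lambda>x. sc c) \<in> families i"
| families_qq: "(\<lambda>x. qq y) \<in> families i"
| families_phi: "phi D \<iota> i j \<in> families i"
| families_add: "h \<in> families i \<Longrightarrow> h' \<in> families i \<Longrightarrow> (\<lambda>x. h x + h' x) \<in> families i"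
| families_mult: "h \<in> families i \<Longrightarrow> h' \<in> families i \<Longrightarrow> (\<lambda>x. h x * h' x) \<in> families i"

lemma qc_one: "S.qc 1 1 k"
  by (rule S.qcI) simp_all

lemma phi_monomial: "phi D \<iota> i j \<in> monomial_families i"
proof -
  define m where "m = nat (- cartan D i j)"
  consider "orient D i j = 1" | "orient D i j = - 1" | "i = j" | "i \<noteq> j" "orient D i j = 0"
    using orient_cases by blast
  then show ?thesis
  proof cases
    case 1
    show ?thesis
      by (rule monomial_familiesI[OF gg_nonzero[of j] qc_gg_gg rationals_rr[of i m]])
         (simp add: phi_pos[OF 1] m_def)
  next
    case 2
    have "(\<lambda>x. x powi (- 2 * cartan D i j) * inverse (rr i m x)) \<in> rationals i"
      by (intro rationals_mult rationals_powi rationals_inverse_rr)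
    \<comment> \<open>For \<epsilon>_ij = -1 the element g_j stands on the right of the product;
      conjugating the rational family by it brings it to the left, as the normal form
      demands.\<close>
    from rationals_conj[OF gg_nonzero[of j] qc_gg_gg this]
    show ?thesis
    proof (rule monomial_familiesI[OF gg_nonzero[of j] qc_gg_gg])
      fix x :: 'k assume x: "x \<in> central_units"
      have "gg j * (inverse (gg j) * (x powi (- 2 * cartan D i j) * inverse (rr i m x)) * gg j)
          = gg j * inverse (gg j) * (x powi (- 2 * cartan D i j) * inverse (rr i m x)) * gg j"
        by (simp only: mult.assoc)
      then show "phi D \<iota> i j x
          = gg j * (inverse (gg j) * (x powi (- 2 * cartan D i j) * inverse (rr i m x)) * gg j)"
        unfolding phi_neg[OF 2 x] m_def[symmetric] using gg_nonzero[of j] by simp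
    qed
  next
    case 3
    show ?thesis
    proof (rule monomial_familiesI[OF gg_nonzero[of i] qc_gg_gg rationals_powi])
      fix x :: 'k assume "x \<in> central_units"
      then show "phi D \<iota> i j x = gg i * x powi (- 2)"
        unfolding 3[symmetric] phi_diag by (intro central_units_commute[symmetric] central_units_powi)
    qed
  next
    case 4
    show ?thesis
      by (rule monomial_familiesI[OF gg_nonzero[of j] qc_gg_gg rationals_const[OF double_centralizer_one]])
         (simp add: phi_other 4)
  qed
qed

lemma families_polynomial: "h \<in> families i \<Longrightarrow> h \<in> polynomial_families i"
proof (induction rule: families.induct)
  case (families_sc c)
  have "(\<lambda>x. sc c) \<in> rationals i"
    by (rule rationals_const, rule double_centralizer_central) (rule S.sc_central)
  then show ?case
    by (intro polynomial_families.monomial monomial_familiesI[OF _ qc_one]) simp_all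
next
  case (families_qq y)
  have "(\<lambda>x. qq y) \<in> rationals i"
    by (intro rationals_const central_dc qq_units)
  then show ?case
    by (intro polynomial_families.monomial monomial_familiesI[OF _ qc_one]) simp_all
next
  case (families_phi j)
  show ?case by (rule polynomial_families.monomial[OF phi_monomial])
qed (simp_all add: polynomial_families.add polynomial_families_mult)

lemma cj_families: "h \<in> families i \<Longrightarrow> x \<in> central_units \<Longrightarrow> cj (ff i) (h x) = h (qs i 1 * x)"
proof (induction rule: families.induct)
  case (families_sc c)
  show ?case by (rule cj_central[OF ff_nonzero]) (rule S.sc_central)
next
  case (families_qq y)
  show ?case by (rule cj_units[OF qq_units])
qed (simp_all add: cj_phi cj_add cj_mult ff_nonzero)

text \<open>A zero \<open>x\<^sub>0\<close> propagates by conjugation to all \<open>q\<^sub>i\<^sup>n x\<^sub>0\<close>, too many for a Laurent polynomial.\<close>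

lemma families_vanish:
  assumes h: "h \<in> families i" and x0: "x0 \<in> central_units" "h x0 = 0" and x: "x \<in> central_units"
  shows "h x = 0"
proof -
  have z: "h (qs i 1 ^ n * x0) = 0" for n
  proof (induction n)
    case (Suc n)
    have "qs i 1 ^ n * x0 \<in> central_units"
      by (intro central_units_mult central_units_power qs_units x0)
    from cj_families[OF h this] show ?case by (simp only: Suc power_Suc mult.assoc) (simp add: cj_def)
  qed (simp add: x0)
  obtain d where d: "d \<in> denominators i" "laurent (\<lambda>x. h x * d x)"
    using polynomial_families_fractions[OF families_polynomial[OF h]]
    unfolding laurent_fractions_def by blast
  have q: "k = l" if "qs i 1 powi k = qs i 1 powi l" for k l
  proof -
    have "qs i k = qs i l" using that by (simp flip: S.sc_powi power_int_mult)
    then show ?thesis by (rule qs_inj)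
  qed
  have "h x * d x = 0"
    by (rule laurent_vanish[OF d(2) qs_units[of i 1] x0(1) q _ x]) (simp_all only: z mult_zero_left)
  moreover have "d x \<noteq> 0" using d(1) x by (simp add: denominators_def)
  ultimately show ?thesis by simp
qed

lemma families_diff: "h \<in> families i \<Longrightarrow> h' \<in> families i \<Longrightarrow> (\<lambda>x. h x - h' x) \<in> families i"
  using families_add[OF _ families_mult[OF families_sc[of "- 1"]]] by (simp add: S.sc_minus)

text \<open>With x0 = 1 this is the well-definedness of the substitution: two expressions for the
  same element of A_q have the same value at x.\<close>

lemma families_determined:
  assumes "h \<in> families i" "h' \<in> families i" "x0 \<in> central_units" "h x0 = h' x0" "x \<in> central_units"
  shows "h x = h' x"
  using families_vanish[OF families_diff[OF assms(1,2)] assms(3) _ assms(5)] assms(4) by simp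

section \<open>The algebra \<open>\<A>\<^sub>q\<close> and its skew field of fractions\<close>

lemma type_algebra_minus: "\<ominus>\<^bsub>ring_of_type_algebra\<^esub> (x :: 'k) = - x"
proof -
  have "\<exists>y. y + x = 0" for x :: 'k by (rule exI[of _ "- x"]) simp
  then interpret K: ring "ring_of_type_algebra :: 'k ring"
    by unfold_locales (auto simp: ring_of_type_algebra_def Units_def algebra_simps)
  show ?thesis by (rule K.minus_equality) (simp_all add: ring_of_type_algebra_def)
qed

lemma Aq_closed:
  "sc c \<in> Aq D \<iota>" "gg j \<in> Aq D \<iota>" "qq y \<in> Aq D \<iota>" "1 \<in> Aq D \<iota>"
  "a \<in> Aq D \<iota> \<Longrightarrow> - a \<in> Aq D \<iota>"
  "a \<in> Aq D \<iota> \<Longrightarrow> b \<in> Aq D \<iota> \<Longrightarrow> a + b \<in> Aq D \<iota>"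
  "a \<in> Aq D \<iota> \<Longrightarrow> b \<in> Aq D \<iota> \<Longrightarrow> a * b \<in> Aq D \<iota>"
proof -
  let ?K = "ring_of_type_algebra :: 'k ring" and ?G = "range sc \<union> range gg \<union> range qq"
  have ops: "monoid.mult ?K = (*)" "add ?K = (+)" "\<one>\<^bsub>?K\<^esub> = 1"
    by (simp_all add: ring_of_type_algebra_def)
  show "sc c \<in> Aq D \<iota>" "gg j \<in> Aq D \<iota>" "qq y \<in> Aq D \<iota>"
    unfolding Aq_def by (auto intro: generate_ring.incl)
  show "1 \<in> Aq D \<iota>"
    unfolding Aq_def using generate_ring.one[of ?K ?G] by (simp only: ops)
  show "a \<in> Aq D \<iota> \<Longrightarrow> - a \<in> Aq D \<iota>"
    unfolding Aq_def using generate_ring.a_inv[of a ?K ?G] by (simp only: type_algebra_minus)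
  show "a \<in> Aq D \<iota> \<Longrightarrow> b \<in> Aq D \<iota> \<Longrightarrow> a + b \<in> Aq D \<iota>"
    unfolding Aq_def using generate_ring.eng_add[of a ?K ?G b] by (simp only: ops)
  show "a \<in> Aq D \<iota> \<Longrightarrow> b \<in> Aq D \<iota> \<Longrightarrow> a * b \<in> Aq D \<iota>"
    unfolding Aq_def using generate_ring.eng_mult[of a ?K ?G b] by (simp only: ops)
qed

lemma Aq_induct [consumes 1, case_names sc gg qq minus add mult]:
  assumes "a \<in> Aq D \<iota>" "\<And>c. P (sc c)" "\<And>j. P (gg j)" "\<And>y. P (qq y)"
    "\<And>a. a \<in> Aq D \<iota> \<Longrightarrow> P a \<Longrightarrow> P (- a)"
    "\<And>a b. a \<in> Aq D \<iota> \<Longrightarrow> b \<in> Aq D \<iota> \<Longrightarrow> P a \<Longrightarrow> P b \<Longrightarrow> P (a + b)"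
    "\<And>a b. a \<in> Aq D \<iota> \<Longrightarrow> b \<in> Aq D \<iota> \<Longrightarrow> P a \<Longrightarrow> P b \<Longrightarrow> P (a * b)"
  shows "P a"
  using assms(1) unfolding Aq_def
proof (induction rule: generate_ring.induct)
  case one
  then show ?case using assms(2)[of 1] by (simp add: ring_of_type_algebra_def)
next
  case (a_inv h)
  then show ?case using assms(5) by (simp add: type_algebra_minus Aq_def)
next
  case (eng_add h1 h2)
  then show ?case using assms(6) by (simp add: Aq_def ring_of_type_algebra_def)
next
  case (eng_mult h1 h2)
  then show ?case using assms(7) by (simp add: Aq_def ring_of_type_algebra_def)
qed (use assms in auto)

text \<open>By \<open>phi_one\<close>, evaluation at 1 sends the generators of the families to the
  generators of A_q.\<close>

lemma Aq_families: "a \<in> Aq D \<iota> \<longleftrightarrow> (\<exists>h\<in>families i. h 1 = a)"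
proof
  assume "a \<in> Aq D \<iota>"
  then show "\<exists>h\<in>families i. h 1 = a"
  proof (induction rule: Aq_induct)
    case (gg j)
    show ?case using families_phi phi_one by blast
  next
    case (minus a)
    then obtain h where "h \<in> families i" "h 1 = a" by blast
    then show ?case using families_mult[OF families_sc[of "- 1"], of h] by (force simp: S.sc_minus)
  next
    case (add a b)
    then show ?case using families_add by fast
  next
    case (mult a b)
    then show ?case using families_mult by fast
  qed (use families_sc families_qq in fast)+
next
  assume "\<exists>h\<in>families i. h 1 = a"
  then obtain h where "h \<in> families i" "h 1 = a" by blast
  then show "a \<in> Aq D \<iota>"
    by (induction arbitrary: a rule: families.induct) (auto simp: Aq_closed phi_one)
qed

sublocale Q: ore_subring "Aq D \<iota>"
proof
  \<comment> \<open>The scalars are left out of the generators, since they enter as coefficients of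
    the span.\<close>
  let ?G = "range gg \<union> range qq"
  have central: "\<exists>c. S.qc c x k" if "x \<in> central_units" for x k
    using central_units_commute[OF that, of k] by (intro exI[of _ 1] S.qcI) simp_all
  have qc: "\<exists>c. S.qc c x y" if xy: "x \<in> ?G" "y \<in> ?G" for x y
  proof -
    consider "x \<in> range qq" | "y \<in> range qq" | "x \<in> range gg" "y \<in> range gg" using xy by blast
    then show ?thesis
    proof cases
      case 1 then show ?thesis using central qq_units by blast
    next
      case 2 then show ?thesis using central qq_units S.qc_sym by blast
    next
      case 3 then show ?thesis using qc_gg_gg by blast
    qed
  qed
  note mc = S.monomial_span_closed[of ?G, OF qc]
  have sub: "Aq D \<iota> \<subseteq> S.monomial_span ?G"
  proof
    fix a assume "a \<in> Aq D \<iota>"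
    then show "a \<in> S.monomial_span ?G"
      by (induction rule: Aq_induct) (auto intro: mc)
  qed
  fix a s assume "a \<in> Aq D \<iota>" "s \<in> Aq D \<iota>" "s \<noteq> 0"
  then show "\<exists>a'\<in>Aq D \<iota>. \<exists>s'\<in>Aq D \<iota>. s' \<noteq> 0 \<and> s * a' = a * s'"
    by (intro S.right_Ore[OF qc sub] Aq_closed)
qed (simp_all add: Aq_closed)

lemma QAq_fracs: "QAq D \<iota> = Q.fracs"
  by (simp add: QAq_def Q.fracs_def)

text \<open>Sends h(1) to h(x0) for a family h; by \<open>families_determined\<close> the chosen h
  does not matter when x0 is a central unit.\<close>

definition specialize :: "'i \<Rightarrow> 'k \<Rightarrow> 'k \<Rightarrow> 'k" where
  "specialize i x0 a = (SOME h. h \<in> families i \<and> h 1 = a) x0"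

lemma specialize_eq:
  assumes "h \<in> families i" "x0 \<in> central_units"
  shows "specialize i x0 (h 1) = h x0"
proof -
  have "\<exists>h'. h' \<in> families i \<and> h' 1 = h 1" using assms by blast
  from someI_ex[OF this] show ?thesis
    unfolding specialize_def using families_determined[OF _ assms(1) central_units_one _ assms(2)] by blast
qed

lemma ore_embedding_specialize:
  assumes x0: "x0 \<in> central_units"
  shows "ore_embedding (Aq D \<iota>) (specialize i x0)"
proof unfold_locales
  note s = specialize_eq[OF _ x0, of _ i]
  fix a b assume "a \<in> Aq D \<iota>" "b \<in> Aq D \<iota>"
  then obtain h h' where h: "h \<in> families i" "a = h 1" "h' \<in> families i" "b = h' 1"
    unfolding Aq_families[of _ i] by blast
  show "specialize i x0 (a + b) = specialize i x0 a + specialize i x0 b"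
    using s[OF families_add[OF h(1,3)]] s[OF h(1)] s[OF h(3)] unfolding h by simp
  show "specialize i x0 (a * b) = specialize i x0 a * specialize i x0 b"
    using s[OF families_mult[OF h(1,3)]] s[OF h(1)] s[OF h(3)] unfolding h by simp
next
  show "specialize i x0 1 = 1" using specialize_eq[OF families_sc[of 1] x0] by simp
next
  fix a assume "a \<in> Aq D \<iota>" "specialize i x0 a = 0"
  then obtain h where h: "h \<in> families i" "a = h 1" "h x0 = 0"
    unfolding Aq_families[of _ i] using specialize_eq[OF _ x0] by metis
  then show "a = 0" using families_vanish[OF h(1) x0 h(3) central_units_one] by simp
qed

text \<open>The substitution x = q^y is carried out for every element y of the rescaled lattice.
  This generality gives the inverse shift by -y at no extra cost.\<close>

definition shift :: "'i \<Rightarrow> 'y \<Rightarrow> 'k \<Rightarrow> 'k" where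
  "shift i y = ore_embedding.ext (Aq D \<iota>) (specialize i (qq y))"

lemma phi_fracs: "phi D \<iota> i j (qq y) \<in> Q.fracs"
proof -
  note A = Q.A_fracs[OF Aq_closed(1)] Q.A_fracs[OF Aq_closed(2)] Q.A_fracs[OF Aq_closed(3)]
    Q.A_fracs[OF Aq_closed(4)]
  have r: "rr i m (qq y) \<in> Q.fracs" for m
    by (induction m)
       (auto simp: rr_Suc A ee_def intro!: Q.fracs_mult Q.fracs_inverse Q.fracs_add Q.fracs_powi)
  consider "orient D i j = 1" | "orient D i j = - 1" | "i = j" | "i \<noteq> j" "orient D i j = 0"
    using orient_cases by blast
  then show ?thesis
    by cases (auto simp: phi_pos phi_neg[OF _ qq_units] phi_diag phi_other r A
        intro!: Q.fracs_mult Q.fracs_inverse Q.fracs_powi)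
qed

lemma families_fracs: "h \<in> families i \<Longrightarrow> h (qq y) \<in> Q.fracs"
  by (induction rule: families.induct)
     (auto simp: phi_fracs Q.fracs_add Q.fracs_mult Q.A_fracs Aq_closed)

section \<open>The automorphism attached to q^y: existence, group law and uniqueness\<close>

context
  fixes i :: 'i and y :: 'y
begin

interpretation E: ore_embedding "Aq D \<iota>" "specialize i (qq y)"
  by (rule ore_embedding_specialize[OF qq_units])

lemma shift_families: "h \<in> families i \<Longrightarrow> shift i y (h 1) = h (qq y)"
  unfolding shift_def by (subst E.ext_A) (auto simp: Aq_families[of _ i] specialize_eq qq_units)

lemma shift_gg: "shift i y (gg j) = phi D \<iota> i j (qq y)"
  using shift_families[OF families_phi, of j] by (simp add: phi_one)

lemma shift_qq: "shift i y (qq z) = qq z"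
  using shift_families[OF families_qq, of z] .

lemma shift_sc: "shift i y (sc c) = sc c"
  using shift_families[OF families_sc, of c] .

lemma shift_fracs: "k \<in> Q.fracs \<Longrightarrow> shift i y k \<in> Q.fracs"
proof -
  assume "k \<in> Q.fracs"
  then obtain a s where as: "a \<in> Aq D \<iota>" "s \<in> Aq D \<iota>" "s \<noteq> 0" "k = a * inverse s"
    unfolding Q.fracs_def by blast
  then obtain h h' where h: "h \<in> families i" "a = h 1" "h' \<in> families i" "s = h' 1"
    unfolding Aq_families[of _ i] by blast
  have "shift i y k = h (qq y) * inverse (h' (qq y))"
    unfolding shift_def as(4) E.ext_frac[OF as(1-3)] unfolding h
    using specialize_eq[OF h(1) qq_units] specialize_eq[OF h(3) qq_units] by simp
  then show ?thesis using h by (simp add: Q.fracs_mult Q.fracs_inverse families_fracs)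
qed

lemmas shift_hom = E.ext_add[folded shift_def] E.ext_mult[folded shift_def] E.ext_one[folded shift_def]
  E.ext_inverse[folded shift_def] E.ext_powi[folded shift_def] E.ext_inj[folded shift_def]
  E.ext_minus[folded shift_def]

lemmas gen_fracs = Q.A_fracs[OF Aq_closed(1)] Q.A_fracs[OF Aq_closed(2)] Q.A_fracs[OF Aq_closed(3)]
  Q.A_fracs[OF Aq_closed(4)]

text \<open>The shift by y multiplies g_i by (q^y)^-2, so the numerators of the shifted second
  product are the denominators of the first one and cancel. What remains are the numerators of the
  first and the denominators for y + z.\<close>

lemma shift_rr: "rr i m (qq y) * shift i y (rr i m (qq z)) = rr i m (qq (y + z))"
proof -
  define c where "c k = qs i k * qq y powi (- 2)" for k
  define d where "d k = qs i k * qq z powi (- 2)" for k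
  define e where "e k = qs i k * qq (y + z) powi (- 2)" for k
  have cu: "c k \<in> central_units" "d k \<in> central_units" "e k \<in> central_units" for k
    unfolding c_def d_def e_def by (intro den_units qq_units)+
  have cF: "d k \<in> Q.fracs" "qs i k \<in> Q.fracs" for k
    unfolding d_def by (auto intro!: Q.fracs_mult Q.fracs_powi gen_fracs)
  have eF: "ee i k \<in> Q.fracs" if "k \<in> Q.fracs" for k
    unfolding ee_def using that by (auto intro!: Q.fracs_add Q.fracs_mult gen_fracs)
  have rF: "rr i m (qq z) \<in> Q.fracs" for m
    by (induction m)
       (auto simp: rr_Suc gen_fracs intro!: Q.fracs_mult Q.fracs_inverse eF Q.fracs_powi)
  have se: "shift i y (ee i k) = ee i (k * qq y powi (- 2))" if "k \<in> Q.fracs" "shift i y k = k" for k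
    unfolding ee_def using that
    by (simp add: shift_hom Q.fracs_mult gen_fracs shift_gg phi_diag mult.assoc)
  have sn: "shift i y (ee i (qs i k)) = ee i (c k)" for k
    unfolding c_def by (rule se) (simp_all add: gen_fracs shift_sc)
  have sd: "shift i y (ee i (d k)) = ee i (e k)" for k
  proof -
    have "qq (y + z) powi (- 2) = qq z powi (- 2) * qq y powi (- 2)"
      by (metis add.commute powi_mult_distrib_central qq_add qq_units)
    then have "d k * qq y powi (- 2) = e k" by (simp add: d_def e_def mult.assoc)
    moreover have "shift i y (d k) = d k"
      unfolding d_def by (simp add: shift_hom Q.fracs_powi gen_fracs shift_sc shift_qq)
    ultimately show ?thesis using se[OF cF(1)[of k]] by simp
  qed
  show ?thesis
  proof (induction m)
    case 0
    show ?case by (simp add: shift_hom)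
  next
    case (Suc m)
    let ?n = "ee i (qs i (2 * int m))" and ?c = "ee i (c (2 * int m))" and ?e = "ee i (e (2 * int m))"
    let ?S = "shift i y (rr i m (qq z))"
    have dcs: "?c \<in> dc i" "rr i m (qq y) \<in> dc i" "?n \<in> dc i"
      by (auto intro!: ee_dc cu qs_units rr_dc qq_units)
    have nz: "?c \<noteq> 0" "rr i m (qq y) \<noteq> 0" by (auto intro!: ee_nonzero cu rr_nonzero qq_units)
    have "rr i m (qq (y + z)) \<in> dc i" by (intro rr_dc qq_units)
    \<comment> \<open>As for conjugation by F, the shifted product is placed in the double
      centralizer by means of the induction hypothesis.\<close>
    then have "inverse (rr i m (qq y)) * (rr i m (qq y) * ?S) \<in> dc i"
      unfolding Suc by (intro double_centralizer_mult double_centralizer_inverse dcs)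
    then have S: "?S \<in> dc i" using nz by (simp add: inverse_mult_cancel)
    have "shift i y (rr i (Suc m) (qq z)) = ?S * (?c * inverse ?e)"
      unfolding rr_Suc d_def[symmetric]
      by (simp add: shift_hom rF eF cF Q.fracs_mult Q.fracs_inverse sn sd)
    then have "rr i (Suc m) (qq y) * shift i y (rr i (Suc m) (qq z))
        = rr i m (qq y) * ((?n * inverse ?c) * ?S) * (?c * inverse ?e)"
      unfolding rr_Suc c_def[symmetric] by (simp add: mult.assoc)
    also have "(?n * inverse ?c) * ?S = ?S * (?n * inverse ?c)"
      by (rule double_centralizer_commute[OF _ S]) (intro double_centralizer_mult double_centralizer_inverse dcs)
    also have "rr i m (qq y) * (?S * (?n * inverse ?c)) * (?c * inverse ?e)
        = (rr i m (qq y) * ?S) * (?n * (inverse ?c * (?c * inverse ?e)))" by (simp only: mult.assoc)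
    also have "\<dots> = rr i (Suc m) (qq (y + z))"
      unfolding Suc rr_Suc e_def[symmetric] inverse_mult_cancel[OF nz(1)] ..
    finally show ?case .
  qed
qed

text \<open>The additive law in y behind surjectivity: for z = -y the right-hand side is phi_ij(1) =
  g_j.\<close>

lemma shift_phi: "shift i y (phi D \<iota> i j (qq z)) = phi D \<iota> i j (qq (y + z))"
proof -
  have sz: "shift i y (qq z powi k) = qq z powi k" "qq z powi k \<in> Q.fracs" for k
    by (simp_all add: shift_hom gen_fracs shift_qq Q.fracs_powi)
  have rF: "rr i m (qq z) \<in> Q.fracs" for m
    by (induction m)
       (auto simp: rr_Suc gen_fracs ee_def intro!: Q.fracs_add Q.fracs_mult Q.fracs_inverse Q.fracs_powi)
  have pw: "qq (y + z) powi k = qq z powi k * qq y powi k" for k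
    using powi_mult_distrib_central[OF qq_units, of z "qq y" k] by (simp add: add.commute flip: qq_add)
  define m where "m = nat (- cartan D i j)"
  consider "orient D i j = 1" | "orient D i j = - 1" | "i = j" | "i \<noteq> j" "orient D i j = 0"
    using orient_cases by blast
  then show ?thesis
  proof cases
    case 1
    show ?thesis
      unfolding phi_pos[OF 1] m_def[symmetric] shift_rr[symmetric]
      by (simp add: shift_hom gen_fracs rF shift_gg phi_pos[OF 1] m_def mult.assoc)
  next
    case 2
    let ?r = "rr i m (qq y)" and ?S = "shift i y (rr i m (qq z))" and ?k = "- 2 * cartan D i j"
    have nz: "?r \<noteq> 0" "?S \<noteq> 0"
      using rr_nonzero[OF qq_units] shift_rr[of m z] by (metis mult_zero_right)+
    have "shift i y (phi D \<iota> i j (qq z)) = qq z powi ?k * inverse ?S * (qq y powi ?k * inverse ?r * gg j)"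
      unfolding phi_neg[OF 2 qq_units] m_def[symmetric]
      by (simp add: shift_hom gen_fracs rF sz Q.fracs_mult Q.fracs_inverse shift_gg phi_neg[OF 2 qq_units] flip: m_def)
    also have "\<dots> = qq z powi ?k * (inverse ?S * qq y powi ?k) * inverse ?r * gg j"
      by (simp only: mult.assoc)
    also have "inverse ?S * qq y powi ?k = qq y powi ?k * inverse ?S"
      by (rule central_units_commute[OF central_units_powi[OF qq_units]])
    also have "qq z powi ?k * (qq y powi ?k * inverse ?S) * inverse ?r * gg j
        = (qq z powi ?k * qq y powi ?k) * (inverse ?S * inverse ?r) * gg j" by (simp only: mult.assoc)
    also have "\<dots> = phi D \<iota> i j (qq (y + z))"
      unfolding phi_neg[OF 2 qq_units] m_def[symmetric] shift_rr[symmetric] pw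
        nonzero_inverse_mult_distrib[OF nz] ..
    finally show ?thesis .
  next
    case 3
    show ?thesis
      unfolding 3[symmetric] phi_diag pw
      by (simp add: shift_hom gen_fracs sz shift_gg phi_diag mult.assoc)
  next
    case 4
    then show ?thesis by (simp add: phi_other shift_gg)
  qed
qed

lemma shift_surj: "k \<in> Q.fracs \<Longrightarrow> k \<in> shift i y ` Q.fracs"
proof -
  have I: "k \<in> shift i y ` Q.fracs" if "k' \<in> Q.fracs" "shift i y k' = k" for k k'
    using that by blast
  have A: "a \<in> shift i y ` Q.fracs" if "a \<in> Aq D \<iota>" for a
    using that
  proof (induction rule: Aq_induct)
    case (sc c)
    show ?case by (rule I[OF _ shift_sc]) (rule gen_fracs)
  next
    case (gg j)
    show ?case by (rule I[OF phi_fracs shift_phi[of j "- y", simplified qq_zero phi_one right_minus]])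
  next
    case (qq z)
    show ?case by (rule I[OF _ shift_qq]) (rule gen_fracs)
  next
    case (minus a)
    then obtain b where b: "b \<in> Q.fracs" "a = shift i y b" by blast
    have "sc (- 1) * b \<in> Q.fracs" by (intro Q.fracs_mult gen_fracs b)
    then show ?case
      by (rule I) (simp add: shift_hom Q.fracs_mult gen_fracs b shift_sc S.sc_minus del: mult_minus_left)
  next
    case (add a b)
    then obtain a' b' where "a' \<in> Q.fracs" "a = shift i y a'" "b' \<in> Q.fracs" "b = shift i y b'" by blast
    then show ?case by (intro I[of "a' + b'"]) (simp_all add: shift_hom Q.fracs_add)
  next
    case (mult a b)
    then obtain a' b' where "a' \<in> Q.fracs" "a = shift i y a'" "b' \<in> Q.fracs" "b = shift i y b'" by blast
    then show ?case by (intro I[of "a' * b'"]) (simp_all add: shift_hom Q.fracs_mult)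
  qed
  assume "k \<in> Q.fracs"
  then obtain a s where "a \<in> Aq D \<iota>" "s \<in> Aq D \<iota>" "k = a * inverse s"
    unfolding Q.fracs_def by blast
  then obtain a' s' where "a' \<in> Q.fracs" "s' \<in> Q.fracs" "k = shift i y a' * inverse (shift i y s')"
    using A by blast
  then show ?thesis by (intro I[of "a' * inverse s'"]) (simp_all add: shift_hom Q.fracs_mult Q.fracs_inverse)
qed

lemma shift_automorphism:
  "restrict (shift i y) (QAq D \<iota>) \<in> algebra_auts (scal D \<iota>) (QAq D \<iota>)"
proof -
  have "inj_on (restrict (shift i y) Q.fracs) Q.fracs"
    using shift_hom(6) by (simp add: inj_on_restrict_eq)
  moreover have "restrict (shift i y) Q.fracs ` Q.fracs = Q.fracs"
    using shift_surj shift_fracs by auto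
  ultimately show ?thesis
    unfolding algebra_auts_def QAq_fracs ring_iso_def ring_hom_def bij_betw_def
    by (auto simp: ring_of_type_algebra_def shift_fracs shift_hom Q.fracs_add Q.fracs_mult gen_fracs shift_sc)
qed

text \<open>The prescribed values determine \<gamma>(h(1)) = h(q^y) for every family h, hence
  \<gamma> on A_q; fractions follow by clearing the denominator, and outside Q(A_q) extensionality
  decides.\<close>

lemma shift_unique:
  assumes "\<gamma> \<in> algebra_auts (scal D \<iota>) (QAq D \<iota>)"
    "\<And>j. \<gamma> (gg j) = phi D \<iota> i j (qq y)" "\<And>z. \<gamma> (qq z) = qq z"
  shows "\<gamma> = restrict (shift i y) (QAq D \<iota>)"
proof
  have \<gamma>: "\<gamma> (k + l) = \<gamma> k + \<gamma> l" "\<gamma> (k * l) = \<gamma> k * \<gamma> l" "\<gamma> 1 = 1" "\<gamma> (sc c * k) = sc c * \<gamma> k"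
    if "k \<in> Q.fracs" "l \<in> Q.fracs" for k l c
    using assms(1) that unfolding algebra_auts_def QAq_fracs ring_iso_def ring_hom_def
    by (auto simp: ring_of_type_algebra_def)
  have sc: "\<gamma> (sc c) = sc c" for c
    using \<gamma>(3)[OF gen_fracs(4) gen_fracs(4)] \<gamma>(4)[OF gen_fracs(4) gen_fracs(4), of c] by simp
  have fam: "h 1 \<in> Q.fracs \<and> \<gamma> (h 1) = h (qq y)" if "h \<in> families i" for h
    using that by (induction rule: families.induct)
      (auto simp: gen_fracs sc assms phi_one \<gamma> Q.fracs_add Q.fracs_mult)
  fix k
  show "\<gamma> k = restrict (shift i y) (QAq D \<iota>) k"
  proof (cases "k \<in> Q.fracs")
    case False
    then show ?thesis
      using assms(1) unfolding algebra_auts_def QAq_fracs by (auto simp: extensional_def)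
  next
    case True
    then obtain a s where as: "a \<in> Aq D \<iota>" "s \<in> Aq D \<iota>" "s \<noteq> 0" "k = a * inverse s"
      unfolding Q.fracs_def by blast
    then obtain h h' where h: "h \<in> families i" "a = h 1" "h' \<in> families i" "s = h' 1"
      unfolding Aq_families[of _ i] by blast
    \<comment> \<open>Multiplying by s reduces the comparison to elements of A_q and to the
      nonvanishing of the shifted s, so that \<gamma> never has to be applied to an inverse.\<close>
    have ks: "k * s = a" using as by (simp add: mult.assoc)
    have sF: "s \<in> Q.fracs" using as Q.A_fracs by blast
    have \<gamma>s: "\<gamma> s = shift i y s" "\<gamma> a = shift i y a"
      using fam[OF h(1)] fam[OF h(3)] shift_families[OF h(1)] shift_families[OF h(3)] by (simp_all add: h)
    have "shift i y s \<noteq> 0" using E.ext_eq_0[OF sF] as(3) by (simp add: shift_def)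
    moreover have "\<gamma> k * shift i y s = shift i y k * shift i y s"
      using \<gamma>(2)[OF True sF] shift_hom(2)[OF True sF] by (simp add: ks \<gamma>s)
    ultimately show ?thesis using True by (simp add: QAq_fracs)
  qed
qed

end

end

theorem mainTheorem6:
  fixes D :: "('i::finite, 'x::ab_group_add, 'y::ab_group_add) quantum_datum"
    and \<iota> :: "('i, 'y) aqt_elem \<Rightarrow> 'k::division_ring"
  assumes "quantum_datum D"
    and "skew_field_of_fractions (Aqt D) \<iota>"
  shows "(\<forall>(n::int) i j.
            (f1 D \<iota> i + f2 D \<iota> i) powi n * g D \<iota> j * (f1 D \<iota> i + f2 D \<iota> i) powi (- n)
              = phi D \<iota> i j (scal D \<iota> (qi D i powi n)))
       \<and> (\<forall>i (l::'y). \<exists>!\<gamma>. \<gamma> \<in> algebra_auts (scal D \<iota>) (QAq D \<iota>)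
            \<and> (\<forall>j. \<gamma> (g D \<iota> j) = phi D \<iota> i j (qpow D \<iota> (zmul (wt D i) l)))
            \<and> (\<forall>y. \<gamma> (qpow D \<iota> y) = qpow D \<iota> y))"
proof -
  interpret qfractions D \<iota> using assms by (rule qfractions.intro)
  show ?thesis
  proof (intro conjI allI)
    fix n :: int and i j
    show "(f1 D \<iota> i + f2 D \<iota> i) powi n * g D \<iota> j * (f1 D \<iota> i + f2 D \<iota> i) powi (- n)
        = phi D \<iota> i j (scal D \<iota> (qi D i powi n))"
      \<comment> \<open>The conjugation formula at the point x = 1, where phi_ij(1) = g_j.\<close>
      using cj_ff_powi[OF central_units_one, of i n j] by (simp add: ff_def phi_one)
  next
    fix i and l :: 'y
    let ?y = "zmul (wt D i) l"
    \<comment> \<open>The candidate is restricted to Q(A_q), so the generators have to be recognized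
      as elements of it before its values at them can be read off.\<close>
    have "g D \<iota> j \<in> QAq D \<iota>" "qpow D \<iota> z \<in> QAq D \<iota>" for j z
      by (simp_all add: QAq_fracs gen_fracs)
    then show "\<exists>!\<gamma>. \<gamma> \<in> algebra_auts (scal D \<iota>) (QAq D \<iota>)
        \<and> (\<forall>j. \<gamma> (g D \<iota> j) = phi D \<iota> i j (qpow D \<iota> ?y))
        \<and> (\<forall>y. \<gamma> (qpow D \<iota> y) = qpow D \<iota> y)"
      by (intro ex1I[of _ "restrict (shift i ?y) (QAq D \<iota>)"])
         (simp_all add: shift_automorphism shift_gg shift_qq shift_unique)
  qed
qed

end
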